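(* Let $\lambda,\mu,\kappa$ be infinite cardinals such that $\lambda=\mu^{+}$, $\mathrm{cf}(\mu)=\mu$, $\kappa=\mathrm{cf}(\kappa)\le\mu$ and $\lambda^{<\kappa}=\lambda$. Then there are $\lambda^{+},\kappa+1$-trees $I_{0}$ and $I_{1}$ such that $I_{0}\not\cong I_{1}$ and $$I_{0}\equiv^{\lambda}_{\mu\times\kappa}I_{1}.$$ If moreover $\lambda^{\kappa}=\lambda$, then $I_{0}$ and $I_{1}$ can be taken of cardinality $\lambda$.
   Context: Trees. A tree is a partial order $(t,<)$ such that for each $x\in t$ the set $\mathrm{pred}(x)=\{y\in t : y<x\}$ is well-ordered by $<$. Trees are regarded as structures in the language $\{<\}$; ordinals are also trees. Write $x\sim y$ if $\mathrm{pred}(x)=\mathrm{pred}(y)$, and let $[x]$ be the $\sim$-class of $x$. A $\lambda^{+},\kappa+1$-tree is a tree $I$ such that: (i) $|[x]|<\lambda^{+}$ for every $x\in I$; (ii) for every $x\in I$ the order type of $\mathrm{pred}(x)$ is at most $\kappa$ (so levels $0,1,\dots,\kappa$ may be nonempty, and there are no higher levels); (iii) $I$ has a unique root; (iv) if $x,y\in I$ have no immediate predecessors and $x\sim y$, then $x=y$. Game. Let $t$ be a tree, $\lambda$ a cardinal and $\mathcal A,\mathcal B$ structures in the same relational language. In the Ehrenfeucht-Fraisse game $G^{\lambda}_{t}(\mathcal A,\mathcal B)$, at each move $\alpha$ player $\forall$ chooses $x_\alpha\in t$, some $\lambda_\alpha<\lambda$ and either elements $a_\alpha^\beta\in\mathcal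 A$ ($\beta<\lambda_\alpha$) or elements $b_\alpha^\beta\in\mathcal B$ ($\beta<\lambda_\alpha$); then player $\exists$ answers with $b_\alpha^\beta\in\mathcal B$ ($\beta<\lambda_\alpha$) in the first case and with $a_\alpha^\beta\in\mathcal A$ ($\beta<\lambda_\alpha$) in the second. Player $\forall$ must move so that $(x_\beta)_{\beta\le\alpha}$ is strictly increasing in $t$; player $\exists$ must move so that $\{(a_\gamma^\beta,b_\gamma^\beta):\gamma\le\alpha,\ \beta<\lambda_\gamma\}$ is a partial isomorphism from $\mathcal A$ to $\mathcal B$. The player who first has to break the rules loses. $\mathcal A\equiv^{\lambda}_{t}\mathcal B$ means that $\exists$ has a winning strategy in $G^{\lambda}_{t}(\mathcal A,\mathcal B)$. $\mu\times\kappa$ denotes the ordinal product ($\kappa$ consecutive copies of $\mu$), regarded as a tree. *)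

theory Defs
  imports Main
begin

unbundle cardinal_syntax

text \<open>
  As in the library theories on well-orders and cardinals, an order is a reflexive relation
  whose universe is its \<open>Field\<close>. In a tree, the strict set of predecessors
  of \<open>x\<close> is the library's \<open>underS t x\<close>, and an ordinal is a relation
  satisfying \<open>Well_order\<close>. For an ordinal \<open>r\<close>, a point \<open>i \<in> Field r\<close> stands for the ordinal
  \<open>underS r i\<close>; in this way \<open>Field r\<close> is the set of all ordinals below \<open>r\<close>.
\<close>

section \<open>Cardinal and ordinal arithmetic\<close>

text \<open>The cardinality of the set of all sequences of length less than \<open>k\<close> in \<open>l\<close>;
  the tag \<open>i\<close> is the length of the sequence.\<close>

definition cexp_less :: "'l rel \<Rightarrow> 'k rel \<Rightarrow> ('k \<times> ('k \<Rightarrow> 'l)) rel" (infixr \<open>^<c\<close> 90) where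
  "l ^<c k = |SIGMA i : Field k. Func (underS k i) (Field l)|"

text \<open>The ordinal product: \<open>k\<close> consecutive copies of \<open>m\<close>.\<close>

definition ord_prod :: "'m rel \<Rightarrow> 'k rel \<Rightarrow> ('m \<times> 'k) rel" where
  "ord_prod m k =
     {((a, b), (a', b')). a \<in> Field m \<and> a' \<in> Field m \<and> b \<in> Field k \<and> b' \<in> Field k \<and>
        ((b, b') \<in> k \<and> b \<noteq> b' \<or> b = b' \<and> (a, a') \<in> m)}"


section \<open>Structures with one binary relation\<close>

type_synonym 'a struct = "'a set \<times> 'a rel"

definition isomorphic :: "'a struct \<Rightarrow> 'b struct \<Rightarrow> bool" where
  "isomorphic A B \<longleftrightarrow>
     (\<exists>f. bij_betw f (fst A) (fst B) \<and>
          (\<forall>x\<in>fst A. \<forall>y\<in>fst A. (x, y) \<in> snd A \<longleftrightarrow> (f x, f y) \<in> snd B))"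

text \<open>A partial isomorphism is given by its graph.\<close>

definition partial_iso :: "'a struct \<Rightarrow> 'b struct \<Rightarrow> ('a \<times> 'b) set \<Rightarrow> bool" where
  "partial_iso A B P \<longleftrightarrow>
     P \<subseteq> fst A \<times> fst B \<and>
     (\<forall>(a, b)\<in>P. \<forall>(a', b')\<in>P.
        (a = a' \<longleftrightarrow> b = b') \<and> ((a, a') \<in> snd A \<longleftrightarrow> (b, b') \<in> snd B))"


section \<open>Trees\<close>

definition is_tree :: "'a rel \<Rightarrow> bool" where
  "is_tree t \<longleftrightarrow> Partial_order t \<and> (\<forall>x\<in>Field t. Well_order (Restr t (underS t x)))"

text \<open>A tree as a structure in the language \<open>{<}\<close>, where \<open><\<close> is the strict order.\<close>

definition tree_struct :: "'a rel \<Rightarrow> 'a struct" where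
  "tree_struct t = (Field t, t - Id)"

definition same_pred_class :: "'a rel \<Rightarrow> 'a \<Rightarrow> 'a set" where
  "same_pred_class t x = {y \<in> Field t. underS t y = underS t x}"

definition immediate_pred :: "'a rel \<Rightarrow> 'a \<Rightarrow> 'a \<Rightarrow> bool" where
  "immediate_pred t y x \<longleftrightarrow> y \<in> underS t x \<and> (\<nexists>z. y \<in> underS t z \<and> z \<in> underS t x)"

text \<open>\<open>wide_tree l k\<close> describes the \<open>l\<^sup>+, k+1\<close>-trees.\<close>

definition wide_tree :: "'l rel \<Rightarrow> 'k rel \<Rightarrow> 'a rel \<Rightarrow> bool" where
  "wide_tree l k t \<longleftrightarrow>
     is_tree t \<and>
     (\<forall>x\<in>Field t. |same_pred_class t x| <o cardSuc l) \<and>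
     (\<forall>x\<in>Field t. Restr t (underS t x) \<le>o k) \<and>
     (\<exists>!x. x \<in> Field t \<and> underS t x = {}) \<and>
     (\<forall>x\<in>Field t. \<forall>y\<in>Field t.
        (\<nexists>z. immediate_pred t z x) \<and> (\<nexists>z. immediate_pred t z y) \<and>
        underS t x = underS t y \<longrightarrow> x = y)"


section \<open>The Ehrenfeucht-Fraisse game\<close>

text \<open>
  Besides a tree element, a move of the player \<open>\<forall>\<close> consists of an ordinal \<open>i < l\<close>
  and a sequence of length \<open>i\<close> in one of the two structures.
\<close>

datatype ('i, 'a, 'b) move = ChooseA 'i "'i \<Rightarrow> 'a" | ChooseB 'i "'i \<Rightarrow> 'b"

fun legal_move :: "'i rel \<Rightarrow> 'a struct \<Rightarrow> 'b struct \<Rightarrow> ('i, 'a, 'b) move \<Rightarrow> bool" where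
  "legal_move l A B (ChooseA i s) \<longleftrightarrow> i \<in> Field l \<and> s \<in> Func (underS l i) (fst A)"
| "legal_move l A B (ChooseB i s) \<longleftrightarrow> i \<in> Field l \<and> s \<in> Func (underS l i) (fst B)"

text \<open>
  The tree elements chosen by \<open>\<forall>\<close> are strictly increasing, so the sequence of them is
  determined by its range, which is a chain of the tree; conversely, every chain of a tree is
  well-ordered, hence is the range of exactly one strictly increasing sequence indexed by an
  ordinal. Hence a sequence of moves of \<open>\<forall>\<close> is encoded as a partial map \<open>p\<close> which
  sends each chosen tree element to the rest of the move in which it was chosen, and the moves
  of \<open>\<forall>\<close> up to and including the one at \<open>x\<close> are \<open>history t p x\<close>.
\<close>

type_synonym ('t, 'i, 'a, 'b) play = "'t \<rightharpoonup> ('i, 'a, 'b) move"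

definition legal_play ::
  "'i rel \<Rightarrow> 't rel \<Rightarrow> 'a struct \<Rightarrow> 'b struct \<Rightarrow> ('t, 'i, 'a, 'b) play \<Rightarrow> bool" where
  "legal_play l t A B p \<longleftrightarrow> dom p \<in> Chains t \<and> (\<forall>q\<in>ran p. legal_move l A B q)"

definition history :: "'t rel \<Rightarrow> ('t, 'i, 'a, 'b) play \<Rightarrow> 't \<Rightarrow> ('t, 'i, 'a, 'b) play" where
  "history t p x = p |` under t x"

text \<open>
  A strategy of \<open>\<exists>\<close> sends the moves of \<open>\<forall>\<close> so far to a sequence answering the last of them.
  It has two components, giving the answer in \<open>A\<close> to a move in \<open>B\<close> and
  the answer in \<open>B\<close> to a move in \<open>A\<close>.
\<close>

type_synonym ('t, 'i, 'a, 'b) strategy =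
  "(('t, 'i, 'a, 'b) play \<Rightarrow> 'i \<Rightarrow> 'a) \<times> (('t, 'i, 'a, 'b) play \<Rightarrow> 'i \<Rightarrow> 'b)"

fun answered :: "'i rel \<Rightarrow> ('t, 'i, 'a, 'b) strategy \<Rightarrow> ('t, 'i, 'a, 'b) play \<Rightarrow>
    ('i, 'a, 'b) move \<Rightarrow> ('a \<times> 'b) set" where
  "answered l S h (ChooseA i s) = {(s j, snd S h j) |j. j \<in> underS l i}"
| "answered l S h (ChooseB i s) = {(fst S h j, s j) |j. j \<in> underS l i}"

text \<open>The pairs of elements collected up to and including the move at \<open>x\<close>.\<close>

definition position :: "'i rel \<Rightarrow> 't rel \<Rightarrow> ('t, 'i, 'a, 'b) strategy \<Rightarrow>
    ('t, 'i, 'a, 'b) play \<Rightarrow> 't \<Rightarrow> ('a \<times> 'b) set" where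
  "position l t S p x =
     (\<Union>y \<in> dom p \<inter> under t x. answered l S (history t p y) (the (p y)))"

text \<open>
  Every play ends with one of the players unable to obey the rules, so \<open>\<exists>\<close> wins
  precisely when she obeys them as long as \<open>\<forall>\<close> does.
\<close>

definition winning_strategy :: "'i rel \<Rightarrow> 't rel \<Rightarrow> 'a struct \<Rightarrow> 'b struct \<Rightarrow>
    ('t, 'i, 'a, 'b) strategy \<Rightarrow> bool" where
  "winning_strategy l t A B S \<longleftrightarrow>
     (\<forall>p. legal_play l t A B p \<longrightarrow> (\<forall>x\<in>dom p. partial_iso A B (position l t S p x)))"

definition EF_equiv :: "'i rel \<Rightarrow> 't rel \<Rightarrow> 'a struct \<Rightarrow> 'b struct \<Rightarrow> bool" where
  "EF_equiv l t A B \<longleftrightarrow> (\<exists>S. winning_strategy l t A B S)"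

end

(*
  Call a point of l special if it has cofinality m. The nodes of the larger tree are sequences of
  letters of length at most k. A sequence starts with raw letters, which are distinct special
  points, and may then continue with plain letters (y, j); the smaller tree consists of the
  sequences without raw letters. Every letter carries a label, and the label of the letter after a
  raw letter x has to be x. A plain letter (y, j) is good if j lies in a fixed set J of
  cardinality m and y is smaller than the label of the next letter. A sequence of length k is kept
  if from some point on all its letters are raw or good.

  An isomorphism preserves labels. By Fodor's lemma it cannot send every raw letter x injectively to
  a plain letter (y, j) with j in J and y < x. Hence there is a branch of raw letters whose image has
  no good letter, although the branch itself is kept.

  In the game, the player who has to answer commits, at each move, to a bound in l for everything
  that has been played. If I is the set of her bounds, she maps a raw letter x to a good plain
  letter whose first component y < x has no point of I between y and x. This fails only if x is a
  special limit point of I, which occurs at most once in each copy of m, so that fewer than k raw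
  letters are mapped to bad ones and the same sequences of length k are kept on both sides.
*)
theory Submission
  imports Defs
begin

section \<open>Well-orders and cardinals\<close>

text \<open>Why labels lag one letter behind: what an isomorphism is shown to preserve about a
  letter is its label, through the gadgets hung below it, and not its \<open>arg\<close> or
  \<open>copy\<close>. If a raw letter carried its own point as label, injectivity on sibling
  letters would come for free and Fodor's lemma would have no grip.

  Why there is a second component: all raw points between two neighbouring commitments may receive
  the same smaller value, and there can be \<open>m\<close> of them. A set \<open>J\<close> of size
  \<open>m\<close> tells them apart, and since second components range over \<open>l\<close> many
  values, the plain letters already there can be shifted aside.

  Why this is possible in the game but not for an isomorphism: below a set of commitments only limit
  points resist being moved down, whereas a map defined on all special points must meet a point that
  it does not move down.\<close>

lemma Well_order_trans: "Well_order r \<Longrightarrow> (a, b) \<in> r \<Longrightarrow> (b, c) \<in> r \<Longrightarrow> (a, c) \<in> r"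
  using wo_rel.TRANS[of r] unfolding wo_rel_def trans_def by blast

lemma Well_order_antisym: "Well_order r \<Longrightarrow> (a, b) \<in> r \<Longrightarrow> (b, a) \<in> r \<Longrightarrow> a = b"
  using wo_rel.ANTISYM[of r] unfolding wo_rel_def antisym_def by blast

lemma underS_trans:
  assumes "Well_order r" "a \<in> underS r b" "b \<in> underS r c"
  shows "a \<in> underS r c"
  using assms Well_order_trans[OF assms(1), of a b c] Well_order_antisym[OF assms(1), of a b]
  unfolding underS_def by blast

lemma underS_rel_trans:
  assumes "Well_order r" "a \<in> underS r b" "(b, c) \<in> r"
  shows "a \<in> underS r c"
  using assms Well_order_trans[OF assms(1), of a b c] Well_order_antisym[OF assms(1), of a b]
  unfolding underS_def by blast

lemma rel_underS_trans:
  assumes "Well_order r" "(a, b) \<in> r" "b \<in> underS r c"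
  shows "a \<in> underS r c"
  using assms Well_order_trans[OF assms(1), of a b c] Well_order_antisym[OF assms(1), of a b]
  unfolding underS_def by blast

lemma underS_asym: "Well_order r \<Longrightarrow> a \<in> underS r b \<Longrightarrow> b \<notin> underS r a"
  using underS_trans[of r a b a] underS_notIn[of a r] by blast

lemma underS_trichotomy:
  assumes "Well_order r" "a \<in> Field r" "b \<in> Field r"
  shows "a \<in> underS r b \<or> a = b \<or> b \<in> underS r a"
  using wo_rel.TOTALS[of r] assms unfolding wo_rel_def underS_def by blast

lemma underS_Field_both: "a \<in> underS r b \<Longrightarrow> a \<in> Field r \<and> b \<in> Field r"
  unfolding underS_def Field_def by auto

lemma underS_imp_rel: "a \<in> underS r b \<Longrightarrow> (a, b) \<in> r"
  unfolding underS_def by auto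

lemma Well_order_refl: "Well_order r \<Longrightarrow> a \<in> Field r \<Longrightarrow> (a, a) \<in> r"
  using wo_rel.REFL[of r] unfolding wo_rel_def refl_on_def by blast

lemma not_underS_iff:
  assumes "Well_order r" "a \<in> Field r" "b \<in> Field r"
  shows "a \<notin> underS r b \<longleftrightarrow> (b, a) \<in> r"
proof
  show "(b, a) \<in> r" if "a \<notin> underS r b"
    using underS_trichotomy[OF assms] that Well_order_refl[OF assms(1,2)] underS_imp_rel[of b r a] by blast
  show "a \<notin> underS r b" if "(b, a) \<in> r"
    using rel_underS_trans[OF assms(1) that, of b] underS_notIn[of b r] by blast
qed

lemma wf_underS: "Well_order r \<Longrightarrow> wf {(a, b). a \<in> underS r b}"
  by (rule wf_subset[of "r - Id"]) (auto simp: underS_def well_order_on_def)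

lemma Well_order_least:
  assumes "Well_order r" "A \<subseteq> Field r" "A \<noteq> {}"
  obtains a where "a \<in> A" "\<And>b. b \<in> A \<Longrightarrow> (a, b) \<in> r"
proof -
  obtain a where a: "a \<in> A" "\<And>b. b \<in> underS r a \<Longrightarrow> b \<notin> A"
    using wfE_min[OF wf_underS[OF assms(1)], of _ A] assms(3) by (metis (no_types, lifting) case_prodI ex_in_conv mem_Collect_eq)
  have "(a, b) \<in> r" if "b \<in> A" for b
    using not_underS_iff[OF assms(1), of b a] a that assms(2) by blast
  with a(1) show thesis by (rule that)
qed

lemma Cinfinite_Well_order: "Cinfinite r \<Longrightarrow> Well_order r"
  by (simp add: card_order_on_well_order_on)

lemma Cinfinite_greater:
  assumes "Cinfinite r" "a \<in> Field r"
  obtains b where "a \<in> underS r b"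
  using infinite_Card_order_limit[of r a] assms unfolding cinfinite_def underS_def by blast

lemma Cinfinite_under_less:
  assumes "Cinfinite r" "a \<in> Field r"
  shows "|under r a| <o r"
proof -
  obtain b where b: "a \<in> underS r b" using Cinfinite_greater[OF assms] .
  then have "under r a \<subseteq> underS r b"
    using rel_underS_trans[OF Cinfinite_Well_order[OF assms(1)]] unfolding under_def by blast
  then have "|under r a| \<le>o |underS r b|" by (rule card_of_mono1)
  moreover have "|underS r b| <o r"
    using card_of_underS[of r b] assms underS_Field_both[OF b] by blast
  ultimately show ?thesis by (rule ordLeq_ordLess_trans)
qed

text \<open>A set that is too small to be cofinal has a weak bound; one further point of the limit
  order makes it strict.\<close>

lemma regularCard_bounded:
  assumes r: "Cinfinite r" "regularCard r" and A: "A \<subseteq> Field r" "|A| <o r"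
  obtains b where "b \<in> Field r" "A \<subseteq> underS r b"
proof -
  have "\<not> cofinal A r"
    using r(2) A(1) not_ordLess_ordIso[OF A(2)] unfolding regularCard_def by blast
  then obtain a where a: "a \<in> Field r" "\<And>b. b \<in> A \<Longrightarrow> a = b \<or> (a, b) \<notin> r"
    unfolding cofinal_def by blast
  then have "b \<notin> A" if "a \<in> underS r b" for b using that unfolding underS_def by blast
  then have le: "\<And>b. b \<in> A \<Longrightarrow> (b, a) \<in> r"
    using not_underS_iff[OF Cinfinite_Well_order[OF r(1)] a(1)] A(1) by blast
  obtain c where c: "a \<in> underS r c" using Cinfinite_greater[OF r(1) a(1)] .
  have "A \<subseteq> underS r c"
    using rel_underS_trans[OF Cinfinite_Well_order[OF r(1)] le c] by blast
  with that underS_Field_both[OF c] show thesis by blast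
qed

lemma card_of_UN_ordLeq_Cinfinite:
  assumes "Cinfinite r" "|I| \<le>o r" "\<And>i. i \<in> I \<Longrightarrow> |A i| \<le>o r"
  shows "|\<Union>i\<in>I. A i| \<le>o r"
  using card_of_UNION_ordLeq_infinite_Field[of r I A] assms unfolding cinfinite_def by blast

lemma card_of_image_ordLeq: "|A| \<le>o r \<Longrightarrow> |f ` A| \<le>o r"
  using ordLeq_transitive[OF card_of_image] .

lemma card_of_image_ordLess: "|A| <o r \<Longrightarrow> |f ` A| <o r"
  using ordLeq_ordLess_trans[OF card_of_image] .


section \<open>The setting\<close>

locale successor_cardinal =
  fixes l :: "'l rel" and m :: "'m rel" and k :: "'k rel"
  assumes Cl: "Cinfinite l" and Cm: "Cinfinite m" and Ck: "Cinfinite k"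
    and lm: "l =o cardSuc m" and reg_m: "regularCard m" and reg_k: "regularCard k"
    and km: "k \<le>o m"
begin

lemma wol: "Well_order l" and wom: "Well_order m" and wok: "Well_order k"
  using Cl Cm Ck Cinfinite_Well_order by blast+

lemma reg_l: "regularCard l"
  using regularCard_ordIso[OF ordIso_symmetric[OF lm]] Cinfinite_cardSuc[OF Cm]
    regularCard_cardSuc[OF Cm] by blast

lemma less_l_iff: "|A| <o l \<longleftrightarrow> |A| \<le>o m"
proof -
  have "|A| <o l \<longleftrightarrow> |A| <o cardSuc m"
    using ordLess_ordIso_trans[OF _ lm] ordLess_ordIso_trans[OF _ ordIso_symmetric[OF lm]] by metis
  then show ?thesis using cardSuc_ordLeq_ordLess[of m "|A|"] Cm card_of_Card_order by blast
qed

lemma bounded_l: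
  assumes "A \<subseteq> Field l" "|A| \<le>o m"
  obtains b where "b \<in> Field l" "A \<subseteq> underS l b"
  using regularCard_bounded[OF Cl reg_l assms(1)] assms(2) less_l_iff by blast

lemma card_underS_l: "|underS l b| \<le>o m"
proof (cases "b \<in> Field l")
  case True
  then show ?thesis using card_of_underS[of l b] Cl less_l_iff by blast
next
  case False
  then show ?thesis using underS_empty[of b l] card_of_empty1[of m] wom by simp
qed

text \<open>The points of cofinality \<open>m\<close> in \<open>l\<close>.\<close>

definition special :: "'l set" where
  "special = {d \<in> Field l. \<forall>K \<subseteq> underS l d. |K| <o m \<longrightarrow> (\<exists>c \<in> underS l d. K \<subseteq> underS l c)}"

text \<open>
  If \<open>I\<close> is the set of bounds that \<open>\<exists>\<close> has committed to, then the special limit points of \<open>I\<close>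
  are the points that she can no longer map to smaller values.
\<close>

definition limit_point :: "'l set \<Rightarrow> 'l \<Rightarrow> bool" where
  "limit_point I x \<longleftrightarrow> (\<forall>y \<in> underS l x. \<exists>i\<in>I. y \<in> underS l i \<and> i \<in> underS l x)"

text \<open>Only points reached by some commitment count: a bounded raw letter has such a point, and
  there is then a first commitment that reaches it.\<close>

definition bad :: "'l set \<Rightarrow> 'l set" where
  "bad I = {x \<in> special. (\<exists>i\<in>I. (x, i) \<in> l) \<and> limit_point I x}"

text \<open>Taking the least strict bound makes bounds monotone in the set and lets a supremum be
  written as a value of \<open>bound\<close>.\<close>

definition bound :: "'l set \<Rightarrow> 'l" where
  "bound K = wo_rel.minim l {i \<in> Field l. K \<subseteq> underS l i}"

lemma wo_rel_l: "wo_rel l"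
  unfolding wo_rel_def by (rule wol)

lemma bound:
  assumes "K \<subseteq> Field l" "|K| \<le>o m"
  shows "bound K \<in> Field l" "K \<subseteq> underS l (bound K)"
proof -
  have "{i \<in> Field l. K \<subseteq> underS l i} \<noteq> {}" using bounded_l[OF assms] by blast
  then have "bound K \<in> {i \<in> Field l. K \<subseteq> underS l i}"
    unfolding bound_def by (intro wo_rel.minim_in[OF wo_rel_l]) auto
  then show "bound K \<in> Field l" "K \<subseteq> underS l (bound K)" by auto
qed

lemma bound_mono:
  assumes "K \<subseteq> K'" "K' \<subseteq> Field l" "|K'| \<le>o m"
  shows "(bound K, bound K') \<in> l"
  unfolding bound_def[of K]
  by (rule wo_rel.minim_least[OF wo_rel_l]) (use assms bound[of K'] in auto)

abbreviation clock :: "('m \<times> 'k) rel" where "clock \<equiv> ord_prod m k"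

lemma clock_iff:
  "(x, y) \<in> clock \<longleftrightarrow> fst x \<in> Field m \<and> fst y \<in> Field m \<and> snd x \<in> Field k \<and> snd y \<in> Field k \<and>
     (snd x \<in> underS k (snd y) \<or> snd x = snd y \<and> (fst x, fst y) \<in> m)"
  unfolding ord_prod_def underS_def by auto

lemma clock_refl: "(x, y) \<in> clock \<Longrightarrow> (x, x) \<in> clock \<and> (y, y) \<in> clock"
  unfolding clock_iff using Well_order_refl[OF wom] by blast

lemma clock_trans: "(x, y) \<in> clock \<Longrightarrow> (y, z) \<in> clock \<Longrightarrow> (x, z) \<in> clock"
  unfolding clock_iff
  using underS_trans[OF wok, of "snd x" "snd y" "snd z"]
    Well_order_trans[OF wom, of "fst x" "fst y" "fst z"] by auto

lemma clock_antisym: "(x, y) \<in> clock \<Longrightarrow> (y, x) \<in> clock \<Longrightarrow> x = y"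
  unfolding clock_iff prod_eq_iff
  using underS_asym[OF wok, of "snd x" "snd y"] underS_notIn[of "snd x" k]
    Well_order_antisym[OF wom, of "fst x" "fst y"] by auto

lemma wf_clock: "wf (clock - Id)"
proof (rule wf_subset)
  show "wf (inv_image ({(a, b). a \<in> underS k b} <*lex*> {(a, b). a \<in> underS m b})
      (\<lambda>x. (snd x, fst x)))"
    using wf_underS[OF wok] wf_underS[OF wom] by blast
  show "clock - Id \<subseteq> inv_image ({(a, b). a \<in> underS k b} <*lex*> {(a, b). a \<in> underS m b})
      (\<lambda>x. (snd x, fst x))"
    by (auto simp: clock_iff underS_def)
qed

lemma card_Field_k: "|Field k| \<le>o m"
  using ordIso_ordLeq_trans[OF card_of_Field_ordIso[of k] km] Ck by blast

lemma card_Field_m: "|Field m| \<le>o m"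
  using ordIso_imp_ordLeq[OF card_of_Field_ordIso[of m]] Cm by blast

lemma card_Times_m: "|A| \<le>o m \<Longrightarrow> |B| \<le>o m \<Longrightarrow> |A \<times> B| \<le>o m"
  using card_of_Times_ordLeq_infinite_Field[of m A B] Cm unfolding cinfinite_def by blast

lemma card_subset_m: "A \<subseteq> B \<Longrightarrow> |B| \<le>o m \<Longrightarrow> |A| \<le>o m"
  using ordLeq_transitive[OF card_of_mono1] .

lemma card_under_clock: "|under clock x| \<le>o m"
  by (rule card_subset_m[OF _ card_Times_m[OF card_Field_m card_Field_k]])
    (auto simp: under_def clock_iff)

end

lemma partial_isoI:
  assumes "\<And>a b. (a, b) \<in> P \<Longrightarrow> a \<in> fst A \<and> b \<in> fst B"
    and pres: "\<And>a b a' b'. (a, b) \<in> P \<Longrightarrow> (a', b') \<in> P \<Longrightarrow>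
      (a = a' \<longleftrightarrow> b = b') \<and> ((a, a') \<in> snd A \<longleftrightarrow> (b, b') \<in> snd B)"
  shows "partial_iso A B P"
  unfolding partial_iso_def
proof (intro conjI)
  show "P \<subseteq> fst A \<times> fst B" using assms(1) by auto
  show "\<forall>(a, b)\<in>P. \<forall>(a', b')\<in>P. (a = a' \<longleftrightarrow> b = b') \<and> ((a, a') \<in> snd A \<longleftrightarrow> (b, b') \<in> snd B)"
  proof (intro ballI case_prodI2)
    fix p q a b a' b' assume "p \<in> P" "p = (a, b)" "q \<in> P" "q = (a', b')"
    then show "(a = a' \<longleftrightarrow> b = b') \<and> ((a, a') \<in> snd A \<longleftrightarrow> (b, b') \<in> snd B)"
      using pres[of a b a' b'] by simp
  qed
qed

lemma partial_iso_subset: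
  assumes "partial_iso A B Q" "P \<subseteq> Q"
  shows "partial_iso A B P"
proof -
  have "\<forall>x\<in>P. \<forall>y\<in>P. (fst x = fst y \<longleftrightarrow> snd x = snd y) \<and>
      ((fst x, fst y) \<in> snd A \<longleftrightarrow> (snd x, snd y) \<in> snd B)"
    using assms unfolding partial_iso_def split_beta by (meson subsetD)
  then show ?thesis using assms unfolding partial_iso_def split_beta by blast
qed

context successor_cardinal
begin

section \<open>Winning by committing to bounds\<close>

context
  fixes A :: "'a struct" and B :: "'b struct" and rkA :: "'a \<Rightarrow> 'l" and rkB :: "'b \<Rightarrow> 'l"
  assumes rkA: "a \<in> fst A \<Longrightarrow> rkA a \<in> Field l" and rkB: "b \<in> fst B \<Longrightarrow> rkB b \<in> Field l"
begin

section \<open>Ranks and commitments along a play\<close>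

fun ranks :: "('l, 'a, 'b) move \<Rightarrow> 'l set" where
  "ranks (ChooseA i s) = (rkA \<circ> s) ` underS l i"
| "ranks (ChooseB i s) = (rkB \<circ> s) ` underS l i"

definition past_ranks :: "('m \<times> 'k, 'l, 'a, 'b) play \<Rightarrow> 'm \<times> 'k \<Rightarrow> 'l set" where
  "past_ranks h z = (\<Union>y \<in> dom h \<inter> under clock z. ranks (the (h y)))"

text \<open>There is one bound for each past move, over everything played up to and including that
  move. Later histories therefore reproduce earlier commitments unchanged.\<close>

definition commitments :: "('m \<times> 'k, 'l, 'a, 'b) play \<Rightarrow> 'l set" where
  "commitments h = (\<lambda>z. bound (past_ranks h z)) ` dom h"

lemma ranks_legal:
  assumes "legal_move l A B q"
  shows "ranks q \<subseteq> Field l" "|ranks q| \<le>o m"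
proof -
  show "ranks q \<subseteq> Field l" using assms rkA rkB by (cases q) (auto simp: Func_def)
  show "|ranks q| \<le>o m"
    by (cases q) (simp_all add: card_of_image_ordLeq card_underS_l)
qed

lemma past_ranks_legal:
  assumes p: "legal_play l clock A B p"
  shows "past_ranks p z \<subseteq> Field l" "|past_ranks p z| \<le>o m"
proof -
  have q: "legal_move l A B (the (p y))" if "y \<in> dom p" for y
    using p that unfolding legal_play_def ran_def by fastforce
  show "past_ranks p z \<subseteq> Field l"
    unfolding past_ranks_def using ranks_legal(1)[OF q] by blast
  show "|past_ranks p z| \<le>o m"
    unfolding past_ranks_def
    by (rule card_of_UN_ordLeq_Cinfinite[OF Cm card_subset_m[OF _ card_under_clock[of z]]])
      (auto intro: ranks_legal(2)[OF q])
qed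

lemma dom_history: "dom (history clock p x) = dom p \<inter> under clock x"
  unfolding history_def by auto

lemma past_ranks_history:
  assumes "z \<in> under clock x"
  shows "past_ranks (history clock p x) z = past_ranks p z"
proof -
  have "under clock z \<subseteq> under clock x" using assms clock_trans unfolding under_def by blast
  then show ?thesis unfolding past_ranks_def dom_history by (auto simp: history_def)
qed

lemma past_ranks_mono: "(y, z) \<in> clock \<Longrightarrow> past_ranks p y \<subseteq> past_ranks p z"
  unfolding past_ranks_def using clock_trans[of _ y z] by (intro UN_mono) (auto simp: under_def)

lemma commitments_history:
  "commitments (history clock p x) = (\<lambda>z. bound (past_ranks p z)) ` (dom p \<inter> under clock x)"
  unfolding commitments_def dom_history by (intro image_cong) (auto simp: past_ranks_history)

lemma legal_chain:
  assumes "legal_play l clock A B p" "y \<in> dom p" "z \<in> dom p"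
  shows "(y, z) \<in> clock \<or> (z, y) \<in> clock"
  using assms unfolding legal_play_def Chains_def by blast

lemma commitments_Field:
  assumes "legal_play l clock A B p"
  shows "commitments (history clock p x) \<subseteq> Field l"
  unfolding commitments_history using bound(1)[OF past_ranks_legal[OF assms]] by blast

lemma bound_past_ranks_mono:
  assumes "legal_play l clock A B p" "(y, z) \<in> clock"
  shows "(bound (past_ranks p y), bound (past_ranks p z)) \<in> l"
  by (rule bound_mono[OF past_ranks_mono[OF assms(2)] past_ranks_legal[OF assms(1)]])

text \<open>Bounds grow weakly with the clock, so the bound of a later move either repeats an old
  one or lies above all old ones.\<close>

lemma commitments_end_extension:
  assumes p: "legal_play l clock A B p" and xy: "x \<in> dom p" "y \<in> dom p" "(x, y) \<in> clock"
    and i: "i \<in> commitments (history clock p x)"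
    and j: "j \<in> commitments (history clock p y) - commitments (history clock p x)"
  shows "i \<in> underS l j"
proof -
  obtain z where z: "z \<in> dom p" "(z, x) \<in> clock" "i = bound (past_ranks p z)"
    using i unfolding commitments_history under_def by blast
  obtain z' where z': "z' \<in> dom p" "(z', x) \<notin> clock" "j = bound (past_ranks p z')"
    using j unfolding commitments_history under_def by blast
  then have "(z, z') \<in> clock"
    using legal_chain[OF p z'(1) xy(1)] clock_trans[OF z(2)] by blast
  then have "(i, j) \<in> l" unfolding z(3) z'(3) by (rule bound_past_ranks_mono[OF p])
  moreover have "i \<noteq> j" using i j by blast
  ultimately show ?thesis unfolding underS_def by blast
qed

text \<open>
  Two bad points whose commitments are first exceeded in the same copy of \<open>m\<close> would give a bad
  point with a cofinal sequence shorter than \<open>m\<close>; so there are at most as many bad points as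
  copies of \<open>m\<close> visited so far.
\<close>

lemma card_bad_commitments:
  assumes p: "legal_play l clock A B p" and x: "x \<in> dom p"
  shows "|bad (commitments (history clock p x))| <o k"
proof -
  let ?I = "commitments (history clock p x)"
  let ?D = "dom p \<inter> under clock x"
  define b where "b z = bound (past_ranks p z)" for z
  have I: "?I = b ` ?D" unfolding commitments_history b_def ..
  have bF: "b z \<in> Field l" for z unfolding b_def using bound(1)[OF past_ranks_legal[OF p]] .
  have bmono: "(b y, b z) \<in> l" if "(y, z) \<in> clock" for y z
    unfolding b_def by (rule bound_past_ranks_mono[OF p that])
  \<comment> \<open>For each bad point, pick the first move whose bound reaches it, using
    well-foundedness of the clock.\<close>
  have "\<forall>e \<in> bad ?I. \<exists>z. z \<in> ?D \<and> (e, b z) \<in> l \<and>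
      (\<forall>y \<in> ?D. (e, b y) \<in> l \<longrightarrow> (z, y) \<in> clock)"
  proof
    fix e assume "e \<in> bad ?I"
    then obtain z0 where z0: "z0 \<in> {z \<in> ?D. (e, b z) \<in> l}"
      unfolding bad_def I by fast
    obtain z where z: "z \<in> {z \<in> ?D. (e, b z) \<in> l}"
      "\<And>y. (y, z) \<in> clock - Id \<Longrightarrow> y \<notin> {z \<in> ?D. (e, b z) \<in> l}"
      using wfE_min[OF wf_clock z0] by blast
    have "(z, y) \<in> clock" if "y \<in> ?D" "(e, b y) \<in> l" for y
    proof -
      have "(z, y) \<in> clock \<or> (y, z) \<in> clock" using legal_chain[OF p] z(1) that(1) by blast
      moreover have "(y, z) \<notin> clock - Id" using z(2)[of y] that by blast
      ultimately show ?thesis using clock_refl by blast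
    qed
    with z(1) show "\<exists>z. z \<in> ?D \<and> (e, b z) \<in> l \<and>
      (\<forall>y \<in> ?D. (e, b y) \<in> l \<longrightarrow> (z, y) \<in> clock)" by blast
  qed
  then obtain g where "\<forall>e \<in> bad ?I. g e \<in> ?D \<and> (e, b (g e)) \<in> l \<and>
      (\<forall>y \<in> ?D. (e, b y) \<in> l \<longrightarrow> (g e, y) \<in> clock)"
    using bchoice[of "bad ?I" "\<lambda>e z. z \<in> ?D \<and> (e, b z) \<in> l \<and>
      (\<forall>y \<in> ?D. (e, b y) \<in> l \<longrightarrow> (z, y) \<in> clock)"] by blast
  then have g: "g e \<in> ?D" "(e, b (g e)) \<in> l"
      "\<And>y. y \<in> ?D \<Longrightarrow> (e, b y) \<in> l \<Longrightarrow> (g e, y) \<in> clock" if "e \<in> bad ?I" for e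
    using that by blast+
  have neq: "snd (g e) \<noteq> snd (g e')" if e: "e \<in> bad ?I" and e': "e' \<in> bad ?I" and less: "e \<in> underS l e'"
    for e e'
  proof
    assume eq: "snd (g e) = snd (g e')"
    \<comment> \<open>The moves from \<open>g e\<close> up to but excluding \<open>g e'\<close>.
      Within one copy of \<open>m\<close> there are fewer than \<open>m\<close> of them, and their
      bounds are below \<open>e'\<close> by minimality of \<open>g e'\<close>. Since
      \<open>e'\<close> is special, some \<open>c\<close> below \<open>e'\<close> bounds them
      all.\<close>
    define K where "K = {z \<in> ?D. (g e, z) \<in> clock \<and> (z, g e') \<in> clock \<and> z \<noteq> g e'}"
    have "K \<subseteq> (\<lambda>a. (a, snd (g e'))) ` underS m (fst (g e'))"
    proof
      fix z assume "z \<in> K"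
      then have z: "(g e, z) \<in> clock" "(z, g e') \<in> clock" "z \<noteq> g e'" unfolding K_def by auto
      have s: "snd z = snd (g e')"
        using z(1,2) eq underS_asym[OF wok, of "snd z" "snd (g e')"] unfolding clock_iff by auto
      then have "fst z \<in> underS m (fst (g e'))"
        using z(2,3) underS_notIn[of "snd (g e')" k] prod_eq_iff[of z "g e'"]
        unfolding clock_iff underS_def by auto
      then show "z \<in> (\<lambda>a. (a, snd (g e'))) ` underS m (fst (g e'))"
        using s by (metis image_eqI prod.collapse)
    qed
    moreover have "|underS m (fst (g e'))| <o m"
    proof (rule card_of_underS)
      show "Card_order m" using Cm by blast
      show "fst (g e') \<in> Field m" using g(1)[OF e'] unfolding under_def clock_iff by blast
    qed
    ultimately have "|K| <o m"
      using ordLeq_ordLess_trans[OF card_of_mono1] card_of_image_ordLess by blast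
    then have "|b ` K| <o m" by (rule card_of_image_ordLess)
    moreover have "b ` K \<subseteq> underS l e'"
    proof
      fix i assume "i \<in> b ` K"
      then obtain z where z: "z \<in> K" "i = b z" by blast
      show "i \<in> underS l e'"
      proof (rule ccontr)
        assume "i \<notin> underS l e'"
        then have "(e', b z) \<in> l"
          using not_underS_iff[OF wol bF] e' unfolding bad_def special_def z(2) by blast
        then have "(g e', z) \<in> clock" using g(3)[OF e'] z(1) unfolding K_def by blast
        then show False using z(1) clock_antisym unfolding K_def by blast
      qed
    qed
    ultimately obtain c where c: "c \<in> underS l e'" "b ` K \<subseteq> underS l c"
      using e' unfolding bad_def special_def by blast
    have eF: "e \<in> Field l" "c \<in> Field l" using less c(1) underS_Field_both by fast+
    \<comment> \<open>\<open>y\<close> is the larger of \<open>e\<close> and \<open>c\<close>. A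
      commitment strictly between \<open>y\<close> and \<open>e'\<close> must be made during
      \<open>K\<close>, yet those all lie below \<open>c\<close>.\<close>
    obtain y where y: "y \<in> underS l e'" "(e, y) \<in> l" "(c, y) \<in> l"
      using c(1) less underS_trichotomy[OF wol eF] Well_order_refl[OF wol] eF underS_imp_rel by metis
    obtain i where i: "i \<in> ?I" "y \<in> underS l i" "i \<in> underS l e'"
      using e' y(1) unfolding bad_def limit_point_def by blast
    then obtain z where z: "z \<in> ?D" "i = b z" unfolding I by blast
    have "(e, b z) \<in> l" using underS_imp_rel[OF rel_underS_trans[OF wol y(2) i(2)]] z(2) by simp
    then have 1: "(g e, z) \<in> clock" using g(3)[OF e z(1)] by blast
    have 2: "\<not> (g e', z) \<in> clock"
    proof
      assume "(g e', z) \<in> clock"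
      then have "(e', i) \<in> l"
        using Well_order_trans[OF wol g(2)[OF e'] bmono] z(2) by blast
      then show False using rel_underS_trans[OF wol _ i(3)] underS_notIn by fast
    qed
    then have "z \<in> K"
      using legal_chain[OF p] g(1)[OF e'] z(1) 1 unfolding K_def by blast
    then have "i \<in> underS l c" using c(2) z(2) by blast
    then show False
      using rel_underS_trans[OF wol y(3) i(2)] underS_asym[OF wol] by blast
  qed
  have "inj_on (snd \<circ> g) (bad ?I)"
  proof (rule inj_onI)
    fix e e' assume e: "e \<in> bad ?I" "e' \<in> bad ?I" and eq: "(snd \<circ> g) e = (snd \<circ> g) e'"
    have "e \<in> Field l" "e' \<in> Field l" using e unfolding bad_def special_def by auto
    from underS_trichotomy[OF wol this] show "e = e'"
      using neq[OF e] neq[OF e(2,1)] eq by auto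
  qed
  moreover have "(snd \<circ> g) ` bad ?I \<subseteq> under k (snd x)"
  proof
    fix c assume "c \<in> (snd \<circ> g) ` bad ?I"
    then obtain e where e: "e \<in> bad ?I" "c = snd (g e)" by auto
    have "(g e, x) \<in> clock" using g(1)[OF e(1)] unfolding under_def by blast
    then show "c \<in> under k (snd x)"
      using Well_order_refl[OF wok] unfolding clock_iff e(2) under_def underS_def by auto
  qed
  ultimately have "|bad ?I| \<le>o |under k (snd x)|" using card_of_ordLeqI by (metis card_of_ordLeq)
  moreover have "snd x \<in> Field k"
    using legal_chain[OF p x x] unfolding clock_iff by blast
  ultimately show ?thesis
    using ordLeq_ordLess_trans[OF _ Cinfinite_under_less[OF Ck]] by blast
qed

text \<open>A history is a bare map with no marked last move; the move to be answered is recovered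
  as the greatest point of its domain.\<close>

definition last_time :: "('m \<times> 'k, 'l, 'a, 'b) play \<Rightarrow> 'm \<times> 'k" where
  "last_time h = (THE y. y \<in> dom h \<and> dom h \<subseteq> under clock y)"

lemma last_time_history:
  assumes "(y, y) \<in> clock" "y \<in> dom p"
  shows "last_time (history clock p y) = y"
  unfolding last_time_def dom_history
proof (rule the_equality)
  show "y \<in> dom p \<inter> under clock y \<and> dom p \<inter> under clock y \<subseteq> under clock y"
    using assms unfolding under_def by blast
next
  fix z assume z: "z \<in> dom p \<inter> under clock y \<and> dom p \<inter> under clock y \<subseteq> under clock z"
  then have "(y, z) \<in> clock" using assms unfolding under_def by blast
  moreover have "(z, y) \<in> clock" using z unfolding under_def by blast
  ultimately show "z = y" using clock_antisym by metis
qed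

text \<open>Every answer is read off from \<open>f\<close> at the current commitments. The newest
  commitment exceeds the ranks just played, so \<open>f\<close> covers the move. Commitments only
  grow by end-extension, so by \<open>mono\<close> all earlier answers belong to the current partial
  isomorphism.\<close>

lemma EF_equiv_by_commitments:
  fixes f :: "'l set \<Rightarrow> ('a \<times> 'b) set"
  assumes iso: "\<And>I. I \<subseteq> Field l \<Longrightarrow> |bad I| <o k \<Longrightarrow> partial_iso A B (f I)"
    and covA: "\<And>I a i. I \<subseteq> Field l \<Longrightarrow> |bad I| <o k \<Longrightarrow> a \<in> fst A \<Longrightarrow> i \<in> I \<Longrightarrow>
      rkA a \<in> underS l i \<Longrightarrow> \<exists>b. (a, b) \<in> f I"
    and covB: "\<And>I b i. I \<subseteq> Field l \<Longrightarrow> |bad I| <o k \<Longrightarrow> b \<in> fst B \<Longrightarrow> i \<in> I \<Longrightarrow>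
      rkB b \<in> underS l i \<Longrightarrow> \<exists>a. (a, b) \<in> f I"
    and mono: "\<And>I I'. I \<subseteq> I' \<Longrightarrow> I' \<subseteq> Field l \<Longrightarrow>
      (\<And>i i'. i \<in> I \<Longrightarrow> i' \<in> I' - I \<Longrightarrow> i \<in> underS l i') \<Longrightarrow> f I \<subseteq> f I'"
  shows "EF_equiv l clock A B"
proof -
  define SA where "SA = (\<lambda>h j. case the (h (last_time h)) of
    ChooseA i s \<Rightarrow> undefined | ChooseB i s \<Rightarrow> SOME a. (a, s j) \<in> f (commitments h))"
  define SB where "SB = (\<lambda>h j. case the (h (last_time h)) of
    ChooseA i s \<Rightarrow> SOME b. (s j, b) \<in> f (commitments h) | ChooseB i s \<Rightarrow> undefined)"
  have "winning_strategy l clock A B (SA, SB)"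
    unfolding winning_strategy_def
  proof (intro allI impI ballI)
    fix p x assume p: "legal_play l clock A B p" and x: "x \<in> dom p"
    let ?h = "history clock p"
    have ans: "answered l (SA, SB) (?h y) (the (p y)) \<subseteq> f (commitments (?h y))"
      if y: "y \<in> dom p" for y
    proof -
      have yy: "(y, y) \<in> clock" using legal_chain[OF p y y] by blast
      have last: "last_time (?h y) = y" by (rule last_time_history[OF yy y])
      have at: "?h y y = p y" using yy unfolding history_def under_def by simp
      have legal: "legal_move l A B (the (p y))"
        using p y unfolding legal_play_def ran_def by fastforce
      let ?I = "commitments (?h y)"
      have I: "?I \<subseteq> Field l" "|bad ?I| <o k"
        using commitments_Field[OF p] card_bad_commitments[OF p y] by auto
      let ?i = "bound (past_ranks p y)"
      have i: "?i \<in> ?I" using y yy unfolding commitments_history under_def by blast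
      have "ranks (the (p y)) \<subseteq> past_ranks p y"
        using y yy unfolding past_ranks_def under_def by blast
      then have r: "ranks (the (p y)) \<subseteq> underS l ?i"
        using bound(2)[OF past_ranks_legal[OF p]] by blast
      show ?thesis
      proof (cases "the (p y)")
        case (ChooseA d s)
        have "(s j, SOME b. (s j, b) \<in> f ?I) \<in> f ?I" if "j \<in> underS l d" for j
        proof (rule someI_ex, rule covA[OF I _ i])
          show "s j \<in> fst A" using legal that ChooseA by (auto simp: Func_def)
          show "rkA (s j) \<in> underS l ?i" using r that ChooseA by auto
        qed
        then show ?thesis using ChooseA by (auto simp: SB_def last at)
      next
        case (ChooseB d s)
        have "(SOME a. (a, s j) \<in> f ?I, s j) \<in> f ?I" if "j \<in> underS l d" for j
        proof (rule someI_ex, rule covB[OF I _ i])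
          show "s j \<in> fst B" using legal that ChooseB by (auto simp: Func_def)
          show "rkB (s j) \<in> underS l ?i" using r that ChooseB by auto
        qed
        then show ?thesis using ChooseB by (auto simp: SA_def last at)
      qed
    qed
    have "position l clock (SA, SB) p x \<subseteq> f (commitments (?h x))"
      unfolding position_def
    proof (rule UN_least)
      fix y assume "y \<in> dom p \<inter> under clock x"
      then have y: "y \<in> dom p" "(y, x) \<in> clock" unfolding under_def by auto
      have sub: "commitments (?h y) \<subseteq> commitments (?h x)"
        unfolding commitments_history using clock_trans[OF _ y(2)] unfolding under_def by blast
      have "f (commitments (?h y)) \<subseteq> f (commitments (?h x))"
        by (rule mono[OF sub commitments_Field[OF p]])
          (rule commitments_end_extension[OF p y(1) x y(2)])
      then show "answered l (SA, SB) (?h y) (the (p y)) \<subseteq> f (commitments (?h x))"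
        using ans[OF y(1)] by blast
    qed
    moreover have "partial_iso A B (f (commitments (?h x)))"
      by (rule iso[OF commitments_Field[OF p] card_bad_commitments[OF p x]])
    ultimately show "partial_iso A B (position l clock (SA, SB) p x)"
      by (rule partial_iso_subset[rotated])
  qed
  then show ?thesis unfolding EF_equiv_def by blast
qed

end

end

section \<open>Trees of sequences\<close>

definition seq_order :: "('k \<rightharpoonup> 'w) set \<Rightarrow> ('k \<rightharpoonup> 'w) rel" where
  "seq_order N = {(s, t). s \<in> N \<and> t \<in> N \<and> s \<subseteq>\<^sub>m t}"

lemma Field_seq_order: "Field (seq_order N) = N"
  unfolding seq_order_def Field_def by auto

lemma restrict_map_le: "A \<subseteq> B \<Longrightarrow> s |` A \<subseteq>\<^sub>m s |` B"
  by (auto simp: map_le_def restrict_map_def)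

lemma map_le_restrict:
  assumes "r \<subseteq>\<^sub>m s" "dom r = A"
  shows "r = s |` A"
proof
  fix x show "r x = (s |` A) x"
  proof (cases "x \<in> dom r")
    case True
    then show ?thesis using assms by (simp add: map_le_def)
  next
    case False
    then have "r x = None" by (simp add: domIff)
    moreover have "x \<notin> A" using False assms(2) by simp
    ultimately show ?thesis by simp
  qed
qed

lemma underS_inj:
  assumes "Well_order r" "a \<in> Field r" "b \<in> Field r" "underS r a = underS r b"
  shows "a = b"
  using underS_trichotomy[OF assms(1-3)] assms(4) underS_notIn[of a r] underS_notIn[of b r] by blast

text \<open>Closure is required only under restriction to proper initial segments. A sequence of
  full length may thus be missing although all its restrictions are nodes, and the two trees exploit
  exactly this freedom.\<close>

locale sequence_tree =
  fixes k :: "'k rel" and N :: "('k \<rightharpoonup> 'w) set"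
  assumes wo_k: "Well_order k"
    and dom_node: "s \<in> N \<Longrightarrow> dom s = Field k \<or> (\<exists>a\<in>Field k. dom s = underS k a)"
    and restrict_node: "s \<in> N \<Longrightarrow> a \<in> Field k \<Longrightarrow> s |` underS k a \<in> N"
    and empty_node: "Map.empty \<in> N"
begin

lemma dom_Field: "s \<in> N \<Longrightarrow> dom s \<subseteq> Field k"
  using dom_node[of s] underS_Field by fast

lemma dom_closed: "s \<in> N \<Longrightarrow> a \<in> dom s \<Longrightarrow> b \<in> underS k a \<Longrightarrow> b \<in> dom s"
  using dom_node[of s] underS_trans[OF wo_k] underS_Field_both by fast

lemma dom_restrict: "s \<in> N \<Longrightarrow> a \<in> dom s \<Longrightarrow> dom (s |` underS k a) = underS k a"
  unfolding Map.dom_restrict using dom_closed[of s a] by blast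

lemma proper_initial_segment:
  assumes s: "s \<in> N" and r: "r \<in> N" "r \<subseteq>\<^sub>m s" "r \<noteq> s"
  obtains a where "a \<in> dom s" "r = s |` underS k a"
proof -
  have ne: "dom r \<noteq> dom s"
  proof
    assume "dom r = dom s"
    then have "s \<subseteq>\<^sub>m r" using r(2) by (simp add: map_le_def)
    then show False using map_le_antisym[OF r(2)] r(3) by simp
  qed
  have sub: "dom r \<subseteq> dom s" using r(2) by (rule map_le_implies_dom_le)
  then have "dom r \<noteq> Field k" using ne dom_Field[OF s] by blast
  then obtain a where a: "a \<in> Field k" "dom r = underS k a" using dom_node[OF r(1)] by blast
  have "a \<in> dom s"
  proof (cases "dom s = Field k")
    case True
    then show ?thesis using a(1) by simp
  next
    case False
    then obtain b where b: "b \<in> Field k" "dom s = underS k b" using dom_node[OF s] by blast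
    have "a \<noteq> b" using ne a(2) b(2) by blast
    moreover have "b \<notin> underS k a" using sub a(2) b(2) underS_notIn[of b k] by blast
    ultimately show ?thesis using underS_trichotomy[OF wo_k a(1) b(1)] b(2) by blast
  qed
  moreover have "r = s |` underS k a" by (rule map_le_restrict[OF r(2) a(2)])
  ultimately show thesis by (rule that)
qed

lemma mem_underS_seq_order:
  "r \<in> underS (seq_order N) s \<longleftrightarrow> r \<in> N \<and> s \<in> N \<and> r \<subseteq>\<^sub>m s \<and> r \<noteq> s"
  unfolding underS_def seq_order_def by auto

lemma underS_seq_order:
  assumes s: "s \<in> N"
  shows "underS (seq_order N) s = (\<lambda>a. s |` underS k a) ` dom s"
proof (intro equalityI subsetI)
  fix r assume "r \<in> underS (seq_order N) s"
  then have r: "r \<in> N" "r \<subseteq>\<^sub>m s" "r \<noteq> s" unfolding mem_underS_seq_order by auto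
  obtain a where "a \<in> dom s" "r = s |` underS k a" by (rule proper_initial_segment[OF s r])
  then show "r \<in> (\<lambda>a. s |` underS k a) ` dom s" by (rule rev_image_eqI)
next
  fix r assume "r \<in> (\<lambda>a. s |` underS k a) ` dom s"
  then obtain a where a: "r = s |` underS k a" "a \<in> dom s" by (rule imageE)
  have "a \<notin> dom r" using a(1) underS_notIn[of a k] by simp
  then have "r \<noteq> s" using a(2) by blast
  moreover have "r \<in> N"
    unfolding a(1) by (rule restrict_node[OF s subsetD[OF dom_Field[OF s] a(2)]])
  moreover have "r \<subseteq>\<^sub>m s" unfolding a(1) by (simp add: map_le_def)
  ultimately show "r \<in> underS (seq_order N) s" using s unfolding mem_underS_seq_order by blast
qed

lemma restrict_le_iff:
  assumes s: "s \<in> N" and a: "a \<in> dom s" and b: "b \<in> dom s"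
  shows "s |` underS k a \<subseteq>\<^sub>m s |` underS k b \<longleftrightarrow> (a, b) \<in> k"
proof
  have F: "a \<in> Field k" "b \<in> Field k" using a b dom_Field[OF s] by auto
  show "(a, b) \<in> k" if "s |` underS k a \<subseteq>\<^sub>m s |` underS k b"
  proof -
    have "underS k a \<subseteq> underS k b"
      using map_le_implies_dom_le[OF that] unfolding dom_restrict[OF s a] dom_restrict[OF s b] .
    then have "b \<notin> underS k a" using underS_notIn[of b k] by blast
    then show ?thesis using not_underS_iff[OF wo_k F(2,1)] by blast
  qed
  show "s |` underS k a \<subseteq>\<^sub>m s |` underS k b" if "(a, b) \<in> k"
  proof (rule restrict_map_le)
    show "underS k a \<subseteq> underS k b" using underS_rel_trans[OF wo_k _ that] by blast
  qed
qed

text \<open>The predecessors of \<open>s\<close> are indexed by its positions, which form an initial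
  segment of \<open>k\<close>; the order type and the height bound come from there.\<close>

lemma Restr_seq_order:
  assumes s: "s \<in> N"
  shows "Restr (seq_order N) (underS (seq_order N) s) =
    dir_image (Restr k (dom s)) (\<lambda>a. s |` underS k a)"
proof -
  let ?f = "\<lambda>a. s |` underS k a"
  have N: "?f a \<in> N" if "a \<in> dom s" for a
    by (rule restrict_node[OF s subsetD[OF dom_Field[OF s] that]])
  have *: "(?f a, ?f b) \<in> seq_order N \<longleftrightarrow> (a, b) \<in> k" if "a \<in> dom s" "b \<in> dom s" for a b
    using restrict_le_iff[OF s that] N[OF that(1)] N[OF that(2)] by (simp add: seq_order_def)
  show ?thesis
    unfolding underS_seq_order[OF s] dir_image_def
  proof (intro equalityI subsetI)
    fix x assume x: "x \<in> Restr (seq_order N) (?f ` dom s)"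
    then obtain a b where ab: "a \<in> dom s" "b \<in> dom s" "x = (?f a, ?f b)" by (elim IntE SigmaE imageE) metis
    then have "(a, b) \<in> Restr k (dom s)" using x * by simp
    then show "x \<in> {(?f a, ?f b) |a b. (a, b) \<in> Restr k (dom s)}" using ab(3) by blast
  next
    fix x assume "x \<in> {(?f a, ?f b) |a b. (a, b) \<in> Restr k (dom s)}"
    then obtain a b where "x = (?f a, ?f b)" "a \<in> dom s" "b \<in> dom s" "(a, b) \<in> k" by blast
    then show "x \<in> Restr (seq_order N) (?f ` dom s)" using * by simp
  qed
qed

lemma dom_ofilter:
  assumes s: "s \<in> N" shows "ofilter k (dom s)"
  unfolding ofilter_def
proof (intro conjI ballI)
  show "dom s \<subseteq> Field k" by (rule dom_Field[OF s])
  fix a assume a: "a \<in> dom s"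
  then have "under k a = underS k a \<union> {a}"
    using Refl_under_underS[of k a] wo_rel.REFL[of k] wo_k dom_Field[OF s]
    unfolding wo_rel_def by blast
  then show "under k a \<subseteq> dom s" using dom_closed[OF s a] a by blast
qed

lemma inj_restrict:
  assumes s: "s \<in> N"
  shows "inj_on (\<lambda>a. s |` underS k a) (dom s)"
proof (rule inj_onI)
  fix a b assume a: "a \<in> dom s" and b: "b \<in> dom s" and eq: "s |` underS k a = s |` underS k b"
  have "underS k a = underS k b"
    using arg_cong[OF eq, of dom] unfolding dom_restrict[OF s a] dom_restrict[OF s b] .
  then show "a = b"
    by (rule underS_inj[OF wo_k subsetD[OF dom_Field[OF s] a] subsetD[OF dom_Field[OF s] b]])
qed

lemma Well_order_preds:
  assumes s: "s \<in> N"
  shows "Well_order (Restr (seq_order N) (underS (seq_order N) s))"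
    and "Restr (seq_order N) (underS (seq_order N) s) \<le>o k"
proof -
  have wo: "Well_order (Restr k (dom s))" by (rule Well_order_Restr[OF wo_k])
  have inj: "inj_on (\<lambda>a. s |` underS k a) (Field (Restr k (dom s)))"
    using inj_on_subset[OF inj_restrict[OF s] Field_Restr_subset] .
  show "Well_order (Restr (seq_order N) (underS (seq_order N) s))"
    unfolding Restr_seq_order[OF s] by (rule Well_order_dir_image[OF wo inj])
  have k: "Restr k (Field k) = k" by (auto simp: Field_def)
  have "Restr k (dom s) \<le>o Restr k (Field k)"
    using ofilter_subset_ordLeq[OF wo_k dom_ofilter[OF s] wo_rel.Field_ofilter] dom_Field[OF s] wo_k
    unfolding wo_rel_def by simp
  then show "Restr (seq_order N) (underS (seq_order N) s) \<le>o k"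
    unfolding k Restr_seq_order[OF s]
    by (rule ordIso_ordLeq_trans[OF ordIso_symmetric[OF dir_image_ordIso[OF wo inj]]])
qed

lemma same_preds_restrict:
  assumes s: "s \<in> N" and t: "t \<in> N" and eq: "underS (seq_order N) t = underS (seq_order N) s"
    and a: "a \<in> dom s"
  shows "a \<in> dom t" "t |` underS k a = s |` underS k a"
proof -
  have "s |` underS k a \<in> underS (seq_order N) t"
    unfolding eq underS_seq_order[OF s] using a by (rule imageI)
  then have "s |` underS k a \<in> (\<lambda>b. t |` underS k b) ` dom t"
    unfolding underS_seq_order[OF t] .
  then obtain b where b: "s |` underS k a = t |` underS k b" "b \<in> dom t"
    by (rule imageE)
  have d: "underS k a = underS k b"
    using arg_cong[OF b(1), of dom] unfolding dom_restrict[OF s a] dom_restrict[OF t b(2)] .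
  have ab: "a = b"
    by (rule underS_inj[OF wo_k subsetD[OF dom_Field[OF s] a] subsetD[OF dom_Field[OF t] b(2)] d])
  show "a \<in> dom t" using b(2) unfolding ab .
  show "t |` underS k a = s |` underS k a" using b(1) unfolding ab by (rule sym)
qed

lemma same_preds_dom:
  assumes "s \<in> N" "t \<in> N" and eq: "underS (seq_order N) t = underS (seq_order N) s"
  shows "dom t = dom s"
  using same_preds_restrict(1)[OF assms] same_preds_restrict(1)[OF assms(2,1) eq[symmetric]]
  by (intro equalityI subsetI)

text \<open>Every entry other than a last one is visible in some proper restriction, so common
  predecessors leave only a last entry to compare.\<close>

lemma same_preds_eq:
  assumes s: "s \<in> N" and t: "t \<in> N" and eq: "underS (seq_order N) t = underS (seq_order N) s"
    and last: "\<And>a. a \<in> dom s \<Longrightarrow> (\<nexists>b. b \<in> dom s \<and> a \<in> underS k b) \<Longrightarrow> s a = t a"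
  shows "s = t"
proof
  fix a
  show "s a = t a"
  proof (cases "a \<in> dom s")
    case True
    show ?thesis
    proof (cases "\<exists>b. b \<in> dom s \<and> a \<in> underS k b")
      case True
      then obtain b where "b \<in> dom s" "a \<in> underS k b" by blast
      then show ?thesis using fun_cong[OF same_preds_restrict(2)[OF s t eq], of b a] by simp
    next
      case False
      then show ?thesis using last True by blast
    qed
  next
    case False
    then have "a \<notin> dom t" using same_preds_dom[OF s t eq] by simp
    then show ?thesis using False by (simp add: domIff)
  qed
qed

lemma max_unique:
  assumes "s \<in> N" "a \<in> dom s" "\<nexists>b. b \<in> dom s \<and> a \<in> underS k b"
    "a' \<in> dom s" "\<nexists>b. b \<in> dom s \<and> a' \<in> underS k b"
  shows "a = a'"
  using underS_trichotomy[OF wo_k subsetD[OF dom_Field[OF assms(1)] assms(2)]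
    subsetD[OF dom_Field[OF assms(1)] assms(4)]] assms by blast

text \<open>If \<open>s\<close> has a last position, its class is counted by the letters there;
  otherwise the class is a singleton. A last position also yields an immediate predecessor, which
  gives uniqueness at limits.\<close>

lemma wide_tree_seq_order:
  assumes l: "Cinfinite l" and L: "\<And>s. s \<in> N \<Longrightarrow> ran s \<subseteq> L" "|L| \<le>o l"
  shows "wide_tree l k (seq_order N)"
  unfolding wide_tree_def Field_seq_order
proof (intro conjI ballI impI)
  have "Partial_order (seq_order N)"
    unfolding partial_order_on_def preorder_on_def Field_seq_order
  proof (intro conjI)
    show "seq_order N \<subseteq> N \<times> N" "refl_on N (seq_order N)"
      unfolding seq_order_def refl_on_def by auto
    show "trans (seq_order N)"
      unfolding seq_order_def by (rule transI) (use map_le_trans in blast)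
    show "antisym (seq_order N)"
      unfolding seq_order_def by (rule antisymI) (use map_le_antisym in blast)
  qed
  then show "is_tree (seq_order N)"
    unfolding is_tree_def Field_seq_order using Well_order_preds(1) by blast
next
  fix s assume s: "s \<in> N"
  show "Restr (seq_order N) (underS (seq_order N) s) \<le>o k" by (rule Well_order_preds(2)[OF s])
  have "|same_pred_class (seq_order N) s| \<le>o l"
  proof (cases "\<exists>a. a \<in> dom s \<and> (\<nexists>b. b \<in> dom s \<and> a \<in> underS k b)")
    case True
    then obtain a where a: "a \<in> dom s" "\<nexists>b. b \<in> dom s \<and> a \<in> underS k b" by blast
    let ?C = "same_pred_class (seq_order N) s"
    have C: "t \<in> N" "underS (seq_order N) t = underS (seq_order N) s" "dom t = dom s"
      if "t \<in> ?C" for t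
      using that same_preds_dom[OF s] unfolding same_pred_class_def Field_seq_order by auto
    have "inj_on (\<lambda>t. the (t a)) ?C"
    proof (rule inj_onI)
      fix t t' assume t: "t \<in> ?C" "t' \<in> ?C" and eq: "the (t a) = the (t' a)"
      show "t = t'"
      proof (rule same_preds_eq[OF C(1)[OF t(1)] C(1)[OF t(2)]])
        show "underS (seq_order N) t' = underS (seq_order N) t" using C(2) t by simp
        fix c assume "c \<in> dom t" "\<nexists>b. b \<in> dom t \<and> c \<in> underS k b"
        then have "c = a" using max_unique[OF s] a unfolding C(3)[OF t(1)] by blast
        then show "t c = t' c" using eq a(1) C(3)[OF t(1)] C(3)[OF t(2)] by (metis domD option.sel)
      qed
    qed
    moreover have "(\<lambda>t. the (t a)) ` ?C \<subseteq> L"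
    proof
      fix w assume "w \<in> (\<lambda>t. the (t a)) ` ?C"
      then obtain t where t: "t \<in> ?C" "w = the (t a)" by blast
      then have "w \<in> ran t" using a(1) C(3)[OF t(1)] by (metis domD option.sel ranI)
      then show "w \<in> L" using L(1)[OF C(1)[OF t(1)]] by blast
    qed
    ultimately show ?thesis using ordLeq_transitive[OF _ L(2)] card_of_ordLeq[of ?C L] by blast
  next
    case False
    have "same_pred_class (seq_order N) s \<subseteq> {s}"
      unfolding same_pred_class_def Field_seq_order using same_preds_eq[OF s] False by blast
    then have "finite (same_pred_class (seq_order N) s)" by (rule finite_subset) simp
    then have "|same_pred_class (seq_order N) s| <o l"
      using l finite_ordLess_infinite[OF card_of_Well_order Cinfinite_Well_order[OF l]]
      unfolding cinfinite_def Field_card_of by blast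
    then show ?thesis by (rule ordLess_imp_ordLeq)
  qed
  then show "|same_pred_class (seq_order N) s| <o cardSuc l"
    using cardSuc_ordLeq_ordLess[of l] l card_of_Card_order by blast
next
  show "\<exists>!x. x \<in> N \<and> underS (seq_order N) x = {}"
  proof (rule ex1I[of _ Map.empty])
    show "Map.empty \<in> N \<and> underS (seq_order N) Map.empty = {}"
      using empty_node underS_seq_order[OF empty_node] by simp
    show "x = Map.empty" if "x \<in> N \<and> underS (seq_order N) x = {}" for x
      using that underS_seq_order[of x] by auto
  qed
next
  fix s t assume s: "s \<in> N" and t: "t \<in> N"
    and *: "(\<nexists>z. immediate_pred (seq_order N) z s) \<and> (\<nexists>z. immediate_pred (seq_order N) z t) \<and>
      underS (seq_order N) s = underS (seq_order N) t"
  show "s = t"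
  proof (rule same_preds_eq[OF s t])
    show "underS (seq_order N) t = underS (seq_order N) s" using * by simp
    fix a assume a: "a \<in> dom s" "\<nexists>b. b \<in> dom s \<and> a \<in> underS k b"
    have "immediate_pred (seq_order N) (s |` underS k a) s"
      unfolding immediate_pred_def
    proof
      show pa: "s |` underS k a \<in> underS (seq_order N) s"
        unfolding underS_seq_order[OF s] using a by blast
      show "\<nexists>z. s |` underS k a \<in> underS (seq_order N) z \<and> z \<in> underS (seq_order N) s"
      proof
        assume "\<exists>z. s |` underS k a \<in> underS (seq_order N) z \<and> z \<in> underS (seq_order N) s"
        then obtain b where b: "b \<in> dom s"
          "s |` underS k a \<in> underS (seq_order N) (s |` underS k b)"
          unfolding underS_seq_order[OF s] by blast
        then have "s |` underS k a \<subseteq>\<^sub>m s |` underS k b" "s |` underS k a \<noteq> s |` underS k b"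
          unfolding underS_def seq_order_def by auto
        then have "a \<in> underS k b"
          using restrict_le_iff[OF s a(1) b(1)] unfolding underS_def by auto
        then show False using a b by blast
      qed
    qed
    then show "s a = t a" using * by blast
  qed
qed

end

section \<open>Copies of trees\<close>

lemma dir_image_iff:
  assumes "inj_on f (Field t)" "a \<in> Field t" "b \<in> Field t"
  shows "(f a, f b) \<in> dir_image t f \<longleftrightarrow> (a, b) \<in> t"
proof
  assume "(f a, f b) \<in> dir_image t f"
  then obtain a' b' where ab: "f a = f a'" "f b = f b'" "(a', b') \<in> t"
    unfolding dir_image_def by blast
  then have "a' \<in> Field t" "b' \<in> Field t" by (auto simp: Field_def)
  then have "a = a'" "b = b'" using inj_onD[OF assms(1)] assms(2,3) ab by auto
  then show "(a, b) \<in> t" using ab by simp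
next
  show "(a, b) \<in> t \<Longrightarrow> (f a, f b) \<in> dir_image t f" unfolding dir_image_def by blast
qed

lemma underS_dir_image:
  assumes f: "inj_on f (Field t)" and x: "x \<in> Field t"
  shows "underS (dir_image t f) (f x) = f ` underS t x"
proof (intro equalityI subsetI)
  fix y assume y: "y \<in> underS (dir_image t f) (f x)"
  have "y \<in> f ` Field t" using underS_Field[OF y] unfolding dir_image_Field .
  then obtain z where z: "y = f z" "z \<in> Field t" by (rule imageE)
  then have "z \<in> underS t x"
    using y dir_image_iff[OF f z(2) x] unfolding underS_def by auto
  then show "y \<in> f ` underS t x" using z(1) by simp
next
  fix y assume "y \<in> f ` underS t x"
  then obtain z where z: "y = f z" "z \<in> underS t x" by (rule imageE)
  then have "z \<in> Field t" "z \<noteq> x" "(z, x) \<in> t" unfolding underS_def Field_def by auto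
  then show "y \<in> underS (dir_image t f) (f x)"
    using z(1) dir_image_iff[OF f _ x, of z] inj_onD[OF f _ _ x, of z] unfolding underS_def by auto
qed

lemma Restr_dir_image:
  assumes f: "inj_on f (Field t)" and A: "A \<subseteq> Field t"
  shows "Restr (dir_image t f) (f ` A) = dir_image (Restr t A) f"
proof (intro equalityI subsetI)
  fix x assume x: "x \<in> Restr (dir_image t f) (f ` A)"
  then obtain a b where ab: "x = (f a, f b)" "a \<in> A" "b \<in> A" by auto
  have "(a, b) \<in> t" using x ab A dir_image_iff[OF f, of a b] by auto
  then show "x \<in> dir_image (Restr t A) f" using ab unfolding dir_image_def by auto
next
  fix x assume "x \<in> dir_image (Restr t A) f"
  then show "x \<in> Restr (dir_image t f) (f ` A)" unfolding dir_image_def by auto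
qed

lemma immediate_pred_dir_image:
  assumes f: "inj_on f (Field t)" and x: "x \<in> Field t" and y: "immediate_pred t y x"
  shows "immediate_pred (dir_image t f) (f y) (f x)"
proof -
  have y': "y \<in> underS t x" "\<And>z. y \<in> underS t z \<Longrightarrow> z \<notin> underS t x"
    using y unfolding immediate_pred_def by auto
  have yF: "y \<in> Field t" using underS_Field[OF y'(1)] .
  show ?thesis
    unfolding immediate_pred_def underS_dir_image[OF f x]
  proof
    show "f y \<in> f ` underS t x" using y'(1) by simp
    show "\<nexists>z. f y \<in> underS (dir_image t f) z \<and> z \<in> f ` underS t x"
    proof
      assume "\<exists>z. f y \<in> underS (dir_image t f) z \<and> z \<in> f ` underS t x"
      then obtain z where z: "f y \<in> underS (dir_image t f) (f z)" "z \<in> underS t x" by auto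
      have zF: "z \<in> Field t" using underS_Field[OF z(2)] .
      obtain u where u: "f y = f u" "u \<in> underS t z"
        using z(1) unfolding underS_dir_image[OF f zF] by (rule imageE)
      have "y = u" using inj_onD[OF f u(1) yF underS_Field[OF u(2)]] .
      then show False using y'(2) u(2) z(2) by blast
    qed
  qed
qed

text \<open>The final trees have to live on the type \<open>'l set\<close>, so all notions are
  transported along an injective renaming of the nodes.\<close>

lemma wide_tree_dir_image:
  assumes t: "wide_tree l k t" and f: "inj_on f (Field t)"
  shows "wide_tree l k (dir_image t f)"
proof -
  have is_tree: "is_tree t"
    and width: "\<And>x. x \<in> Field t \<Longrightarrow> |same_pred_class t x| <o cardSuc l"
    and height: "\<And>x. x \<in> Field t \<Longrightarrow> Restr t (underS t x) \<le>o k"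
    and root: "\<exists>!x. x \<in> Field t \<and> underS t x = {}"
    and limits: "\<And>x y. x \<in> Field t \<Longrightarrow> y \<in> Field t \<Longrightarrow> \<nexists>z. immediate_pred t z x \<Longrightarrow>
      \<nexists>z. immediate_pred t z y \<Longrightarrow> underS t x = underS t y \<Longrightarrow> x = y"
    using t unfolding wide_tree_def by blast+
  let ?t = "dir_image t f"
  have po: "Partial_order t" and wo: "\<And>x. x \<in> Field t \<Longrightarrow> Well_order (Restr t (underS t x))"
    using is_tree unfolding is_tree_def by blast+
  have sub: "underS t x \<subseteq> Field t" for x using underS_Field by fast
  have inj: "inj_on f (Field (Restr t (underS t x)))" for x
    using inj_on_subset[OF f, of "Field (Restr t (underS t x))"] by (auto simp: Field_def)
  have restr: "Restr ?t (underS ?t (f x)) = dir_image (Restr t (underS t x)) f" if "x \<in> Field t" for x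
    unfolding underS_dir_image[OF f that] by (rule Restr_dir_image[OF f sub])
  have same: "underS t x = underS t y"
    if "x \<in> Field t" "y \<in> Field t" "underS ?t (f x) = underS ?t (f y)" for x y
    using that(3) inj_on_image_eq_iff[OF f sub sub]
    unfolding underS_dir_image[OF f that(1)] underS_dir_image[OF f that(2)] by simp
  show ?thesis
    unfolding wide_tree_def is_tree_def dir_image_Field
  proof (intro conjI ballI impI)
    show "partial_order_on (f ` Field t) ?t"
      using Partial_order_dir_image[OF po f] unfolding dir_image_Field .
    fix z assume "z \<in> f ` Field t"
    then obtain x where x: "z = f x" "x \<in> Field t" by (rule imageE)
    show "Well_order (Restr ?t (underS ?t z))"
      unfolding x(1) restr[OF x(2)] by (rule Well_order_dir_image[OF wo[OF x(2)] inj])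
    show "Restr ?t (underS ?t z) \<le>o k"
      unfolding x(1) restr[OF x(2)]
      by (rule ordIso_ordLeq_trans[OF ordIso_symmetric[OF dir_image_ordIso[OF wo[OF x(2)] inj]]
        height[OF x(2)]])
    have "same_pred_class ?t z \<subseteq> f ` same_pred_class t x"
    proof
      fix w assume "w \<in> same_pred_class ?t z"
      then have w: "w \<in> f ` Field t" "underS ?t w = underS ?t (f x)"
        unfolding same_pred_class_def dir_image_Field x(1) by auto
      obtain y where y: "w = f y" "y \<in> Field t" using w(1) by (rule imageE)
      then have "y \<in> same_pred_class t x"
        using same[OF y(2) x(2)] w(2) unfolding same_pred_class_def by simp
      then show "w \<in> f ` same_pred_class t x" using y(1) by simp
    qed
    then have "|same_pred_class ?t z| \<le>o |f ` same_pred_class t x|" by (rule card_of_mono1)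
    then have "|same_pred_class ?t z| \<le>o |same_pred_class t x|"
      using ordLeq_transitive[OF _ card_of_image] by blast
    then show "|same_pred_class ?t z| <o cardSuc l"
      using ordLeq_ordLess_trans[OF _ width[OF x(2)]] by blast
  next
    obtain x where x: "x \<in> Field t" "underS t x = {}"
      "\<And>y. y \<in> Field t \<Longrightarrow> underS t y = {} \<Longrightarrow> y = x"
      using root by (elim ex1E) blast
    show "\<exists>!x. x \<in> f ` Field t \<and> underS ?t x = {}"
    proof (rule ex1I[of _ "f x"])
      show "f x \<in> f ` Field t \<and> underS ?t (f x) = {}"
        using x(1,2) underS_dir_image[OF f x(1)] by simp
      fix z assume z: "z \<in> f ` Field t \<and> underS ?t z = {}"
      then obtain y where y: "z = f y" "y \<in> Field t" by blast
      then have "underS t y = {}" using z underS_dir_image[OF f y(2)] by simp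
      then show "z = f x" using x(3) y by simp
    qed
  next
    fix a b assume "a \<in> f ` Field t" "b \<in> f ` Field t"
    then obtain x y where x: "a = f x" "x \<in> Field t" and y: "b = f y" "y \<in> Field t" by blast
    assume *: "(\<nexists>z. immediate_pred ?t z a) \<and> (\<nexists>z. immediate_pred ?t z b) \<and>
      underS ?t a = underS ?t b"
    have "x = y"
    proof (rule limits[OF x(2) y(2)])
      show "\<nexists>z. immediate_pred t z x" "\<nexists>z. immediate_pred t z y"
        using * immediate_pred_dir_image[OF f] x y by blast+
      show "underS t x = underS t y" using same[OF x(2) y(2)] * x(1) y(1) by simp
    qed
    then show "a = b" using x(1) y(1) by simp
  qed
qed

lemma dir_image_strict_iff:
  assumes "inj_on f (Field t)" "a \<in> Field t" "b \<in> Field t"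
  shows "(f a, f b) \<in> dir_image t f - Id \<longleftrightarrow> (a, b) \<in> t - Id"
  using dir_image_iff[OF assms] inj_onD[OF assms(1) _ assms(2,3)] by auto

lemma isomorphic_dir_imageD:
  assumes f: "inj_on f (Field t)" and g: "inj_on g (Field u)"
    and iso: "isomorphic (tree_struct (dir_image t f)) (tree_struct (dir_image u g))"
  shows "isomorphic (tree_struct t) (tree_struct u)"
proof -
  obtain h where h: "bij_betw h (f ` Field t) (g ` Field u)"
    and pres: "\<And>x y. x \<in> f ` Field t \<Longrightarrow> y \<in> f ` Field t \<Longrightarrow>
      (x, y) \<in> dir_image t f - Id \<longleftrightarrow> (h x, h y) \<in> dir_image u g - Id"
    using iso unfolding isomorphic_def tree_struct_def dir_image_Field fst_conv snd_conv by blast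
  let ?g = "the_inv_into (Field u) g"
  have f': "bij_betw f (Field t) (f ` Field t)" using f by (simp add: bij_betw_def)
  have g': "bij_betw ?g (g ` Field u) (Field u)"
    using bij_betw_the_inv_into[of g "Field u" "g ` Field u"] g by (simp add: bij_betw_def)
  have b: "bij_betw (?g \<circ> (h \<circ> f)) (Field t) (Field u)"
    by (rule bij_betw_trans[OF bij_betw_trans[OF f' h] g'])
  have "(x, y) \<in> t - Id \<longleftrightarrow> ((?g \<circ> (h \<circ> f)) x, (?g \<circ> (h \<circ> f)) y) \<in> u - Id"
    if xy: "x \<in> Field t" "y \<in> Field t" for x y
  proof -
    let ?x = "(?g \<circ> (h \<circ> f)) x" and ?y = "(?g \<circ> (h \<circ> f)) y"
    have hF: "h (f x) \<in> g ` Field u" "h (f y) \<in> g ` Field u"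
      using bij_betwE[OF h] xy by blast+
    have F: "?x \<in> Field u" "?y \<in> Field u" using bij_betwE[OF b] xy by blast+
    have gi: "g ?x = h (f x)" "g ?y = h (f y)"
      using f_the_inv_into_f[OF g hF(1)] f_the_inv_into_f[OF g hF(2)] by simp_all
    have "(x, y) \<in> t - Id \<longleftrightarrow> (f x, f y) \<in> dir_image t f - Id"
      by (rule dir_image_strict_iff[OF f xy, symmetric])
    also have "\<dots> \<longleftrightarrow> (g ?x, g ?y) \<in> dir_image u g - Id"
      unfolding gi by (rule pres) (use xy in auto)
    also have "\<dots> \<longleftrightarrow> (?x, ?y) \<in> u - Id" by (rule dir_image_strict_iff[OF g F])
    finally show ?thesis .
  qed
  with b show ?thesis unfolding isomorphic_def tree_struct_def fst_conv snd_conv by blast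
qed

lemma partial_iso_dir_image:
  assumes f: "inj_on f (Field t)" and g: "inj_on g (Field u)"
    and P: "partial_iso (tree_struct t) (tree_struct u) P"
  shows "partial_iso (tree_struct (dir_image t f)) (tree_struct (dir_image u g)) (map_prod f g ` P)"
proof -
  have sub: "a \<in> Field t \<and> b \<in> Field u" if "(a, b) \<in> P" for a b
    using P that unfolding partial_iso_def tree_struct_def by auto
  have pres: "(a = a' \<longleftrightarrow> b = b') \<and> ((a, a') \<in> t - Id \<longleftrightarrow> (b, b') \<in> u - Id)"
    if "(a, b) \<in> P" "(a', b') \<in> P" for a b a' b'
    using P that unfolding partial_iso_def tree_struct_def by fastforce
  have "(f a = f a' \<longleftrightarrow> g b = g b') \<and>
      ((f a, f a') \<in> dir_image t f - Id \<longleftrightarrow> (g b, g b') \<in> dir_image u g - Id)"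
    if ab: "(a, b) \<in> P" "(a', b') \<in> P" for a b a' b'
    using pres[OF ab] sub[OF ab(1)] sub[OF ab(2)] dir_image_strict_iff[OF f] dir_image_strict_iff[OF g]
      inj_on_eq_iff[OF f] inj_on_eq_iff[OF g] by metis
  then have "\<forall>x\<in>P. \<forall>y\<in>P. (f (fst x) = f (fst y) \<longleftrightarrow> g (snd x) = g (snd y)) \<and>
      ((f (fst x), f (fst y)) \<in> dir_image t f - Id \<longleftrightarrow> (g (snd x), g (snd y)) \<in> dir_image u g - Id)"
    unfolding split_paired_Ball_Sigma by (metis prod.collapse)
  moreover have "map_prod f g ` P \<subseteq> f ` Field t \<times> g ` Field u" using sub by auto
  ultimately show ?thesis
    unfolding partial_iso_def tree_struct_def dir_image_Field fst_conv snd_conv split_beta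
    by (simp add: map_prod_def split_beta del: Diff_iff)
qed

section \<open>The letters\<close>

text \<open>The component \<open>copy\<close> provides many twins for each \<open>arg\<close>, so
  that several raw letters can share an image value. Gadgets serve only to make labels visible in
  the order.\<close>

datatype 'a letter = Raw (arg: 'a) (lab: 'a) | Plain (arg: 'a) (copy: 'a) (lab: 'a) | Gadget (lab: 'a)

abbreviation main :: "'a letter \<Rightarrow> bool" where "main w \<equiv> \<not> is_Gadget w"

text \<open>\<open>J\<close> is large enough to number all points up to a given one and small enough
  for the counting in \<open>not_regressive\<close>. The point \<open>star\<close> outside
  \<open>J\<close> marks the image of a raw letter that cannot be moved down, so that this image is
  not good.\<close>

locale letters = successor_cardinal l m k
  for l :: "'l rel" and m :: "'m rel" and k :: "'k rel" +
  fixes J :: "'l set" and star :: 'l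
  assumes J: "J \<subseteq> Field l" "|J| =o m" and star: "star \<in> Field l" "star \<notin> J"
begin

section \<open>Translation of single letters\<close>

definition enum :: "'l \<Rightarrow> 'l \<Rightarrow> 'l" where
  "enum n = (SOME f. inj_on f (under l n) \<and> f ` under l n \<subseteq> J)"

text \<open>Hilbert's hotel: second components move off the set \<open>A\<close> reserved for raw
  letters. Taking the identity for empty \<open>A\<close> matters, because translation must change
  nothing once raw letters are impossible.\<close>

definition hotel :: "'l set \<Rightarrow> 'l \<Rightarrow> 'l" where
  "hotel A = (if A = {} then id else SOME f. bij_betw f (Field l) (Field l - A))"

text \<open>A point below \<open>x\<close> and at or above every member of \<open>I\<close> below
  \<open>x\<close>; it exists exactly when \<open>x\<close> is not a limit point of
  \<open>I\<close>. Only the part of \<open>I\<close> below \<open>x\<close> enters, which keeps the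
  choice stable under end-extension.\<close>

definition lower :: "'l set \<Rightarrow> 'l \<Rightarrow> 'l" where
  "lower I x = (SOME y. y \<in> underS l x \<and> (\<forall>i\<in>I. y \<in> underS l i \<longrightarrow> i \<notin> underS l x))"

definition upper :: "'l set \<Rightarrow> 'l \<Rightarrow> 'l" where
  "upper I x = wo_rel.minim l {i \<in> I. (x, i) \<in> l}"

text \<open>The rooms reserved at first component \<open>y\<close>: the second components that raw
  letters with points in \<open>X\<close> acquire when their \<open>arg\<close> becomes
  \<open>y\<close>.\<close>

definition targets :: "'l set \<Rightarrow> 'l set \<Rightarrow> 'l \<Rightarrow> 'l set" where
  "targets I X y =
     {enum (upper I x) x |x. x \<in> X \<and> (\<exists>i\<in>I. (x, i) \<in> l) \<and> \<not> limit_point I x \<and> lower I x = y} \<union>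
     (if y \<in> X \<and> limit_point I y then {star} else {})"

fun translate_letter :: "'l set \<Rightarrow> ('l \<Rightarrow> 'l set) \<Rightarrow> 'l letter \<Rightarrow> 'l letter" where
  "translate_letter I R (Raw x e) =
     (if limit_point I x then Plain x star e else Plain (lower I x) (enum (upper I x) x) e)"
| "translate_letter I R (Plain y j e) = Plain y (hotel (targets I (R e) y) j) e"
| "translate_letter I R (Gadget g) = Gadget g"

text \<open>The bound is weak for raw and strict for plain letters: if \<open>lower I x\<close> is
  below some \<open>i\<close> in \<open>I\<close>, then no point of \<open>I\<close> between them
  allows only the conclusion that \<open>x\<close> is at most \<open>i\<close>.\<close>

fun bounded_letter :: "'l set \<Rightarrow> 'l letter \<Rightarrow> bool" where
  "bounded_letter I (Raw x e) \<longleftrightarrow> (\<exists>i\<in>I. (x, i) \<in> l)"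
| "bounded_letter I (Plain y j e) \<longleftrightarrow> (\<exists>i\<in>I. y \<in> underS l i)"
| "bounded_letter I (Gadget g) \<longleftrightarrow> True"

fun letter_in :: "('l \<Rightarrow> 'l set) \<Rightarrow> 'l letter \<Rightarrow> bool" where
  "letter_in R (Raw x e) \<longleftrightarrow> x \<in> R e"
| "letter_in R (Plain y j e) \<longleftrightarrow> j \<in> Field l"
| "letter_in R (Gadget g) \<longleftrightarrow> True"

lemma under_l_le: "|under l n| \<le>o m"
proof -
  have "|under l n| <o l"
  proof (cases "n \<in> Field l")
    case True
    then show ?thesis by (rule Cinfinite_under_less[OF Cl])
  next
    case False
    then have "under l n = {}" unfolding under_def Field_def by auto
    then have "|under l n| \<le>o m" using card_of_empty1[of m] wom by simp
    then show ?thesis using less_l_iff by blast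
  qed
  then show ?thesis using less_l_iff by blast
qed

lemma enum: "inj_on (enum n) (under l n)" "enum n ` under l n \<subseteq> J"
proof -
  have "|under l n| \<le>o |J|" by (rule ordLeq_ordIso_trans[OF under_l_le ordIso_symmetric[OF J(2)]])
  then obtain f where "inj_on f (under l n) \<and> f ` under l n \<subseteq> J"
    using card_of_ordLeq[of "under l n" J] by blast
  then have "inj_on (enum n) (under l n) \<and> enum n ` under l n \<subseteq> J"
    unfolding enum_def by (rule someI[of "\<lambda>f. inj_on f (under l n) \<and> f ` under l n \<subseteq> J"])
  then show "inj_on (enum n) (under l n)" "enum n ` under l n \<subseteq> J" by auto
qed

lemma J_star_small: "|insert star J| \<le>o m"
proof -
  have inf: "infinite (Field m)" and card: "Card_order m" using Cm unfolding cinfinite_def by auto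
  have "|{star}| \<le>o m"
    by (rule ordLeq_transitive[OF card_of_singl_ordLeq card_Field_m]) (use inf in auto)
  from card_of_Un_ordLeq_infinite_Field[OF inf this ordIso_imp_ordLeq[OF J(2)] card]
  show ?thesis by simp
qed

lemma hotel_empty: "hotel {} = id"
  unfolding hotel_def by simp

lemma hotel:
  assumes A: "A \<subseteq> insert star J"
  shows "bij_betw (hotel A) (Field l) (Field l - A)"
proof (cases "A = {}")
  case True
  then show ?thesis unfolding hotel_def by simp
next
  case False
  have inf: "infinite (Field l)" using Cl unfolding cinfinite_def by blast
  have "|A| <o l" unfolding less_l_iff by (rule card_subset_m[OF A J_star_small])
  then have "|A| <o |Field l|"
    using ordLess_ordIso_trans[OF _ ordIso_symmetric[OF card_of_Field_ordIso[of l]]] Cl by blast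
  have "\<not> |Field l - A| <o |Field l|"
  proof
    assume "|Field l - A| <o |Field l|"
    then have "|(Field l - A) \<union> A| <o |Field l|"
      using card_of_Un_ordLess_infinite[OF inf _ \<open>|A| <o |Field l|\<close>] by blast
    moreover have "|Field l| \<le>o |(Field l - A) \<union> A|" by (rule card_of_mono1) blast
    ultimately show False using not_ordLess_ordLeq by blast
  qed
  then have "|Field l - A| =o |Field l|"
    using card_of_mono1[of "Field l - A" "Field l"] ordLeq_iff_ordLess_or_ordIso by blast
  then obtain f where "bij_betw f (Field l) (Field l - A)"
    using card_of_ordIso[of "Field l" "Field l - A"] ordIso_symmetric by blast
  then show ?thesis
    unfolding hotel_def using False someI[of "\<lambda>f. bij_betw f (Field l) (Field l - A)"] by simp
qed

lemma lower:
  assumes "\<not> limit_point I x"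
  shows "lower I x \<in> underS l x" "\<And>i. i \<in> I \<Longrightarrow> lower I x \<in> underS l i \<Longrightarrow> i \<notin> underS l x"
proof -
  have "\<exists>y. y \<in> underS l x \<and> (\<forall>i\<in>I. y \<in> underS l i \<longrightarrow> i \<notin> underS l x)"
    using assms unfolding limit_point_def by blast
  from someI_ex[OF this] show "lower I x \<in> underS l x"
    "\<And>i. i \<in> I \<Longrightarrow> lower I x \<in> underS l i \<Longrightarrow> i \<notin> underS l x"
    unfolding lower_def by blast+
qed

lemma upper:
  assumes "I \<subseteq> Field l" "\<exists>i\<in>I. (x, i) \<in> l"
  shows "upper I x \<in> I" "(x, upper I x) \<in> l" "\<And>i. i \<in> I \<Longrightarrow> (x, i) \<in> l \<Longrightarrow> (upper I x, i) \<in> l"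
proof -
  have "upper I x \<in> {i \<in> I. (x, i) \<in> l}"
    unfolding upper_def by (rule wo_rel.minim_in[OF wo_rel_l]) (use assms in auto)
  then show "upper I x \<in> I" "(x, upper I x) \<in> l" by auto
  show "(upper I x, i) \<in> l" if "i \<in> I" "(x, i) \<in> l" for i
    unfolding upper_def by (rule wo_rel.minim_least[OF wo_rel_l]) (use assms that in auto)
qed

text \<open>If \<open>x\<close> is below \<open>x'\<close>, the common value of \<open>lower\<close>
  is below \<open>upper I x\<close>, so \<open>upper I x\<close> cannot lie below \<open>x'\<close>.
  Hence one injection \<open>enum\<close> serves all points with the same \<open>lower\<close>
  value.\<close>

lemma upper_eq:
  assumes I: "I \<subseteq> Field l" and x: "\<exists>i\<in>I. (x, i) \<in> l" "\<not> limit_point I x"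
    and x': "\<exists>i\<in>I. (x', i) \<in> l" "\<not> limit_point I x'" and eq: "lower I x = lower I x'"
  shows "upper I x = upper I x'"
proof -
  have *: "upper I x = upper I x'"
    if x: "\<exists>i\<in>I. (x, i) \<in> l" "\<not> limit_point I x"
    and x': "\<exists>i\<in>I. (x', i) \<in> l" "\<not> limit_point I x'" and eq: "lower I x = lower I x'"
    and less: "x \<in> underS l x'" for x x'
  proof -
    note u = upper[OF I x(1)] and u' = upper[OF I x'(1)]
    have "(x, upper I x') \<in> l" using underS_imp_rel[OF underS_rel_trans[OF wol less u'(2)]] .
    then have 1: "(upper I x, upper I x') \<in> l" by (rule u(3)[OF u'(1)])
    have "lower I x' \<in> underS l (upper I x)"
      using underS_rel_trans[OF wol lower(1)[OF x(2)] u(2)] unfolding eq .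
    then have "upper I x \<notin> underS l x'" by (rule lower(2)[OF x'(2) u(1)])
    then have "(x', upper I x) \<in> l"
      using not_underS_iff[OF wol] I u(1) underS_Field_both[OF less] by blast
    then have "(upper I x', upper I x) \<in> l" by (rule u'(3)[OF u(1)])
    then show ?thesis using Well_order_antisym[OF wol 1] by blast
  qed
  have F: "x \<in> Field l" "x' \<in> Field l" using x(1) x'(1) by (auto simp: Field_def)
  show ?thesis
    using underS_trichotomy[OF wol F] *[OF x x' eq] *[OF x' x eq[symmetric]] by auto
qed

lemma enum_upper:
  assumes I: "I \<subseteq> Field l" and x: "\<exists>i\<in>I. (x, i) \<in> l"
  shows "enum (upper I x) x \<in> J"
  using enum(2)[of "upper I x"] upper(2)[OF I x] unfolding under_def by blast

lemma enum_upper_inj: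
  assumes I: "I \<subseteq> Field l" and x: "\<exists>i\<in>I. (x, i) \<in> l" "\<not> limit_point I x"
    and x': "\<exists>i\<in>I. (x', i) \<in> l" "\<not> limit_point I x'" and eq: "lower I x = lower I x'"
    and e: "enum (upper I x) x = enum (upper I x') x'"
  shows "x = x'"
proof (rule inj_onD[OF enum(1)])
  note u = upper_eq[OF I x x' eq]
  show "enum (upper I x) x = enum (upper I x) x'" using e unfolding u .
  show "x \<in> under l (upper I x)" using upper(2)[OF I x(1)] unfolding under_def by simp
  show "x' \<in> under l (upper I x)" using upper(2)[OF I x'(1)] unfolding under_def u by simp
qed

lemma targets_subset:
  assumes "I \<subseteq> Field l" shows "targets I X y \<subseteq> insert star J"
  unfolding targets_def using enum_upper[OF assms] by auto

lemma hotel_targets: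
  assumes "I \<subseteq> Field l"
  shows "bij_betw (hotel (targets I X y)) (Field l) (Field l - targets I X y)"
  by (rule hotel[OF targets_subset[OF assms]])

lemma translate_Raw_target:
  assumes "x \<in> R e" "\<exists>i\<in>I. (x, i) \<in> l"
  obtains y j where "translate_letter I R (Raw x e) = Plain y j e" "j \<in> targets I (R e) y"
proof (cases "limit_point I x")
  case True
  then have "star \<in> targets I (R e) x" using assms unfolding targets_def by auto
  then show thesis using that True by simp
next
  case False
  then have "enum (upper I x) x \<in> targets I (R e) (lower I x)" using assms unfolding targets_def by auto
  then show thesis using that False by simp
qed

text \<open>Images of raw letters land in \<open>targets\<close> and images of plain letters avoid
  it. Two raw letters with the same \<open>lower\<close> value are separated by a common
  \<open>enum\<close>, and \<open>star\<close> separates the limit points from the rest.\<close>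

lemma translate_letter_inj:
  assumes I: "I \<subseteq> Field l"
    and w: "letter_in R w" "bounded_letter I w" and w': "letter_in R w'" "bounded_letter I w'"
    and eq: "translate_letter I R w = translate_letter I R w'"
  shows "w = w'"
proof -
  have mixed: False
    if "letter_in R (Raw x e)" "bounded_letter I (Raw x e)" "letter_in R (Plain y j d)"
      "translate_letter I R (Raw x e) = translate_letter I R (Plain y j d)" for x e y j d
  proof -
    have "x \<in> R e" "\<exists>i\<in>I. (x, i) \<in> l" using that by auto
    then obtain z i where z: "translate_letter I R (Raw x e) = Plain z i e" "i \<in> targets I (R e) z"
      by (rule translate_Raw_target)
    then have "hotel (targets I (R d) y) j \<in> targets I (R d) y" using that(4) by auto
    moreover have "hotel (targets I (R d) y) j \<in> Field l - targets I (R d) y"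
      using bij_betwE[OF hotel_targets[OF I]] that(3) by auto
    ultimately show False by blast
  qed
  show ?thesis
  proof (cases w)
    case (Raw x e)
    then show ?thesis
    proof (cases w')
      case w'_Raw: (Raw x' e')
      have b: "\<exists>i\<in>I. (x, i) \<in> l" "\<exists>i\<in>I. (x', i) \<in> l" using w(2) w'(2) Raw w'_Raw by auto
      have "e = e'" using eq Raw w'_Raw by (auto split: if_splits)
      moreover have "x = x'"
      proof (cases "limit_point I x \<or> limit_point I x'")
        case True
        then show ?thesis
          using eq Raw w'_Raw enum_upper[OF I b(1)] enum_upper[OF I b(2)] star(2)
          by (auto split: if_splits)
      next
        case False
        then show ?thesis
          using eq Raw w'_Raw enum_upper_inj[OF I b(1) _ b(2)] by auto
      qed
      ultimately show ?thesis using Raw w'_Raw by simp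
    next
      case (Plain y j d)
      then show ?thesis using mixed w w' eq Raw by metis
    next
      case (Gadget g)
      then show ?thesis using eq Raw by (auto split: if_splits)
    qed
  next
    case (Plain y j d)
    then show ?thesis
    proof (cases w')
      case (Raw x' e')
      then show ?thesis using mixed w w' eq[symmetric] Plain by metis
    next
      case w'_Plain: (Plain y' j' d')
      then have same: "y = y'" "d = d'" and h: "hotel (targets I (R d) y) j = hotel (targets I (R d) y) j'"
        using eq Plain by auto
      have "j = j'"
        by (rule inj_onD[OF bij_betw_imp_inj_on[OF hotel_targets[OF I]] h])
          (use w w' Plain w'_Plain in auto)
      then show ?thesis using Plain w'_Plain same by simp
    qed (use eq Plain in auto)
  next
    case (Gadget g)
    then show ?thesis using eq by (cases w') (auto split: if_splits)
  qed
qed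

text \<open>A reserved second component comes from a raw letter, any other from the hotel shift. The
  last clause is what makes the preimage legal in its place.\<close>

lemma translate_letter_surj:
  assumes I: "I \<subseteq> Field l" and y: "\<exists>i\<in>I. y \<in> underS l i" and j: "j \<in> Field l"
  obtains w where "letter_in R w" "bounded_letter I w" "translate_letter I R w = Plain y j e"
    "(\<exists>j'. w = Plain y j' e) \<or> (\<exists>x. w = Raw x e)"
proof (cases "j \<in> targets I (R e) y")
  case True
  then consider x where "j = enum (upper I x) x" "x \<in> R e" "\<exists>i\<in>I. (x, i) \<in> l" "\<not> limit_point I x"
      "lower I x = y"
    | "j = star" "y \<in> R e" "limit_point I y"
    unfolding targets_def by (auto split: if_splits)
  then show thesis
  proof cases
    case 1
    then show thesis using that[of "Raw x e"] by simp
  next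
    case 2
    have "\<exists>i\<in>I. (y, i) \<in> l" using y underS_imp_rel by fast
    then show thesis using 2 that[of "Raw y e"] by simp
  qed
next
  case False
  then have "j \<in> hotel (targets I (R e) y) ` Field l"
    using hotel_targets[OF I, of "R e" y] j unfolding bij_betw_def by blast
  then obtain j' where "j = hotel (targets I (R e) y) j'" "j' \<in> Field l" by (rule imageE)
  then show thesis using that[of "Plain y j' e"] y by simp
qed

lemma lab_trans_letter: "lab (translate_letter I R w) = lab w"
  by (cases w) auto

lemma main_trans_letter: "main (translate_letter I R w) = main w"
  by (cases w) auto

lemma translate_letter_not_Raw: "\<not> is_Raw (translate_letter I R w)"
  by (cases w) auto

lemma translate_letter_Plain_Field:
  assumes I: "I \<subseteq> Field l" and w: "letter_in R w" "bounded_letter I w"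
    and eq: "translate_letter I R w = Plain y j e"
  shows "y \<in> Field l" "j \<in> Field l"
proof -
  have "y \<in> Field l \<and> j \<in> Field l"
  proof (cases w)
    case (Raw x d)
    have x: "\<exists>i\<in>I. (x, i) \<in> l" using w Raw by auto
    have "lower I x \<in> Field l" if "\<not> limit_point I x"
      using underS_Field_both[OF lower(1)[OF that]] by blast
    moreover have "x \<in> Field l" using x by (auto simp: Field_def)
    ultimately show ?thesis
      using eq Raw enum_upper[OF I x] J(1) star(1) by (auto split: if_splits)
  next
    case (Plain y' j' d)
    then have "j' \<in> Field l" "y' \<in> Field l" using w underS_Field_both by fastforce+
    then show ?thesis
      using eq Plain bij_betwE[OF hotel_targets[OF I]] by auto
  qed (use eq in auto)
  then show "y \<in> Field l" "j \<in> Field l" by auto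
qed


section \<open>The nodes\<close>

lemma wo_rel_k: "wo_rel k"
  unfolding wo_rel_def by (rule wok)

definition nxt :: "'k \<Rightarrow> 'k" where
  "nxt a = wo_rel.suc k {a}"

lemma nxt:
  assumes a: "a \<in> Field k"
  shows "a \<in> underS k (nxt a)" "nxt a \<in> Field k" "underS k (nxt a) = under k a"
proof -
  obtain b where b: "a \<in> underS k b" by (rule Cinfinite_greater[OF Ck a])
  have ne: "wo_rel.AboveS k {a} \<noteq> {}"
    using b underS_Field_both[OF b] unfolding AboveS_def underS_def by blast
  have sub: "{a} \<subseteq> Field k" using a by simp
  show 1: "a \<in> underS k (nxt a)"
    using wo_rel.suc_greater[OF wo_rel_k sub ne, of a] unfolding nxt_def underS_def by auto
  show 2: "nxt a \<in> Field k" using underS_Field_both[OF 1] by blast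
  show "underS k (nxt a) = under k a"
  proof (intro equalityI subsetI)
    fix c assume c: "c \<in> underS k (nxt a)"
    have cF: "c \<in> Field k" using underS_Field_both[OF c] by blast
    show "c \<in> under k a"
    proof (rule ccontr)
      assume "c \<notin> under k a"
      then have "a \<in> underS k c"
        using underS_trichotomy[OF wok a cF] Well_order_refl[OF wok a] underS_imp_rel[of c k a]
        unfolding under_def by blast
      then have "c \<in> wo_rel.AboveS k {a}" using cF unfolding AboveS_def underS_def by blast
      then have "(nxt a, c) \<in> k" unfolding nxt_def by (rule wo_rel.suc_least_AboveS[OF wo_rel_k])
      then show False using rel_underS_trans[OF wok _ c] underS_notIn by fast
    qed
  next
    fix c assume "c \<in> under k a"
    then show "c \<in> underS k (nxt a)" using rel_underS_trans[OF wok _ 1] unfolding under_def by blast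
  qed
qed

lemma nxt_inj:
  assumes "a \<in> Field k" "b \<in> Field k" "nxt a = nxt b"
  shows "a = b"
proof -
  have "under k a = under k b" using nxt(3)[OF assms(1)] nxt(3)[OF assms(2)] assms(3) by simp
  then have "(a, b) \<in> k" "(b, a) \<in> k"
    using Well_order_refl[OF wok assms(1)] Well_order_refl[OF wok assms(2)] unfolding under_def by auto
  then show ?thesis by (rule Well_order_antisym[OF wok])
qed

lemma special_Field: "special \<subseteq> Field l"
  unfolding special_def by blast

text \<open>
  \<open>ok r s a w\<close> means that the letter \<open>w\<close> may extend the sequence \<open>s\<close> at position \<open>a\<close>; the raw
  letters are permitted only if \<open>r\<close>. The gadget letters that follow a letter with label \<open>e\<close> are the
  strictly descending sequences below \<open>e\<close>, so that the label can be read off from the order.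
\<close>

fun ok :: "bool \<Rightarrow> ('k \<rightharpoonup> 'l letter) \<Rightarrow> 'k \<Rightarrow> 'l letter \<Rightarrow> bool" where
  "ok r s a (Raw x e) \<longleftrightarrow> r \<and> x \<in> special \<and> e \<in> Field l \<and>
     (\<forall>b \<in> underS k a. \<exists>x' e'. s b = Some (Raw x' e') \<and> x' \<noteq> x \<and> (nxt b = a \<longrightarrow> x' = e))"
| "ok r s a (Plain y j e) \<longleftrightarrow> y \<in> Field l \<and> j \<in> Field l \<and> e \<in> Field l \<and>
     (\<forall>b \<in> underS k a. \<exists>w. s b = Some w \<and> main w)"
| "ok r s a (Gadget g) \<longleftrightarrow> g \<in> Field l \<and>
     (\<exists>b \<in> underS k a. nxt b = a \<and> (\<exists>w. s b = Some w \<and> g \<in> underS l (lab w)))"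

text \<open>In the translation of a branch of raw letters, the next label is the raw point
  \<open>x\<close> that stood here; being good then means that \<open>x\<close> was moved strictly
  down, with a second component in \<open>J\<close>.\<close>

definition good :: "('k \<rightharpoonup> 'l letter) \<Rightarrow> 'k \<Rightarrow> bool" where
  "good s a \<longleftrightarrow> (\<exists>y j e y' j' e'. s a = Some (Plain y j e) \<and> s (nxt a) = Some (Plain y' j' e') \<and>
     j \<in> J \<and> y \<in> underS l e')"

definition survives :: "('k \<rightharpoonup> 'l letter) \<Rightarrow> bool" where
  "survives s \<longleftrightarrow> (\<exists>a0 \<in> Field k. \<forall>a. (a0, a) \<in> k \<longrightarrow> (\<exists>x e. s a = Some (Raw x e)) \<or> good s a)"

definition nodes :: "bool \<Rightarrow> ('k \<rightharpoonup> 'l letter) set" where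
  "nodes r = {s. (dom s = Field k \<and> survives s \<or> (\<exists>a\<in>Field k. dom s = underS k a)) \<and>
     (\<forall>a w. s a = Some w \<longrightarrow> ok r s a w)}"

lemma ok_cong:
  assumes "\<And>b. b \<in> underS k a \<Longrightarrow> s b = s' b"
  shows "ok r s a w = ok r s' a w"
  using assms by (cases w) auto

lemma nodes_ok: "s \<in> nodes r \<Longrightarrow> s a = Some w \<Longrightarrow> ok r s a w"
  unfolding nodes_def by blast

lemma restrict_ok:
  assumes s: "s \<in> nodes r" and c: "(s |` underS k a) c = Some w"
  shows "ok r (s |` underS k a) c w"
proof -
  have c': "c \<in> underS k a" "s c = Some w" using c by (auto simp: restrict_map_def split: if_splits)
  have "ok r s c w" by (rule nodes_ok[OF s c'(2)])
  moreover have "ok r s c w = ok r (s |` underS k a) c w"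
    using underS_trans[OF wok _ c'(1)] by (intro ok_cong) simp
  ultimately show ?thesis by simp
qed

lemma sequence_tree_nodes: "sequence_tree k (nodes r)"
proof
  show "Well_order k" by (rule wok)
  show "dom s = Field k \<or> (\<exists>a\<in>Field k. dom s = underS k a)" if "s \<in> nodes r" for s
    using that unfolding nodes_def by blast
  show "s |` underS k a \<in> nodes r" if s: "s \<in> nodes r" and a: "a \<in> Field k" for s a
  proof -
    have "\<exists>b\<in>Field k. dom (s |` underS k a) = underS k b"
    proof (cases "dom s = Field k")
      case True
      then have "dom (s |` underS k a) = underS k a" using underS_Field[of _ k a] by auto
      then show ?thesis using a by blast
    next
      case False
      then obtain b where b: "b \<in> Field k" "dom s = underS k b" using s unfolding nodes_def by blast
      have d: "dom (s |` underS k a) = underS k b \<inter> underS k a" using b(2) by simp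
      consider "(a, b) \<in> k" | "(b, a) \<in> k"
        using wo_rel.TOTALS[OF wo_rel_k] a b(1) by blast
      then show ?thesis
      proof cases
        case 1
        then have "underS k b \<inter> underS k a = underS k a" using underS_rel_trans[OF wok] by blast
        then show ?thesis using d a by blast
      next
        case 2
        then have "underS k b \<inter> underS k a = underS k b" using underS_rel_trans[OF wok] by blast
        then show ?thesis using d b(1) by blast
      qed
    qed
    then show ?thesis using restrict_ok[OF s] unfolding nodes_def by blast
  qed
  have "Field k \<noteq> {}" using Ck unfolding cinfinite_def by auto
  then obtain a where a: "a \<in> Field k" "\<And>b. b \<in> Field k \<Longrightarrow> (a, b) \<in> k"
    using Well_order_least[OF wok subset_refl] by blast
  have "underS k a = {}"
  proof (rule ccontr)
    assume "underS k a \<noteq> {}"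
    then obtain b where b: "b \<in> underS k a" by blast
    then have "(a, b) \<in> k" using a(2) underS_Field_both[OF b] by blast
    then show False using rel_underS_trans[OF wok _ b] underS_notIn by fast
  qed
  then have "dom (Map.empty :: 'k \<rightharpoonup> 'l letter) = underS k a" by simp
  then show "Map.empty \<in> nodes r" using a(1) unfolding nodes_def by blast
qed

lemma Field_k_neq_underS: "a \<in> Field k \<Longrightarrow> Field k \<noteq> underS k a"
  using underS_notIn[of a k] by blast

lemma nodes_survives:
  assumes "s \<in> nodes r" "dom s = Field k"
  shows "survives s"
  using assms Field_k_neq_underS unfolding nodes_def by auto

lemma nodes_dom_closed: "s \<in> nodes r \<Longrightarrow> a \<in> dom s \<Longrightarrow> b \<in> underS k a \<Longrightarrow> b \<in> dom s"
  using sequence_tree.dom_closed[OF sequence_tree_nodes] .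

lemma nodes_dom_Field: "s \<in> nodes r \<Longrightarrow> dom s \<subseteq> Field k"
  using sequence_tree.dom_Field[OF sequence_tree_nodes] .

lemma extend_node:
  assumes s: "s \<in> nodes r" and a: "a \<in> Field k" "dom s = underS k a" and w: "ok r s a w"
  shows "s(a \<mapsto> w) \<in> nodes r" "dom (s(a \<mapsto> w)) = underS k (nxt a)"
proof -
  have "under k a = underS k a \<union> {a}"
    using Refl_under_underS[OF wo_rel.REFL[OF wo_rel_k] a(1)] .
  then show d: "dom (s(a \<mapsto> w)) = underS k (nxt a)"
    unfolding nxt(3)[OF a(1)] using a(2) by simp
  have "ok r (s(a \<mapsto> w)) c v" if c: "(s(a \<mapsto> w)) c = Some v" for c v
  proof -
    have c': "c = a \<and> v = w \<or> s c = Some v" using c by (auto split: if_splits)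
    have le: "(c, a) \<in> k"
    proof (cases "c = a")
      case True
      then show ?thesis using Well_order_refl[OF wok a(1)] by simp
    next
      case False
      then have "c \<in> underS k a" using c' a(2) by blast
      then show ?thesis by (rule underS_imp_rel)
    qed
    have "ok r s c v"
    proof (cases "c = a")
      case True
      then show ?thesis using c w by simp
    next
      case False
      then show ?thesis using c' nodes_ok[OF s] by blast
    qed
    moreover have "ok r (s(a \<mapsto> w)) c v = ok r s c v"
    proof (rule ok_cong)
      fix b assume "b \<in> underS k c"
      then have "b \<noteq> a" using underS_rel_trans[OF wok _ le] underS_notIn by fast
      then show "(s(a \<mapsto> w)) b = s b" by simp
    qed
    ultimately show ?thesis by simp
  qed
  then show "s(a \<mapsto> w) \<in> nodes r" using d nxt(2)[OF a(1)] unfolding nodes_def by blast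
qed

lemma ok_set_letter: "ok r s a w \<Longrightarrow> set_letter w \<subseteq> Field l"
  using special_Field by (cases w) auto

lemma card_letters: "|{w. set_letter w \<subseteq> Field l}| \<le>o l"
proof -
  let ?F = "Field l"
  have inf: "infinite ?F" and card: "Card_order l" using Cl unfolding cinfinite_def by auto
  have F: "|?F| \<le>o l" by (rule ordIso_imp_ordLeq[OF card_of_Field_ordIso[OF card]])
  note times = card_of_Times_ordLeq_infinite_Field[OF inf _ _ card]
  have 2: "|?F \<times> ?F| \<le>o l" by (rule times[OF F F])
  have 3: "|?F \<times> ?F \<times> ?F| \<le>o l" by (rule times[OF F 2])
  note un = card_of_Un_ordLeq_infinite_Field[OF inf _ _ card]
  have *: "{w. set_letter w \<subseteq> ?F} \<subseteq> (\<lambda>(x, e). Raw x e) ` (?F \<times> ?F) \<union>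
      ((\<lambda>(y, j, e). Plain y j e) ` (?F \<times> ?F \<times> ?F) \<union> Gadget ` ?F)"
  proof
    fix w assume "w \<in> {w. set_letter w \<subseteq> ?F}"
    then show "w \<in> (\<lambda>(x, e). Raw x e) ` (?F \<times> ?F) \<union>
      ((\<lambda>(y, j, e). Plain y j e) ` (?F \<times> ?F \<times> ?F) \<union> Gadget ` ?F)"
      by (cases w) force+
  qed
  show ?thesis
    by (rule ordLeq_transitive[OF card_of_mono1[OF *]
      un[OF card_of_image_ordLeq[OF 2] un[OF card_of_image_ordLeq[OF 3] card_of_image_ordLeq[OF F]]]])
qed

lemma ran_node: "s \<in> nodes r \<Longrightarrow> ran s \<subseteq> {w. set_letter w \<subseteq> Field l}"
  unfolding ran_def using nodes_ok ok_set_letter by blast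

lemma wide_tree_nodes: "wide_tree l k (seq_order (nodes r))"
  by (rule sequence_tree.wide_tree_seq_order[OF sequence_tree_nodes Cl ran_node card_letters])


section \<open>The partial isomorphisms\<close>

text \<open>The raw letters that compete with plain letters of label \<open>e\<close> for this
  position and so need room. They depend on earlier entries only, so translation and its inverse can
  be computed along the sequence.\<close>

definition raws :: "('k \<rightharpoonup> 'l letter) \<Rightarrow> 'k \<Rightarrow> 'l \<Rightarrow> 'l set" where
  "raws s a e = {x. ok True s a (Raw x e)}"

definition translate :: "'l set \<Rightarrow> ('k \<rightharpoonup> 'l letter) \<Rightarrow> ('k \<rightharpoonup> 'l letter)" where
  "translate I s = (\<lambda>a. map_option (translate_letter I (raws s a)) (s a))"

definition bounded :: "'l set \<Rightarrow> ('k \<rightharpoonup> 'l letter) \<Rightarrow> bool" where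
  "bounded I s \<longleftrightarrow> (\<forall>a w. s a = Some w \<longrightarrow> bounded_letter I w)"

lemma raws_cong:
  assumes "\<And>b. b \<in> underS k a \<Longrightarrow> s b = s' b"
  shows "raws s a = raws s' a"
proof
  fix e show "raws s a e = raws s' a e"
    unfolding raws_def by (rule Collect_cong, rule ok_cong[OF assms])
qed

lemma ok_letter_in: "ok True s a w \<Longrightarrow> letter_in (raws s a) w"
  unfolding raws_def by (cases w) auto

lemma translate_Some: "s a = Some w \<Longrightarrow> translate I s a = Some (translate_letter I (raws s a) w)"
  unfolding translate_def by simp

lemma translate_SomeD:
  assumes "translate I s a = Some v"
  obtains w where "s a = Some w" "v = translate_letter I (raws s a) w"
  using assms unfolding translate_def by auto

lemma dom_trans: "dom (translate I s) = dom s"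
  unfolding translate_def by auto

lemma translate_mono:
  assumes s: "s \<in> nodes r" and le: "s \<subseteq>\<^sub>m s'"
  shows "translate I s \<subseteq>\<^sub>m translate I s'"
  unfolding map_le_def dom_trans
proof
  fix a assume a: "a \<in> dom s"
  have "s b = s' b" if "b \<in> underS k a" for b
    using le nodes_dom_closed[OF s a that] unfolding map_le_def by blast
  then have "raws s a = raws s' a" by (rule raws_cong)
  then show "translate I s a = translate I s' a"
    using le a unfolding translate_def map_le_def by simp
qed

text \<open>Induction on positions: equal earlier entries give equal sets \<open>raws\<close>, hence
  the same letter translation, which is injective.\<close>

lemma translate_le_iff:
  assumes I: "I \<subseteq> Field l" and s: "s \<in> nodes True" "bounded I s" and s': "s' \<in> nodes True" "bounded I s'"
  shows "translate I s \<subseteq>\<^sub>m translate I s' \<longleftrightarrow> s \<subseteq>\<^sub>m s'"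
proof
  assume le: "translate I s \<subseteq>\<^sub>m translate I s'"
  have "a \<in> dom s \<longrightarrow> s a = s' a" for a
  proof (induction a rule: wf_induct_rule[OF wf_underS[OF wok]])
    case (1 a)
    show ?case
    proof
      assume a: "a \<in> dom s"
      have "s b = s' b" if "b \<in> underS k a" for b
        using 1 that nodes_dom_closed[OF s(1) a that] by blast
      then have r: "raws s a = raws s' a" by (rule raws_cong)
      obtain w where w: "s a = Some w" using a by blast
      have "translate I s' a = Some (translate_letter I (raws s a) w)"
        using le a translate_Some[of s a w I] w unfolding map_le_def dom_trans by simp
      then obtain w' where w': "s' a = Some w'"
        "translate_letter I (raws s a) w = translate_letter I (raws s a) w'"
        unfolding r by (rule translate_SomeD)
      have "w = w'"
      proof (rule translate_letter_inj[OF I _ _ _ _ w'(2)])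
        show "letter_in (raws s a) w" by (rule ok_letter_in[OF nodes_ok[OF s(1) w]])
        show "letter_in (raws s a) w'" unfolding r by (rule ok_letter_in[OF nodes_ok[OF s'(1) w'(1)]])
        show "bounded_letter I w" "bounded_letter I w'"
          using s(2) s'(2) w w'(1) unfolding bounded_def by auto
      qed
      then show "s a = s' a" using w w' by simp
    qed
  qed
  then show "s \<subseteq>\<^sub>m s'" unfolding map_le_def by blast
next
  show "s \<subseteq>\<^sub>m s' \<Longrightarrow> translate I s \<subseteq>\<^sub>m translate I s'" by (rule translate_mono[OF s(1)])
qed

lemma translate_ok:
  assumes I: "I \<subseteq> Field l" and w: "s a = Some w" "ok True s a w" "bounded_letter I w"
  shows "ok False (translate I s) a (translate_letter I (raws s a) w)"
proof -
  note Plain_Field = translate_letter_Plain_Field[OF I ok_letter_in[OF w(2)] w(3)]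
  have main_before: "\<exists>w. translate I s b = Some w \<and> main w" if before: "\<exists>w. s b = Some w \<and> main w" for b
  proof -
    obtain v where v: "s b = Some v" "main v" using before by blast
    then show ?thesis using translate_Some[of s b v I] main_trans_letter[of I "raws s b" v] by simp
  qed
  show ?thesis
  proof (cases "translate_letter I (raws s a) w")
    case (Raw x e)
    then show ?thesis using translate_letter_not_Raw[of I "raws s a" w] by simp
  next
    case (Plain y j e)
    have "lab w = e" using lab_trans_letter[of I "raws s a" w] Plain by simp
    then have e: "e \<in> Field l" using ok_set_letter[OF w(2)] by (cases w) auto
    have "main w" using main_trans_letter[of I "raws s a" w] Plain by simp
    then have "\<forall>b \<in> underS k a. \<exists>w. s b = Some w \<and> main w" using w(2) by (cases w) fastforce+
    then show ?thesis using Plain Plain_Field[OF Plain] e main_before by simp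
  next
    case (Gadget g)
    then have "w = Gadget g" by (cases w) (auto split: if_splits)
    then obtain b v where b: "g \<in> Field l" "b \<in> underS k a" "nxt b = a" "s b = Some v"
      "g \<in> underS l (lab v)" using w(2) by auto
    then show ?thesis
      using Gadget translate_Some[of s b v I] b(4) lab_trans_letter[of I "raws s b" v] by auto
  qed
qed

section \<open>Survival under translation\<close>

lemma eventually_after:
  assumes "a \<in> Field k" "b \<in> Field k"
  obtains c where "c \<in> Field k" "(a, c) \<in> k" "b \<in> underS k c"
proof (cases "b \<in> underS k a")
  case True
  then show thesis using that assms(1) Well_order_refl[OF wok assms(1)] by blast
next
  case False
  then have "(a, b) \<in> k" using not_underS_iff[OF wok assms(2,1)] by blast
  then have "a \<in> underS k (nxt b)" using rel_underS_trans[OF wok _ nxt(1)[OF assms(2)]] by blast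
  then show thesis using that[of "nxt b"] nxt[OF assms(2)] underS_imp_rel by fast
qed

lemma survives_cong:
  assumes b: "b \<in> Field k" and eq: "\<And>a. b \<in> underS k a \<Longrightarrow> s a = s' a" and s: "survives s"
  shows "survives s'"
proof -
  obtain a0 where a0: "a0 \<in> Field k"
    "\<And>a. (a0, a) \<in> k \<Longrightarrow> (\<exists>x e. s a = Some (Raw x e)) \<or> good s a"
    using s unfolding survives_def by blast
  obtain c where c: "c \<in> Field k" "(a0, c) \<in> k" "b \<in> underS k c"
    by (rule eventually_after[OF a0(1) b])
  have "(\<exists>x e. s' a = Some (Raw x e)) \<or> good s' a" if a: "(c, a) \<in> k" for a
  proof -
    have 1: "b \<in> underS k a" by (rule underS_rel_trans[OF wok c(3) a])
    have 2: "b \<in> underS k (nxt a)"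
      using underS_trans[OF wok 1 nxt(1)] underS_Field_both[OF 1] by blast
    show ?thesis
      using a0(2)[OF Well_order_trans[OF wok c(2) a]] eq[OF 1] eq[OF 2] unfolding good_def by simp
  qed
  then show ?thesis using c(1) unfolding survives_def by blast
qed

lemma translate_letter_no_raws:
  assumes "R = (\<lambda>_. {})" "\<not> is_Raw w"
  shows "translate_letter I R w = w"
  using assms by (cases w) (auto simp: targets_def hotel_empty)

text \<open>On a branch of raw letters only, the entries that are limit points of \<open>I\<close>
  are distinct members of \<open>bad I\<close>, hence bounded in \<open>k\<close> by regularity.
  Beyond them each \<open>lower I x\<close> is below \<open>x\<close>, which is the next label. On
  any other branch a non-raw entry rules out raw letters later on, so translation is the identity on
  a tail, and survival depends only on tails.\<close>

lemma survives_trans: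
  assumes I: "I \<subseteq> Field l" and bad: "|bad I| <o k"
    and dom: "dom s = Field k" and ok: "\<And>a w. s a = Some w \<Longrightarrow> ok True s a w" and b: "bounded I s"
  shows "survives (translate I s) \<longleftrightarrow> survives s"
proof (cases "\<forall>a \<in> Field k. \<exists>x e. s a = Some (Raw x e)")
  case True
  define x where "x a = arg (the (s a))" for a
  define B where "B = {a \<in> Field k. limit_point I (x a)}"
  have raw: "\<exists>e. s a = Some (Raw (x a) e)" if "a \<in> Field k" for a
    using True that unfolding x_def by fastforce
  have neq: "x b \<noteq> x a" if "b \<in> underS k a" for a b
  proof -
    have "b \<in> Field k" "a \<in> Field k" using underS_Field_both[OF that] by auto
    then obtain d e where "s b = Some (Raw (x b) d)" "s a = Some (Raw (x a) e)" using raw by blast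
    then show ?thesis using ok[of a "Raw (x a) e"] that by auto
  qed
  have "inj_on x B"
  proof (rule inj_onI)
    fix a a' assume a: "a \<in> B" "a' \<in> B" "x a = x a'"
    then have "a \<in> Field k" "a' \<in> Field k" unfolding B_def by auto
    from underS_trichotomy[OF wok this] show "a = a'" using neq[of a a'] neq[of a' a] a(3) by auto
  qed
  moreover have "x ` B \<subseteq> bad I"
  proof
    fix z assume "z \<in> x ` B"
    then obtain a where a: "a \<in> Field k" "limit_point I (x a)" "z = x a" unfolding B_def by blast
    then obtain e where e: "s a = Some (Raw (x a) e)" using raw by blast
    have "bounded_letter I (Raw (x a) e)" using b e unfolding bounded_def by blast
    then show "z \<in> bad I" using ok[OF e] a unfolding bad_def by auto
  qed
  ultimately have "|B| \<le>o |bad I|" using card_of_ordLeq[of B "bad I"] by blast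
  then have "|B| <o k" by (rule ordLeq_ordLess_trans[OF _ bad])
  moreover have "B \<subseteq> Field k" unfolding B_def by blast
  ultimately obtain a0 where a0: "a0 \<in> Field k" "B \<subseteq> underS k a0"
    using regularCard_bounded[OF Ck reg_k] by blast
  have "good (translate I s) a" if a: "(a0, a) \<in> k" for a
  proof -
    have aF: "a \<in> Field k" using a by (auto simp: Field_def)
    have "a \<notin> underS k a0" using rel_underS_trans[OF wok a] underS_notIn by fast
    then have nb: "\<not> limit_point I (x a)" using a0(2) aF unfolding B_def by blast
    obtain e where e: "s a = Some (Raw (x a) e)" using raw[OF aF] by blast
    obtain e' where e': "s (nxt a) = Some (Raw (x (nxt a)) e')" using raw[OF nxt(2)[OF aF]] by blast
    have "x a = e'" using ok[OF e'] nxt(1)[OF aF] e by auto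
    then have lower: "lower I (x a) \<in> underS l e'" using lower(1)[OF nb] by simp
    have "bounded_letter I (Raw (x a) e)" using b e unfolding bounded_def by blast
    then have "enum (upper I (x a)) (x a) \<in> J" using enum_upper[OF I] by simp
    moreover obtain y' j' where "translate I s (nxt a) = Some (Plain y' j' e')"
      using translate_Some[of s "nxt a" _ I] e' by (cases "limit_point I (x (nxt a))") auto
    moreover have "translate I s a = Some (Plain (lower I (x a)) (enum (upper I (x a)) (x a)) e)"
      using translate_Some[of s a _ I] e nb by simp
    ultimately show ?thesis using lower unfolding good_def by blast
  qed
  then have "survives (translate I s)" using a0(1) unfolding survives_def by blast
  moreover have "survives s"
    unfolding survives_def
  proof (intro bexI[OF _ a0(1)] allI impI)
    fix a assume "(a0, a) \<in> k"
    then have "a \<in> Field k" unfolding Field_def by auto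
    then show "(\<exists>x e. s a = Some (Raw x e)) \<or> good s a" using True by blast
  qed
  ultimately show ?thesis by simp
next
  case False
  then obtain b where b: "b \<in> Field k" "\<nexists>x e. s b = Some (Raw x e)" by blast
  have eq: "translate I s a = s a" if ba: "b \<in> underS k a" for a
  proof -
    obtain w where w: "s a = Some w" using underS_Field_both[OF ba] dom by blast
    have no: "\<not> ok True s a (Raw x e)" for x e
      using b(2) ba by auto
    then have "raws s a = (\<lambda>_. {})" unfolding raws_def by (simp del: ok.simps)
    moreover have "\<not> is_Raw w"
    proof
      assume "is_Raw w"
      then obtain x e where "w = Raw x e" by (cases w) auto
      then show False using ok[OF w] no by blast
    qed
    ultimately show ?thesis using translate_letter_no_raws translate_Some[of s a w I] w by simp
  qed
  show ?thesis using survives_cong[OF b(1), of "translate I s" s] survives_cong[OF b(1), of s "translate I s"] eq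
    by auto
qed

lemma translate_nodes:
  assumes I: "I \<subseteq> Field l" and bad: "|bad I| <o k" and s: "s \<in> nodes True" "bounded I s"
  shows "translate I s \<in> nodes False"
proof -
  have "survives (translate I s)" if "dom s = Field k"
  proof -
    have "survives s"
      by (rule nodes_survives[OF s(1) that])
    then show ?thesis using survives_trans[OF I bad that nodes_ok[OF s(1)] s(2)] by blast
  qed
  moreover have "ok False (translate I s) a v" if v: "translate I s a = Some v" for a v
  proof -
    obtain w where w: "s a = Some w" "v = translate_letter I (raws s a) w" using v by (rule translate_SomeD)
    have "bounded_letter I w" using s(2) w(1) unfolding bounded_def by blast
    then show ?thesis unfolding w(2) by (rule translate_ok[OF I w(1) nodes_ok[OF s(1) w(1)]])
  qed
  moreover have "dom s = Field k \<or> (\<exists>a\<in>Field k. dom s = underS k a)"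
    by (rule sequence_tree.dom_node[OF sequence_tree_nodes s(1)])
  ultimately show ?thesis unfolding nodes_def dom_trans mem_Collect_eq by blast
qed

text \<open>The preimage is found by recursion on positions, since the rooms reserved at a position
  depend on the earlier entries of the preimage, not of \<open>c\<close>. At full length, survival
  is pulled back by \<open>survives_trans\<close>.\<close>

lemma translate_surj:
  assumes I: "I \<subseteq> Field l" and bad: "|bad I| <o k" and c: "c \<in> nodes False" "bounded I c"
  obtains s where "s \<in> nodes True" "bounded I s" "translate I s = c"
proof -
  let ?P = "\<lambda>f a r. (c a = None \<longrightarrow> r = None) \<and> (\<forall>v. c a = Some v \<longrightarrow>
    (\<exists>w. r = Some w \<and> ok True f a w \<and> bounded_letter I w \<and> translate_letter I (raws f a) w = v))"
  have "\<exists>f. \<forall>a. ?P f a (f a)"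
  proof (rule dependent_wf_choice[OF wf_underS[OF wok]])
    fix f g :: "'k \<rightharpoonup> 'l letter" and a r
    assume "\<And>z. (z, a) \<in> {(a, b). a \<in> underS k b} \<Longrightarrow> f z = g z"
    then have fg: "\<And>z. z \<in> underS k a \<Longrightarrow> f z = g z" by simp
    show "?P f a r = ?P g a r" using ok_cong[OF fg] raws_cong[OF fg] by simp
  next
    fix a and f :: "'k \<rightharpoonup> 'l letter"
    assume IH': "\<And>b. (b, a) \<in> {(a, b). a \<in> underS k b} \<Longrightarrow> ?P f b (f b)"
    show "\<exists>r. ?P f a r"
    proof (cases "c a")
      case None
      then show ?thesis by auto
    next
      case (Some v)
      have IH: "\<exists>w u. f b = Some w \<and> c b = Some u \<and> lab w = lab u \<and> main w = main u"
        if ba: "b \<in> underS k a" for b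
      proof -
        have "b \<in> dom c" using nodes_dom_closed[OF c(1) _ ba] Some by blast
        then obtain u where u: "c b = Some u" by blast
        then show ?thesis using IH'[of b] ba lab_trans_letter main_trans_letter by fastforce
      qed
      have "\<exists>w. ok True f a w \<and> bounded_letter I w \<and> translate_letter I (raws f a) w = v"
      proof (cases v)
        case (Raw x e)
        then show ?thesis using nodes_ok[OF c(1) Some] by simp
      next
        case (Plain y j e)
        have v: "y \<in> Field l" "j \<in> Field l" "e \<in> Field l" "\<forall>b\<in>underS k a. \<exists>w. c b = Some w \<and> main w"
          using nodes_ok[OF c(1) Some] Plain by auto
        have main: "\<forall>b\<in>underS k a. \<exists>w. f b = Some w \<and> main w" using v(4) IH by fastforce
        have "bounded_letter I v" using c(2) Some unfolding bounded_def by blast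
        then have "\<exists>i\<in>I. y \<in> underS l i" using Plain by simp
        then obtain w where w: "letter_in (raws f a) w" "bounded_letter I w"
          "translate_letter I (raws f a) w = Plain y j e" "(\<exists>j'. w = Plain y j' e) \<or> (\<exists>x. w = Raw x e)"
          by (rule translate_letter_surj[OF I _ v(2)])
        have "ok True f a w" using w(1,4) v main unfolding raws_def by auto
        then show ?thesis using w Plain by blast
      next
        case (Gadget g)
        obtain b u where b: "g \<in> Field l" "b \<in> underS k a" "nxt b = a" "c b = Some u" "g \<in> underS l (lab u)"
          using nodes_ok[OF c(1) Some] Gadget by auto
        then have "ok True f a (Gadget g)" using IH[OF b(2)] by auto
        then show ?thesis using Gadget by (intro exI[of _ "Gadget g"]) simp
      qed
      then show ?thesis using Some by auto
    qed
  qed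
  then obtain f where f: "\<And>a. ?P f a (f a)" by blast
  have some: "ok True f a w \<and> bounded_letter I w \<and> c a = Some (translate_letter I (raws f a) w)"
    if "f a = Some w" for a w
    using f[of a] that by (cases "c a") auto
  have eq: "translate I f = c"
  proof
    fix a show "translate I f a = c a"
    proof (cases "f a")
      case None
      then have "c a = None" using f[of a] by (cases "c a") auto
      then show ?thesis using None unfolding translate_def by simp
    next
      case (Some w)
      then show ?thesis using some[of a w] translate_Some[of f a w I] by simp
    qed
  qed
  have b: "bounded I f" unfolding bounded_def using some by blast
  have "survives f" if "dom c = Field k"
  proof -
    have "survives c" by (rule nodes_survives[OF c(1) that])
    moreover have "dom f = Field k" using dom_trans[of I f] that unfolding eq by simp
    ultimately show ?thesis
      using survives_trans[OF I bad _ _ b] some unfolding eq by blast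
  qed
  then have "f \<in> nodes True"
    using c(1) some dom_trans[of I f] unfolding nodes_def eq by auto
  then show thesis using b eq by (rule that)
qed

section \<open>Stability of the translation under end-extension of the commitments\<close>

text \<open>New commitments lie above \<open>i\<close>, hence above \<open>x\<close>, so
  \<open>I\<close> and \<open>I'\<close> agree below \<open>x\<close>.\<close>

lemma limit_point_extend:
  assumes I': "I \<subseteq> I'" "\<And>i i'. i \<in> I \<Longrightarrow> i' \<in> I' - I \<Longrightarrow> i \<in> underS l i'"
    and i: "i \<in> I" "(x, i) \<in> l"
  shows "i' \<in> I' \<Longrightarrow> i' \<in> underS l x \<Longrightarrow> i' \<in> I" "limit_point I' x = limit_point I x"
    "lower I' x = lower I x"
proof -
  show 1: "i' \<in> I" if "i' \<in> I'" "i' \<in> underS l x" for i'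
  proof (rule ccontr)
    assume "i' \<notin> I"
    then have "i \<in> underS l i'" using I'(2)[OF i(1)] that(1) by blast
    moreover have "i' \<in> underS l i" by (rule underS_rel_trans[OF wol that(2) i(2)])
    ultimately show False using underS_asym[OF wol] by blast
  qed
  have *: "(\<exists>i\<in>I'. y \<in> underS l i \<and> i \<in> underS l x) \<longleftrightarrow> (\<exists>i\<in>I. y \<in> underS l i \<and> i \<in> underS l x)" for y
    using 1 I'(1) by blast
  show "limit_point I' x = limit_point I x" unfolding limit_point_def * ..
  have "(\<forall>i\<in>I'. y \<in> underS l i \<longrightarrow> i \<notin> underS l x) \<longleftrightarrow> (\<forall>i\<in>I. y \<in> underS l i \<longrightarrow> i \<notin> underS l x)" for y
    using *[of y] by blast
  then show "lower I' x = lower I x" unfolding lower_def by simp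
qed

lemma upper_extend:
  assumes I': "I \<subseteq> I'" "I' \<subseteq> Field l" "\<And>i i'. i \<in> I \<Longrightarrow> i' \<in> I' - I \<Longrightarrow> i \<in> underS l i'"
    and i: "\<exists>i\<in>I. (x, i) \<in> l"
  shows "upper I' x = upper I x"
proof -
  have I: "I \<subseteq> Field l" using I'(1,2) by blast
  have i': "\<exists>i\<in>I'. (x, i) \<in> l" using i I'(1) by blast
  note u = upper[OF I i] and u' = upper[OF I'(2) i']
  have 1: "(upper I' x, upper I x) \<in> l" by (rule u'(3)[OF subsetD[OF I'(1) u(1)] u(2)])
  have "upper I' x \<in> I"
  proof (rule ccontr)
    assume "upper I' x \<notin> I"
    then have "upper I x \<in> underS l (upper I' x)" using I'(3)[OF u(1)] u'(1) by blast
    then show False using rel_underS_trans[OF wol 1] underS_notIn by fast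
  qed
  then have "(upper I x, upper I' x) \<in> l" using u(3) u'(2) by blast
  then show ?thesis by (rule Well_order_antisym[OF wol 1])
qed

text \<open>A raw point that only the new commitments bound lies above the old commitment
  \<open>i0\<close>, which is above \<open>y\<close>. So \<open>i0\<close> separates it from
  \<open>y\<close>, and its \<open>lower\<close> value cannot be \<open>y\<close>: no new rooms are
  reserved at \<open>y\<close>.\<close>

lemma targets_extend:
  assumes I': "I \<subseteq> I'" "I' \<subseteq> Field l" "\<And>i i'. i \<in> I \<Longrightarrow> i' \<in> I' - I \<Longrightarrow> i \<in> underS l i'"
    and y: "\<exists>i\<in>I. y \<in> underS l i"
  shows "targets I' X y = targets I X y"
proof -
  obtain i0 where i0: "i0 \<in> I" "y \<in> underS l i0" using y by blast
  have lp: "limit_point I' x = limit_point I x" and lo: "lower I' x = lower I x"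
    and up: "upper I' x = upper I x" if "\<exists>i\<in>I. (x, i) \<in> l" for x
    using that limit_point_extend(2,3)[OF I'(1,3)] upper_extend[OF I' that] by blast+
  have "(x \<in> X \<and> (\<exists>i\<in>I'. (x, i) \<in> l) \<and> \<not> limit_point I' x \<and> lower I' x = y) \<longleftrightarrow>
    (x \<in> X \<and> (\<exists>i\<in>I. (x, i) \<in> l) \<and> \<not> limit_point I x \<and> lower I x = y)" for x
  proof (cases "\<exists>i\<in>I. (x, i) \<in> l")
    case True
    then have "\<exists>i\<in>I'. (x, i) \<in> l" using I'(1) by blast
    then show ?thesis using True lp[OF True] lo[OF True] by simp
  next
    case False
    have "lower I' x \<noteq> y" if x: "\<not> limit_point I' x" "\<exists>i\<in>I'. (x, i) \<in> l"
    proof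
      assume eq: "lower I' x = y"
      have "x \<in> Field l" "i0 \<in> Field l" using x(2) i0(1) I' by (auto simp: Field_def)
      then have "i0 \<in> underS l x" using not_underS_iff[OF wol, of i0 x] False i0(1) by blast
      moreover have "lower I' x \<in> underS l i0" using i0(2) eq by simp
      ultimately show False using lower(2)[OF x(1) subsetD[OF I'(1) i0(1)]] by blast
    qed
    then show ?thesis using False by blast
  qed
  then have 1: "{enum (upper I' x) x |x. x \<in> X \<and> (\<exists>i\<in>I'. (x, i) \<in> l) \<and> \<not> limit_point I' x \<and> lower I' x = y}
    = {enum (upper I x) x |x. x \<in> X \<and> (\<exists>i\<in>I. (x, i) \<in> l) \<and> \<not> limit_point I x \<and> lower I x = y}"
    using up by (intro Collect_cong) metis
  have "\<exists>i\<in>I. (y, i) \<in> l" using i0 underS_imp_rel by fast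
  then show ?thesis unfolding targets_def 1 using lp by simp
qed

lemma translate_letter_extend:
  assumes I': "I \<subseteq> I'" "I' \<subseteq> Field l" "\<And>i i'. i \<in> I \<Longrightarrow> i' \<in> I' - I \<Longrightarrow> i \<in> underS l i'"
    and w: "bounded_letter I w"
  shows "translate_letter I' R w = translate_letter I R w" "bounded_letter I' w"
proof -
  show "bounded_letter I' w" using w I'(1) by (cases w) auto
  show "translate_letter I' R w = translate_letter I R w"
  proof (cases w)
    case (Raw x e)
    then have ex: "\<exists>i\<in>I. (x, i) \<in> l" using w by simp
    then obtain i where i: "i \<in> I" "(x, i) \<in> l" by (rule bexE)
    show ?thesis
      using Raw limit_point_extend(2,3)[OF I'(1,3) i] upper_extend[OF I' ex] by simp
  next
    case (Plain y j e)
    then show ?thesis using targets_extend[OF I', of y] w by simp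
  qed simp
qed

lemma translate_extend:
  assumes I': "I \<subseteq> I'" "I' \<subseteq> Field l" "\<And>i i'. i \<in> I \<Longrightarrow> i' \<in> I' - I \<Longrightarrow> i \<in> underS l i'"
    and s: "bounded I s"
  shows "translate I' s = translate I s" "bounded I' s"
proof -
  have b: "bounded_letter I w" if "s a = Some w" for a w using s that unfolding bounded_def by blast
  show "translate I' s = translate I s"
  proof
    fix a show "translate I' s a = translate I s a"
      unfolding translate_def using translate_letter_extend(1)[OF I' b] by (cases "s a") auto
  qed
  show "bounded I' s" unfolding bounded_def using translate_letter_extend(2)[OF I' b] by blast
qed

definition translate_graph :: "'l set \<Rightarrow> (('k \<rightharpoonup> 'l letter) \<times> ('k \<rightharpoonup> 'l letter)) set" where
  "translate_graph I = {(s, translate I s) |s. s \<in> nodes True \<and> bounded I s}"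

lemma partial_iso_trans_graph:
  assumes I: "I \<subseteq> Field l" and bad: "|bad I| <o k"
  shows "partial_iso (tree_struct (seq_order (nodes True))) (tree_struct (seq_order (nodes False)))
    (translate_graph I)"
proof -
  have N: "translate I s \<in> nodes False" if "s \<in> nodes True" "bounded I s" for s
    by (rule translate_nodes[OF I bad that])
  have eq: "s = s' \<longleftrightarrow> translate I s = translate I s'"
    if s: "s \<in> nodes True" "bounded I s" and s': "s' \<in> nodes True" "bounded I s'" for s s'
    using translate_le_iff[OF I s s'] translate_le_iff[OF I s' s] map_le_antisym[of s s'] by auto
  have le: "(s, s') \<in> seq_order (nodes True) - Id \<longleftrightarrow>
      (translate I s, translate I s') \<in> seq_order (nodes False) - Id"
    if s: "s \<in> nodes True" "bounded I s" and s': "s' \<in> nodes True" "bounded I s'" for s s'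
    using translate_le_iff[OF I s s'] eq[OF s s'] N[OF s] N[OF s'] s(1) s'(1)
    unfolding seq_order_def by auto
  show ?thesis
    unfolding tree_struct_def Field_seq_order
  proof (rule partial_isoI, unfold fst_conv snd_conv)
    show "a \<in> nodes True \<and> b \<in> nodes False" if "(a, b) \<in> translate_graph I" for a b
      using that N unfolding translate_graph_def by auto
    fix a b a' b' assume "(a, b) \<in> translate_graph I" "(a', b') \<in> translate_graph I"
    then have "a \<in> nodes True" "bounded I a" "b = translate I a" "a' \<in> nodes True" "bounded I a'"
      "b' = translate I a'"
      unfolding translate_graph_def by auto
    then show "(a = a' \<longleftrightarrow> b = b') \<and>
        ((a, a') \<in> seq_order (nodes True) - Id \<longleftrightarrow> (b, b') \<in> seq_order (nodes False) - Id)"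
      using eq[of a a'] le[of a a'] by simp
  qed
qed

lemma translate_graph_extend:
  assumes "I \<subseteq> I'" "I' \<subseteq> Field l" "\<And>i i'. i \<in> I \<Longrightarrow> i' \<in> I' - I \<Longrightarrow> i \<in> underS l i'"
  shows "translate_graph I \<subseteq> translate_graph I'"
proof
  fix p assume "p \<in> translate_graph I"
  then obtain s where s: "p = (s, translate I s)" "s \<in> nodes True" "bounded I s"
    unfolding translate_graph_def by blast
  then have "p = (s, translate I' s)" "bounded I' s" using translate_extend[OF assms s(3)] by simp_all
  then show "p \<in> translate_graph I'" using s(2) unfolding translate_graph_def by blast
qed

section \<open>Ranks of nodes\<close>

text \<open>Only first components of main letters need to be below a commitment; second components,
  labels and gadgets are translated without restriction.\<close>

definition rank :: "('k \<rightharpoonup> 'l letter) \<Rightarrow> 'l" where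
  "rank s = bound {arg w |w. w \<in> ran s \<and> main w}"

lemma rank:
  assumes s: "s \<in> nodes r"
  shows "rank s \<in> Field l" "i \<in> I \<Longrightarrow> rank s \<in> underS l i \<Longrightarrow> bounded I s"
proof -
  let ?K = "{arg w |w. w \<in> ran s \<and> main w}"
  have F: "?K \<subseteq> Field l"
  proof
    fix x assume "x \<in> ?K"
    then obtain w where w: "x = arg w" "w \<in> ran s" "main w" by blast
    have "set_letter w \<subseteq> Field l" using ran_node[OF s] w(2) by blast
    then show "x \<in> Field l" using w by (cases w) auto
  qed
  have "?K \<subseteq> (\<lambda>a. arg (the (s a))) ` Field k"
  proof
    fix x assume "x \<in> ?K"
    then obtain a w where w: "x = arg w" "s a = Some w" unfolding ran_def by blast
    then have "x = arg (the (s a))" "a \<in> Field k" using nodes_dom_Field[OF s] by auto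
    then show "x \<in> (\<lambda>a. arg (the (s a))) ` Field k" by blast
  qed
  then have K: "|?K| \<le>o m" by (rule card_subset_m[OF _ card_of_image_ordLeq[OF card_Field_k]])
  show "rank s \<in> Field l" unfolding rank_def by (rule bound(1)[OF F K])
  show "bounded I s" if i: "i \<in> I" "rank s \<in> underS l i"
    unfolding bounded_def
  proof (intro allI impI)
    fix a w assume w: "s a = Some w"
    show "bounded_letter I w"
    proof (cases "main w")
      case True
      then have "arg w \<in> ?K" using w unfolding ran_def by blast
      then have "arg w \<in> underS l (rank s)" using bound(2)[OF F K] unfolding rank_def by blast
      then have w': "arg w \<in> underS l i" by (rule underS_trans[OF wol _ i(2)])
      then show ?thesis using True i(1) underS_imp_rel[OF w'] by (cases w) auto
    next
      case False
      then show ?thesis by (cases w) auto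
    qed
  qed
qed


section \<open>The trees are not isomorphic\<close>

lemma bound_least:
  assumes "i \<in> Field l" "K \<subseteq> underS l i"
  shows "(bound K, i) \<in> l"
  unfolding bound_def by (rule wo_rel.minim_least[OF wo_rel_l]) (use assms in auto)

text \<open>A form of Fodor's lemma: the values below a point of cofinality \<open>m\<close> are used up by smaller points.\<close>

lemma not_regressive:
  assumes P: "P \<subseteq> Field l" "|P| \<le>o m" and h: "inj_on h (special - P)"
  obtains x where "x \<in> special - P" "\<not> (fst (h x) \<in> underS l x \<and> snd (h x) \<in> J)"
proof -
  \<comment> \<open>The points that \<open>h\<close> sends to a first component at most
    \<open>c\<close> with second component in \<open>J\<close>. Injectivity of \<open>h\<close>
    leaves at most \<open>m\<close> of them.\<close>
  define D where "D c = {x \<in> special - P. (fst (h x), c) \<in> l \<and> snd (h x) \<in> J}" for c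
  have D: "|D c| \<le>o m" for c
  proof -
    have "h ` D c \<subseteq> under l c \<times> J"
      by (rule image_subsetI) (simp add: D_def under_def mem_Times_iff)
    moreover have "inj_on h (D c)" by (rule inj_on_subset[OF h]) (auto simp: D_def)
    ultimately have "|D c| \<le>o |under l c \<times> J|" using card_of_ordLeq[of "D c" "under l c \<times> J"] by blast
    then show ?thesis
      by (rule ordLeq_transitive[OF _ card_Times_m[OF under_l_le ordIso_imp_ordLeq[OF J(2)]]])
  qed
  \<comment> \<open>Requirements for stage \<open>i\<close> of an increasing sequence of length
    \<open>m\<close>: exceed the earlier stages, the set \<open>P\<close> and all earlier
    \<open>D (f i')\<close>. Intersecting with \<open>Field l\<close> keeps the set boundable for
    arbitrary \<open>f\<close>, as the recursion demands.\<close>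
  define S where "S f i = (f ` underS m i \<union> P \<union> (\<Union>i' \<in> underS m i. D (f i'))) \<inter> Field l"
    for f :: "'m \<Rightarrow> 'l" and i
  have inf: "infinite (Field m)" and card: "Card_order m" using Cm unfolding cinfinite_def by auto
  note un = card_of_Un_ordLeq_infinite_Field[OF inf _ _ card]
  have um: "|underS m i| \<le>o m" for i
    by (rule card_subset_m[OF _ card_Field_m]) (auto dest: underS_Field)
  have S: "|S f i| \<le>o m" for f i
  proof -
    have "|f ` underS m i \<union> P \<union> (\<Union>i' \<in> underS m i. D (f i'))| \<le>o m"
      by (rule un[OF un[OF card_of_image_ordLeq[OF um] P(2)] card_of_UN_ordLeq_Cinfinite[OF Cm um D]])
    then show ?thesis by (rule card_subset_m[rotated]) (auto simp: S_def)
  qed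
  have "\<exists>f. \<forall>i. f i \<in> Field l \<and> S f i \<subseteq> underS l (f i)"
  proof (rule dependent_wf_choice[OF wf_underS[OF wom]])
    fix f g :: "'m \<Rightarrow> 'l" and i r
    assume "\<And>z. (z, i) \<in> {(a, b). a \<in> underS m b} \<Longrightarrow> f z = g z"
    then have "S f i = S g i" unfolding S_def by simp
    then show "(r \<in> Field l \<and> S f i \<subseteq> underS l r) = (r \<in> Field l \<and> S g i \<subseteq> underS l r)" by simp
  next
    fix i and f :: "'m \<Rightarrow> 'l"
    have "S f i \<subseteq> Field l" unfolding S_def by blast
    then obtain r where "r \<in> Field l" "S f i \<subseteq> underS l r" using bounded_l[OF _ S] by blast
    then show "\<exists>r. r \<in> Field l \<and> S f i \<subseteq> underS l r" by blast
  qed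
  then obtain f where f: "\<And>i. f i \<in> Field l" "\<And>i. S f i \<subseteq> underS l (f i)" by blast
  have incr: "f i' \<in> underS l (f i)" if "i' \<in> underS m i" for i i'
    using f(2)[of i] f(1)[of i'] that unfolding S_def by blast
  \<comment> \<open>The supremum of the sequence. It is special because the sequence is strictly
    increasing of regular length \<open>m\<close>.\<close>
  let ?d = "bound (f ` Field m)"
  have fF: "f ` Field m \<subseteq> Field l" using f(1) by blast
  note d = bound[OF fF card_of_image_ordLeq[OF card_Field_m]]
  have below: "\<exists>i \<in> Field m. (c, f i) \<in> l" if c: "c \<in> underS l ?d" for c
  proof (rule ccontr)
    assume none: "\<not> (\<exists>i \<in> Field m. (c, f i) \<in> l)"
    have cF: "c \<in> Field l" using underS_Field_both[OF c] by blast
    have "f ` Field m \<subseteq> underS l c"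
    proof
      fix z assume "z \<in> f ` Field m"
      then have "(c, z) \<notin> l" "z \<in> Field l" using none fF by auto
      then show "z \<in> underS l c" using not_underS_iff[OF wol _ cF] by blast
    qed
    then have "(?d, c) \<in> l" by (rule bound_least[OF cF])
    then show False using rel_underS_trans[OF wol _ c] underS_notIn by fast
  qed
  obtain i0 where i0: "i0 \<in> Field m" using inf by fastforce
  have fd: "f i \<in> underS l ?d" if "i \<in> Field m" for i using d(2) that by blast
  have "P \<subseteq> underS l (f i0)" using f(2)[of i0] P(1) unfolding S_def by blast
  then have "?d \<notin> P" using underS_asym[OF wol] fd[OF i0] by blast
  moreover have "?d \<in> special"
    unfolding special_def
  proof (intro CollectI conjI d(1) allI impI)
    fix K assume K: "K \<subseteq> underS l ?d" "|K| <o m"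
    obtain g where g: "\<And>c. c \<in> K \<Longrightarrow> g c \<in> Field m \<and> (c, f (g c)) \<in> l"
      using bchoice[of K "\<lambda>c i. i \<in> Field m \<and> (c, f i) \<in> l"] below K(1) by blast
    have "g ` K \<subseteq> Field m" using g by blast
    then obtain i where i: "i \<in> Field m" "g ` K \<subseteq> underS m i"
      using regularCard_bounded[OF Cm reg_m _ card_of_image_ordLess[OF K(2)]] by blast
    have "K \<subseteq> underS l (f i)"
    proof
      fix c assume c: "c \<in> K"
      then have "f (g c) \<in> underS l (f i)" using incr i(2) by blast
      then show "c \<in> underS l (f i)" using rel_underS_trans[OF wol] g[OF c] by blast
    qed
    then show "\<exists>c \<in> underS l ?d. K \<subseteq> underS l c" using fd[OF i(1)] by blast
  qed
  moreover have "\<not> (fst (h ?d) \<in> underS l ?d \<and> snd (h ?d) \<in> J)"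
  proof
    \<comment> \<open>The value of \<open>h\<close> at the supremum is caught by some stage
      \<open>f i\<close>; then the supremum lies in \<open>D (f i)\<close> and hence below a later
      stage, which is absurd.\<close>
    assume reg: "fst (h ?d) \<in> underS l ?d \<and> snd (h ?d) \<in> J"
    then obtain i where i: "i \<in> Field m" "(fst (h ?d), f i) \<in> l" using below by blast
    have "?d \<in> D (f i)" using reg i(2) \<open>?d \<in> special\<close> \<open>?d \<notin> P\<close> unfolding D_def by blast
    moreover obtain i' where i': "i \<in> underS m i'" by (rule Cinfinite_greater[OF Cm i(1)])
    ultimately have "?d \<in> underS l (f i')" using f(2)[of i'] d(1) unfolding S_def by blast
    then show False using underS_asym[OF wol] fd underS_Field_both[OF i'] by blast
  qed
  ultimately show thesis using that by blast
qed

section \<open>Isomorphisms preserve levels\<close>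

definition node_iso :: "bool \<Rightarrow> bool \<Rightarrow> (('k \<rightharpoonup> 'l letter) \<Rightarrow> ('k \<rightharpoonup> 'l letter)) \<Rightarrow> bool" where
  "node_iso r r' F \<longleftrightarrow> bij_betw F (nodes r) (nodes r') \<and>
     (\<forall>s \<in> nodes r. \<forall>t \<in> nodes r. s \<subseteq>\<^sub>m t \<longleftrightarrow> F s \<subseteq>\<^sub>m F t)"

lemma node_iso_inverse:
  assumes "node_iso r r' F"
  shows "node_iso r' r (the_inv_into (nodes r) F)"
proof -
  have b: "bij_betw F (nodes r) (nodes r')"
    and le: "\<And>s t. s \<in> nodes r \<Longrightarrow> t \<in> nodes r \<Longrightarrow> s \<subseteq>\<^sub>m t \<longleftrightarrow> F s \<subseteq>\<^sub>m F t"
    using assms unfolding node_iso_def by auto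
  let ?G = "the_inv_into (nodes r) F"
  have b': "bij_betw ?G (nodes r') (nodes r)" by (rule bij_betw_the_inv_into[OF b])
  have "s \<subseteq>\<^sub>m t \<longleftrightarrow> ?G s \<subseteq>\<^sub>m ?G t" if "s \<in> nodes r'" "t \<in> nodes r'" for s t
    using le[of "?G s" "?G t"] bij_betwE[OF b'] that f_the_inv_into_f_bij_betw[OF b] by auto
  then show ?thesis using b' unfolding node_iso_def by blast
qed

context
  fixes r r' F
  assumes F: "node_iso r r' F"
begin

lemma node_iso_in: "s \<in> nodes r \<Longrightarrow> F s \<in> nodes r'"
  using F bij_betwE unfolding node_iso_def by blast

lemma node_iso_le: "s \<in> nodes r \<Longrightarrow> t \<in> nodes r \<Longrightarrow> F s \<subseteq>\<^sub>m F t \<longleftrightarrow> s \<subseteq>\<^sub>m t"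
  using F unfolding node_iso_def by blast

lemma node_iso_inj: "s \<in> nodes r \<Longrightarrow> t \<in> nodes r \<Longrightarrow> F s = F t \<Longrightarrow> s = t"
  using F unfolding node_iso_def by (meson bij_betw_imp_inj_on inj_onD)

lemma node_iso_surj:
  assumes "t \<in> nodes r'"
  obtains s where "s \<in> nodes r" "F s = t"
proof -
  have "t \<in> F ` nodes r" using F assms unfolding node_iso_def bij_betw_def by simp
  then show thesis using that by (elim imageE) simp
qed

text \<open>By induction the proper initial segments of \<open>s\<close> keep their lengths. They
  are mapped onto those of \<open>F s\<close>, surjectivity of \<open>F\<close> giving that none is
  missed, so both sequences have the same positions.\<close>

lemma node_iso_dom:
  assumes "s \<in> nodes r" "a \<in> Field k" "dom s = underS k a"
  shows "dom (F s) = underS k a"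
  using assms
proof (induction a arbitrary: s rule: wf_induct_rule[OF wf_underS[OF wok]])
  case (1 a)
  note s = 1(2) and d = 1(4)
  note restrict = sequence_tree.restrict_node[OF sequence_tree_nodes]
  note dom_restrict = sequence_tree.dom_restrict[OF sequence_tree_nodes]
  note Fs = node_iso_in[OF s]
  have IH: "dom (F (s |` underS k b)) = underS k b" if b: "b \<in> underS k a" for b
  proof (rule 1(1))
    show "(b, a) \<in> {(a, b). a \<in> underS k b}" using b by simp
    show "b \<in> Field k" using underS_Field_both[OF b] by blast
    then show "s |` underS k b \<in> nodes r" by (rule restrict[OF s])
    show "dom (s |` underS k b) = underS k b" by (rule dom_restrict[OF s]) (use b d in simp)
  qed
  show ?case
  proof (intro equalityI subsetI)
    fix c assume c: "c \<in> dom (F s)"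
    then have cF: "c \<in> Field k" using nodes_dom_Field[OF Fs] by blast
    obtain t where t: "t \<in> nodes r" "F t = F s |` underS k c"
      by (rule node_iso_surj[OF restrict[OF Fs cF]])
    have "F t \<subseteq>\<^sub>m F s" unfolding t(2) by (simp add: map_le_def)
    then have "t \<subseteq>\<^sub>m s" using node_iso_le[OF t(1) s] by blast
    moreover have "t \<noteq> s"
    proof
      assume "t = s"
      then have "c \<in> dom (F s |` underS k c)" using c t(2) by simp
      then show False using underS_notIn[of c k] by simp
    qed
    ultimately obtain b where b: "b \<in> dom s" "t = s |` underS k b"
      by (rule sequence_tree.proper_initial_segment[OF sequence_tree_nodes s t(1)])
    have bF: "b \<in> Field k" using nodes_dom_Field[OF s] b(1) by blast
    have "underS k b = underS k c"
      using IH[of b] b d arg_cong[OF t(2), of dom] dom_restrict[OF Fs c] by simp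
    then have "b = c" by (rule underS_inj[OF wok bF cF])
    then show "c \<in> underS k a" using b(1) d by simp
  next
    fix b assume b: "b \<in> underS k a"
    have bF: "b \<in> Field k" using underS_Field_both[OF b] by blast
    let ?t = "s |` underS k b"
    have t: "?t \<in> nodes r" by (rule restrict[OF s bF])
    have "b \<notin> dom ?t" using underS_notIn[of b k] by simp
    then have "?t \<noteq> s" using b d by (metis (no_types))
    then have "F ?t \<noteq> F s" using node_iso_inj[OF t s] by blast
    moreover have "F ?t \<subseteq>\<^sub>m F s" using node_iso_le[OF t s] by (simp add: map_le_def)
    ultimately obtain c where c: "c \<in> dom (F s)" "F ?t = F s |` underS k c"
      using sequence_tree.proper_initial_segment[OF sequence_tree_nodes Fs node_iso_in[OF t]] by blast
    have cF: "c \<in> Field k" using nodes_dom_Field[OF Fs] c(1) by blast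
    have "underS k b = underS k c"
      using IH[OF b] arg_cong[OF c(2), of dom] dom_restrict[OF Fs c(1)] by simp
    then have "b = c" by (rule underS_inj[OF wok bF cF])
    then show "b \<in> dom (F s)" using c(1) by simp
  qed
qed

lemma node_iso_restrict:
  assumes s: "s \<in> nodes r" and t: "t \<in> nodes r" "t \<subseteq>\<^sub>m s" and a: "a \<in> Field k" "dom t = underS k a"
  shows "F t = F s |` underS k a"
  by (rule map_le_restrict[OF _ node_iso_dom[OF t(1) a]]) (use node_iso_le[OF t(1) s] t(2) in blast)

lemma node_iso_extend:
  assumes s: "s \<in> nodes r" "a \<in> Field k" "dom s = underS k a" and w: "ok r s a w"
  shows "F (s(a \<mapsto> w)) \<in> nodes r'" "dom (F (s(a \<mapsto> w))) = underS k (nxt a)"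
    "F (s(a \<mapsto> w)) |` underS k a = F s" "\<exists>v. F (s(a \<mapsto> w)) a = Some v"
proof -
  note e = extend_node[OF s w]
  show "F (s(a \<mapsto> w)) \<in> nodes r'" by (rule node_iso_in[OF e(1)])
  show d: "dom (F (s(a \<mapsto> w))) = underS k (nxt a)" by (rule node_iso_dom[OF e(1) nxt(2)[OF s(2)] e(2)])
  have "s \<subseteq>\<^sub>m s(a \<mapsto> w)" using s(3) underS_notIn[of a k] by (auto simp: map_le_def)
  from node_iso_restrict[OF e(1) s(1) this s(2,3)]
  show "F (s(a \<mapsto> w)) |` underS k a = F s" by simp
  show "\<exists>v. F (s(a \<mapsto> w)) a = Some v" using d nxt(1)[OF s(2)] by blast
qed

end

section \<open>Isomorphisms preserve gadgets and labels\<close>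

lemma restrict_Some: "s |` A = t \<Longrightarrow> t a = Some v \<Longrightarrow> s a = Some v"
  by (auto simp: restrict_map_def split: if_splits)

lemma ok_Gadget_iff:
  assumes a: "a \<in> Field k" and s: "s a = Some w"
  shows "ok r s (nxt a) (Gadget g) \<longleftrightarrow> g \<in> underS l (lab w)"
proof -
  have "b = a" if "b \<in> underS k (nxt a)" "nxt b = nxt a" for b
    using nxt_inj[OF _ a that(2)] underS_Field_both[OF that(1)] by blast
  then have "g \<in> underS l (lab w)" if ok: "ok r s (nxt a) (Gadget g)" using ok s by fastforce
  moreover have "ok r s (nxt a) (Gadget g)" if "g \<in> underS l (lab w)"
    using that s nxt(1)[OF a] underS_Field_both[OF that] by auto
  ultimately show ?thesis by blast
qed

text \<open>This tells main letters from gadgets: a gadget is followed by gadgets only, a main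
  letter can always be followed by a plain one. The components \<open>star\<close> are an arbitrary
  choice.\<close>

lemma main_ok_Plain:
  assumes s: "s \<in> nodes r" "a \<in> Field k" "s a = Some w" "main w"
  shows "ok r s (nxt a) (Plain star star star)"
proof -
  have "\<exists>v. s b = Some v \<and> main v" if b: "b \<in> underS k (nxt a)" for b
  proof (cases "b = a")
    case True
    then show ?thesis using s by simp
  next
    case False
    then have "b \<in> underS k a" using b nxt(3)[OF s(2)] unfolding under_def underS_def by blast
    moreover have "ok r s a w" by (rule nodes_ok[OF s(1,3)])
    ultimately show ?thesis using s(4) by (cases w) fastforce+
  qed
  then show ?thesis using star(1) by simp
qed

lemma Gadget_successor:
  assumes s: "ok r s (nxt a) v" "a \<in> Field k" "s a = Some (Gadget g)"
  obtains g' where "v = Gadget g'" "g' \<in> underS l g"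
proof (cases v)
  case (Raw x e)
  then show thesis using s nxt(1)[OF s(2)] by fastforce
next
  case (Plain y j e)
  then show thesis using s nxt(1)[OF s(2)] by fastforce
next
  case (Gadget g')
  then have "g' \<in> underS l g" using s(1) ok_Gadget_iff[of a s "Gadget g" r g'] s(2,3) Gadget by simp
  then show thesis using that Gadget by blast
qed

text \<open>Induction on \<open>g\<close>. Pulled back along the inverse, all successors of
  \<open>F s\<close> turn out to be gadgets below \<open>g\<close>, so \<open>F s\<close> does not
  end in a main letter. A larger gadget there would admit \<open>Gadget g\<close> as successor; a
  smaller one would, by the induction hypothesis, be followed by itself.\<close>

lemma node_iso_Gadget:
  assumes F: "node_iso r r' F"
    and s: "s \<in> nodes r" "a \<in> Field k" "dom s = underS k (nxt a)" "s a = Some (Gadget g)"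
  shows "F s a = Some (Gadget g)"
  using s
proof (induction g arbitrary: s a rule: wf_induct_rule[OF wf_underS[OF wol]])
  case (1 g)
  note s = 1(2) and a = 1(3) and d = 1(4) and sa = 1(5)
  note na = nxt(2)[OF a]
  have IH: "F t b = Some (Gadget g')"
    if "g' \<in> underS l g" "t \<in> nodes r" "b \<in> Field k" "dom t = underS k (nxt b)" "t b = Some (Gadget g')"
    for g' t b
    using 1(1)[of g' t b] that by blast
  have Fs: "F s \<in> nodes r'" "dom (F s) = underS k (nxt a)"
    using node_iso_in[OF F s] node_iso_dom[OF F s na d] by auto
  have children: "\<exists>g'. v = Gadget g' \<and> g' \<in> underS l g" if v: "ok r' (F s) (nxt a) v" for v
  proof -
    note t = extend_node[OF Fs(1) na Fs(2) v]
    let ?G = "the_inv_into (nodes r) F"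
    note G = node_iso_inverse[OF F]
    have bij: "bij_betw F (nodes r) (nodes r')" using F unfolding node_iso_def by blast
    have FG: "F (?G u) = u" if "u \<in> nodes r'" for u by (rule f_the_inv_into_f_bij_betw[OF bij that])
    have GF: "?G (F u) = u" if "u \<in> nodes r" for u
      by (rule the_inv_into_f_f[OF bij_betw_imp_inj_on[OF bij] that])
    let ?t = "?G ((F s)(nxt a \<mapsto> v))"
    have tN: "?t \<in> nodes r" by (rule node_iso_in[OF G t(1)])
    note e = node_iso_extend[OF G Fs(1) na Fs(2) v]
    obtain w where w: "?t (nxt a) = Some w" using e(4) by blast
    have res: "?t |` underS k (nxt a) = s" using e(3) unfolding GF[OF s] .
    then have ta: "?t a = Some (Gadget g)" using sa by (rule restrict_Some)
    obtain g' where g': "w = Gadget g'" "g' \<in> underS l g"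
      by (rule Gadget_successor[OF nodes_ok[OF tN w] a ta])
    have "F ?t (nxt a) = Some (Gadget g')" by (rule IH[OF g'(2) tN na e(2)]) (use w g'(1) in simp)
    then show ?thesis using FG[OF t(1)] g'(2) by simp
  qed
  obtain w where w: "F s a = Some w" using Fs(2) nxt(1)[OF a] by blast
  have "\<not> main w"
  proof
    assume "main w"
    then show False using children[OF main_ok_Plain[OF Fs(1) a w]] by simp
  qed
  then obtain g2 where g2: "w = Gadget g2" by (cases w) auto
  have gF: "g \<in> Field l" "g2 \<in> Field l"
    using ok_set_letter[OF nodes_ok[OF s sa]] ok_set_letter[OF nodes_ok[OF Fs(1) w]] g2 by auto
  have "g \<notin> underS l g2"
  proof
    assume "g \<in> underS l g2"
    then have "ok r' (F s) (nxt a) (Gadget g)" using ok_Gadget_iff[of a "F s" w r' g] a w g2 by simp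
    then show False using children underS_notIn[of g l] by blast
  qed
  moreover have "g2 \<notin> underS l g"
  proof
    assume less: "g2 \<in> underS l g"
    then have ok: "ok r s (nxt a) (Gadget g2)" using ok_Gadget_iff[of a s "Gadget g" r g2] a sa by simp
    note e = node_iso_extend[OF F s na d ok] and x = extend_node[OF s na d ok]
    have "F (s(nxt a \<mapsto> Gadget g2)) (nxt a) = Some (Gadget g2)"
      by (rule IH[OF less x(1) na x(2)]) simp
    from nodes_ok[OF e(1) this]
    have "g2 \<in> underS l (lab w)" using ok_Gadget_iff[OF a, of "F (s(nxt a \<mapsto> Gadget g2))" w r' g2] restrict_Some[OF e(3) w] by blast
    then show False using g2 underS_notIn by fastforce
  qed
  ultimately show ?case using underS_trichotomy[OF wol gF] w g2 by auto
qed

text \<open>The gadgets that may follow a letter are exactly those below its label, and isomorphisms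
  fix gadgets. Applied to the inverse as well, this gives equality of labels.\<close>

lemma node_iso_lab_mono:
  assumes F: "node_iso r r' F"
    and s: "s \<in> nodes r" "a \<in> Field k" "dom s = underS k (nxt a)" "s a = Some w" and w': "F s a = Some w'"
  shows "underS l (lab w) \<subseteq> underS l (lab w')"
proof
  fix g assume "g \<in> underS l (lab w)"
  then have ok: "ok r s (nxt a) (Gadget g)" using ok_Gadget_iff[of a s w r g] s(2,4) by blast
  note na = nxt(2)[OF s(2)]
  note e = node_iso_extend[OF F s(1) na s(3) ok] and x = extend_node[OF s(1) na s(3) ok]
  have "F (s(nxt a \<mapsto> Gadget g)) (nxt a) = Some (Gadget g)"
    by (rule node_iso_Gadget[OF F x(1) na x(2)]) simp
  from nodes_ok[OF e(1) this]
  show "g \<in> underS l (lab w')" using ok_Gadget_iff[OF s(2), of "F (s(nxt a \<mapsto> Gadget g))" w' r' g] restrict_Some[OF e(3) w'] by blast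
qed

lemma node_iso_main:
  assumes F: "node_iso r r' F"
    and s: "s \<in> nodes r" "a \<in> Field k" "dom s = underS k (nxt a)" "s a = Some w" and w: "main w"
  obtains w' where "F s a = Some w'" "main w'" "lab w' = lab w"
proof -
  note na = nxt(2)[OF s(2)]
  have Fs: "F s \<in> nodes r'" "dom (F s) = underS k (nxt a)"
    using node_iso_in[OF F s(1)] node_iso_dom[OF F s(1) na s(3)] by auto
  obtain w' where w': "F s a = Some w'" using Fs(2) nxt(1)[OF s(2)] by blast
  let ?G = "the_inv_into (nodes r) F"
  note G = node_iso_inverse[OF F]
  have "bij_betw F (nodes r) (nodes r')" using F unfolding node_iso_def by blast
  then have GF: "?G (F s) = s" by (rule the_inv_into_f_f[OF bij_betw_imp_inj_on s(1)])
  have "main w'"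
  proof (rule ccontr)
    assume "\<not> main w'"
    then obtain g where "w' = Gadget g" by (cases w') auto
    then have "?G (F s) a = Some (Gadget g)" using node_iso_Gadget[OF G Fs(1) s(2) Fs(2)] w' by blast
    then show False using s(4) w unfolding GF by simp
  qed
  moreover have "lab w' = lab w"
  proof -
    have "underS l (lab w') \<subseteq> underS l (lab w)"
      using node_iso_lab_mono[OF G Fs(1) s(2) Fs(2) w'] s(4) unfolding GF by blast
    moreover have "underS l (lab w) \<subseteq> underS l (lab w')" by (rule node_iso_lab_mono[OF F s w'])
    moreover have "lab w \<in> Field l" using ok_set_letter[OF nodes_ok[OF s(1,4)]] by (cases w) auto
    moreover have "lab w' \<in> Field l" using ok_set_letter[OF nodes_ok[OF Fs(1) w']] by (cases w') auto
    ultimately show ?thesis using underS_inj[OF wol, of "lab w'" "lab w"] by blast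
  qed
  ultimately show thesis using that w' by blast
qed

section \<open>A branch of raw letters whose image has no good entry\<close>

lemma node_not_regressive:
  assumes F: "node_iso True False F"
    and s: "s \<in> nodes True" "a \<in> Field k" "dom s = underS k a"
    and raw: "\<And>b. b \<in> underS k a \<Longrightarrow> \<exists>x e. s b = Some (Raw x e)"
  obtains x e where "ok True s a (Raw x e)"
    "\<And>y j d. F (s(a \<mapsto> Raw x e)) a = Some (Plain y j d) \<Longrightarrow> j \<in> J \<Longrightarrow> y \<notin> underS l x"
proof -
  define P where "P = (\<lambda>b. arg (the (s b))) ` underS k a"
  have "P \<subseteq> Field l"
  proof
    fix z assume "z \<in> P"
    then obtain b where b: "b \<in> underS k a" "z = arg (the (s b))" unfolding P_def by blast
    then obtain x e where "s b = Some (Raw x e)" using raw by blast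
    then show "z \<in> Field l" using ok_set_letter[OF nodes_ok[OF s(1)]] b(2) by fastforce
  qed
  moreover have "|P| \<le>o m"
    unfolding P_def
    by (rule card_of_image_ordLeq[OF card_subset_m[OF _ card_Field_k]]) (auto dest: underS_Field)
  ultimately have P: "P \<subseteq> Field l" "|P| \<le>o m" by auto
  \<comment> \<open>At a successor position the label is forced to be the preceding raw point;
    elsewhere every label is allowed and \<open>star\<close> is taken.\<close>
  obtain e where e: "e \<in> Field l" "\<And>b x d. b \<in> underS k a \<Longrightarrow> nxt b = a \<Longrightarrow> s b = Some (Raw x d) \<Longrightarrow> x = e"
  proof (cases "\<exists>b \<in> underS k a. nxt b = a")
    case True
    then obtain b where b: "b \<in> underS k a" "nxt b = a" by blast
    then obtain x d where x: "s b = Some (Raw x d)" using raw by blast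
    have "x \<in> Field l" using ok_set_letter[OF nodes_ok[OF s(1) x]] by simp
    moreover have "x' = x" if b': "b' \<in> underS k a" "nxt b' = a" "s b' = Some (Raw x' d')" for b' x' d'
    proof -
      have "b' = b" using nxt_inj[of b' b] b b'(1,2) underS_Field_both by metis
      then show ?thesis using x b'(3) by simp
    qed
    ultimately show thesis using that by blast
  next
    case False
    then show thesis using that[OF star(1)] by blast
  qed
  have ok: "ok True s a (Raw x e)" if x: "x \<in> special - P" for x
  proof -
    have "\<exists>x' e'. s b = Some (Raw x' e') \<and> x' \<noteq> x \<and> (nxt b = a \<longrightarrow> x' = e)" if b: "b \<in> underS k a" for b
    proof -
      obtain x' e' where x': "s b = Some (Raw x' e')" using raw[OF b] by blast
      then have "x' \<in> P" unfolding P_def using b by force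
      then show ?thesis using x' x e(2)[OF b _ x'] by blast
    qed
    then show ?thesis using x e(1) by simp
  qed
  define v where "v x = the (F (s(a \<mapsto> Raw x e)) a)" for x
  have v: "F (s(a \<mapsto> Raw x e)) a = Some (Plain (arg (v x)) (copy (v x)) e)" if x: "x \<in> special - P" for x
  proof -
    note t = extend_node[OF s ok[OF x]]
    obtain w where w: "F (s(a \<mapsto> Raw x e)) a = Some w" "main w" "lab w = lab (Raw x e)"
      by (rule node_iso_main[OF F t(1) s(2) t(2), of "Raw x e"]) auto
    have "ok False (F (s(a \<mapsto> Raw x e))) a w" by (rule nodes_ok[OF node_iso_in[OF F t(1)] w(1)])
    then show ?thesis using w unfolding v_def by (cases w) auto
  qed
  have "inj_on (\<lambda>x. (arg (v x), copy (v x))) (special - P)"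
  proof (rule inj_onI)
    fix x x' assume x: "x \<in> special - P" "x' \<in> special - P"
      and eq: "(arg (v x), copy (v x)) = (arg (v x'), copy (v x'))"
    let ?t = "s(a \<mapsto> Raw x e)" and ?t' = "s(a \<mapsto> Raw x' e)"
    note t = extend_node[OF s ok[OF x(1)]] node_iso_extend[OF F s ok[OF x(1)]]
    note t' = extend_node[OF s ok[OF x(2)]] node_iso_extend[OF F s ok[OF x(2)]]
    have "F ?t = F ?t'"
    proof
      fix b show "F ?t b = F ?t' b"
      proof (cases "b = a")
        case True
        then show ?thesis using v[OF x(1)] v[OF x(2)] eq by simp
      next
        case False
        show ?thesis
        proof (cases "b \<in> underS k (nxt a)")
          case True
          then have "b \<in> underS k a" using False nxt(3)[OF s(2)] unfolding under_def underS_def by blast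
          then show ?thesis using fun_cong[OF t(5), of b] fun_cong[OF t'(5), of b] by simp
        next
          case False
          then have "F ?t b = None" "F ?t' b = None" using t(4) t'(4) by (metis domIff)+
          then show ?thesis by simp
        qed
      qed
    qed
    then have "?t = ?t'" by (rule node_iso_inj[OF F t(1) t'(1)])
    then show "x = x'" by (metis fun_upd_same letter.inject(1) option.inject)
  qed
  then obtain x where x: "x \<in> special - P"
    "\<not> (fst ((\<lambda>x. (arg (v x), copy (v x))) x) \<in> underS l x \<and> snd ((\<lambda>x. (arg (v x), copy (v x))) x) \<in> J)"
    by (rule not_regressive[OF P])
  show thesis
  proof (rule that[OF ok[OF x(1)]])
    show "y \<notin> underS l x" if "F (s(a \<mapsto> Raw x e)) a = Some (Plain y j d)" "j \<in> J" for y j d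
      using x(2) v[OF x(1)] that by simp
  qed
qed


text \<open>Choosing letters by \<open>node_not_regressive\<close> at every position gives a branch
  that survives since it is raw throughout. Its image has full length and no raw letters, so
  survival forces a good entry there; preservation of the next label turns this entry into one
  excluded by the choice.\<close>

lemma not_node_iso: "\<not> node_iso True False F"
proof
  assume F: "node_iso True False F"
  \<comment> \<open>Everything is phrased through the restriction of \<open>f\<close> below
    \<open>a\<close>, so that the recursion sees earlier values only. The value \<open>None\<close>
    off \<open>Field k\<close> makes the domain of the result exact.\<close>
  let ?P = "\<lambda>f a r. (a \<notin> Field k \<longrightarrow> r = None) \<and> (a \<in> Field k \<longrightarrow>
    (\<exists>x e. r = Some (Raw x e) \<and> ok True (f |` underS k a) a (Raw x e) \<and>
      (\<forall>y j d. F ((f |` underS k a)(a \<mapsto> Raw x e)) a = Some (Plain y j d) \<longrightarrow> j \<in> J \<longrightarrow> y \<notin> underS l x)))"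
  have "\<exists>f. \<forall>a. ?P f a (f a)"
  proof (rule dependent_wf_choice[OF wf_underS[OF wok]])
    fix f g :: "'k \<rightharpoonup> 'l letter" and a r
    assume "\<And>z. (z, a) \<in> {(a, b). a \<in> underS k b} \<Longrightarrow> f z = g z"
    then have "f |` underS k a = g |` underS k a" by (intro ext) (simp add: restrict_map_def)
    then show "?P f a r = ?P g a r" by simp
  next
    fix a and f :: "'k \<rightharpoonup> 'l letter"
    assume IH: "\<And>b. (b, a) \<in> {(a, b). a \<in> underS k b} \<Longrightarrow> ?P f b (f b)"
    show "\<exists>r. ?P f a r"
    proof (cases "a \<in> Field k")
      case False
      then show ?thesis by blast
    next
      case True
      let ?s = "f |` underS k a"
      have f: "\<exists>x e. f b = Some (Raw x e) \<and> ok True (f |` underS k b) b (Raw x e)"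
        if b: "b \<in> underS k a" for b
        using IH[of b] b underS_Field_both[OF b] by blast
      have "underS k a \<subseteq> dom f" using f by blast
      then have d: "dom ?s = underS k a" by auto
      have "ok True ?s b w" if w: "?s b = Some w" for b w
      proof -
        have b: "b \<in> underS k a" "f b = Some w" using w by (auto simp: restrict_map_def split: if_splits)
        then have "ok True (f |` underS k b) b w" using f[OF b(1)] by auto
        moreover have "ok True (f |` underS k b) b w = ok True ?s b w"
          using underS_trans[OF wok _ b(1)] by (intro ok_cong) simp
        ultimately show ?thesis by simp
      qed
      then have s: "?s \<in> nodes True" using d True unfolding nodes_def by blast
      have raw: "\<exists>x e. ?s b = Some (Raw x e)" if "b \<in> underS k a" for b using f[OF that] that by auto
      show ?thesis by (rule node_not_regressive[OF F s True d raw]) (use True in blast)+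
    qed
  qed
  then obtain f where f: "\<And>a. ?P f a (f a)" by blast
  obtain x e where raw: "\<And>a. a \<in> Field k \<Longrightarrow> f a = Some (Raw (x a) (e a))"
    and ok': "\<And>a. a \<in> Field k \<Longrightarrow> ok True (f |` underS k a) a (Raw (x a) (e a))"
    and reg: "\<And>a y j d. a \<in> Field k \<Longrightarrow>
      F ((f |` underS k a)(a \<mapsto> Raw (x a) (e a))) a = Some (Plain y j d) \<Longrightarrow> j \<in> J \<Longrightarrow> y \<notin> underS l (x a)"
  proof -
    have "f a = Some (Raw (arg (the (f a))) (lab (the (f a)))) \<and>
        ok True (f |` underS k a) a (Raw (arg (the (f a))) (lab (the (f a)))) \<and>
        (\<forall>y j d. F ((f |` underS k a)(a \<mapsto> Raw (arg (the (f a))) (lab (the (f a))))) a = Some (Plain y j d)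
          \<longrightarrow> j \<in> J \<longrightarrow> y \<notin> underS l (arg (the (f a))))"
      if a: "a \<in> Field k" for a
    proof -
      obtain z d where "f a = Some (Raw z d)" "ok True (f |` underS k a) a (Raw z d)"
        "\<forall>y j d'. F ((f |` underS k a)(a \<mapsto> Raw z d)) a = Some (Plain y j d') \<longrightarrow> j \<in> J \<longrightarrow> y \<notin> underS l z"
        using f[of a] a by blast
      then show ?thesis by simp
    qed
    then show thesis by (intro that[of "\<lambda>a. arg (the (f a))" "\<lambda>a. lab (the (f a))"]) blast+
  qed
  have none: "f a = None" if "a \<notin> Field k" for a using f[of a] that by blast
  have "a \<in> dom f \<longleftrightarrow> a \<in> Field k" for a using raw[of a] none[of a] by (cases "a \<in> Field k") auto
  then have dom: "dom f = Field k" by blast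
  have ok: "ok True f a (Raw (x a) (e a))" if a: "a \<in> Field k" for a
  proof -
    have "ok True (f |` underS k a) a (Raw (x a) (e a)) = ok True f a (Raw (x a) (e a))"
      by (rule ok_cong) simp
    then show ?thesis using ok'[OF a] by simp
  qed
  have fN: "f \<in> nodes True"
  proof -
    have "ok True f a w" if w: "f a = Some w" for a w
    proof -
      have a: "a \<in> Field k" using w dom by blast
      have "w = Raw (x a) (e a)" using raw[OF a] w by simp
      then show ?thesis using ok[OF a] by blast
    qed
    moreover have "survives f"
    proof -
      have "Field k \<noteq> {}" using Ck unfolding cinfinite_def by auto
      then obtain a where a: "a \<in> Field k" by blast
      show ?thesis
        unfolding survives_def
      proof (intro bexI[OF _ a] allI impI disjI1)
        fix b assume "(a, b) \<in> k"
        then have "b \<in> Field k" unfolding Field_def by blast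
        then show "\<exists>x e. f b = Some (Raw x e)" using raw by blast
      qed
    qed
    ultimately show ?thesis unfolding nodes_def mem_Collect_eq using dom by (intro conjI allI impI disjI1)
  qed
  note restrict = sequence_tree.restrict_node[OF sequence_tree_nodes fN]
  have drestrict: "dom (f |` underS k a) = underS k a" for a
  proof -
    have "underS k a \<subseteq> dom f" unfolding dom by (rule subsetI, rule underS_Field)
    then show ?thesis by auto
  qed
  let ?c = "F f"
  have cN: "?c \<in> nodes False" by (rule node_iso_in[OF F fN])
  have c: "F (f |` underS k a) = ?c |` underS k a" if a: "a \<in> Field k" for a
    by (rule node_iso_restrict[OF F fN restrict[OF a] _ a drestrict]) (simp add: map_le_def)
  have "Field k \<subseteq> dom ?c"
  proof
    fix a assume a: "a \<in> Field k"
    note na = nxt(2)[OF a]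
    have "dom (?c |` underS k (nxt a)) = underS k (nxt a)"
      using node_iso_dom[OF F restrict[OF na] na drestrict] unfolding c[OF na] .
    then show "a \<in> dom ?c" using nxt(1)[OF a] by auto
  qed
  then have "dom ?c = Field k" using nodes_dom_Field[OF cN] by blast
  then have "survives ?c" by (rule nodes_survives[OF cN])
  then obtain a where a: "a \<in> Field k"
    "\<forall>b. (a, b) \<in> k \<longrightarrow> (\<exists>x e. ?c b = Some (Raw x e)) \<or> good ?c b"
    unfolding survives_def by (rule bexE)
  have "(\<exists>x e. ?c a = Some (Raw x e)) \<or> good ?c a"
    by (rule mp[OF spec[OF a(2)] Well_order_refl[OF wok a(1)]])
  moreover have "?c a \<noteq> Some (Raw x e)" for x e using nodes_ok[OF cN, of a "Raw x e"] by auto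
  ultimately have "good ?c a" by blast
  then obtain y j d y' j' d' where g: "?c a = Some (Plain y j d)" "?c (nxt a) = Some (Plain y' j' d')"
    "j \<in> J" "y \<in> underS l d'"
    unfolding good_def by blast
  note na = nxt(2)[OF a(1)]
  note nna = nxt(2)[OF na]
  have step: "(f |` underS k a)(a \<mapsto> Raw (x a) (e a)) = f |` underS k (nxt a)"
  proof
    fix b
    have "underS k (nxt a) = underS k a \<union> {a}"
      unfolding nxt(3)[OF a(1)] by (rule Refl_under_underS[OF wo_rel.REFL[OF wo_rel_k] a(1)])
    then show "((f |` underS k a)(a \<mapsto> Raw (x a) (e a))) b = (f |` underS k (nxt a)) b"
      by (cases "b = a") (simp_all add: raw[OF a(1)] restrict_map_def)
  qed
  have "F ((f |` underS k a)(a \<mapsto> Raw (x a) (e a))) a = Some (Plain y j d)"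
    unfolding step c[OF na] using g(1) nxt(1)[OF a(1)] by simp
  then have "y \<notin> underS l (x a)" by (rule reg[OF a(1) _ g(3)])
  \<comment> \<open>The label after position \<open>a\<close> is preserved by \<open>F\<close>, and
    on the raw branch it equals the preceding point \<open>x a\<close>. Two further positions are
    kept so that the letter at \<open>nxt a\<close> is the last one of the restricted node.\<close>
  moreover have "d' = x a"
  proof -
    let ?t = "f |` underS k (nxt (nxt a))"
    have "?t (nxt a) = Some (Raw (x (nxt a)) (e (nxt a)))" using raw[OF na] nxt(1)[OF na] by simp
    then obtain w where w: "F ?t (nxt a) = Some w" "lab w = e (nxt a)"
      by (rule node_iso_main[OF F restrict[OF nna] na drestrict]) auto
    have "F ?t (nxt a) = Some (Plain y' j' d')"
      unfolding c[OF nna] using g(2) nxt(1)[OF na] by simp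
    then have "d' = e (nxt a)" using w by simp
    moreover have "x a = e (nxt a)"
    proof -
      obtain x' e' where "f a = Some (Raw x' e')" "nxt a = nxt a \<longrightarrow> x' = e (nxt a)"
        using ok[OF na] nxt(1)[OF a(1)] unfolding ok.simps by blast
      then show ?thesis using raw[OF a(1)] by simp
    qed
    ultimately show ?thesis by simp
  qed
  ultimately show False using g(4) by simp
qed

lemma not_isomorphic_nodes:
  "\<not> isomorphic (tree_struct (seq_order (nodes True))) (tree_struct (seq_order (nodes False)))"
proof
  assume "isomorphic (tree_struct (seq_order (nodes True))) (tree_struct (seq_order (nodes False)))"
  then obtain F where F: "bij_betw F (nodes True) (nodes False)"
    "\<forall>s\<in>nodes True. \<forall>t\<in>nodes True. (s, t) \<in> seq_order (nodes True) - Id \<longleftrightarrow>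
      (F s, F t) \<in> seq_order (nodes False) - Id"
    unfolding isomorphic_def tree_struct_def Field_seq_order fst_conv snd_conv by blast
  have "s \<subseteq>\<^sub>m t \<longleftrightarrow> F s \<subseteq>\<^sub>m F t" if s: "s \<in> nodes True" and t: "t \<in> nodes True" for s t
  proof (cases "s = t")
    case True
    then show ?thesis by simp
  next
    case False
    then have ne: "F s \<noteq> F t" using inj_onD[OF bij_betw_imp_inj_on[OF F(1)] _ s t] by blast
    have "F s \<in> nodes False" "F t \<in> nodes False" using bij_betwE[OF F(1)] s t by auto
    then show ?thesis using F(2) s t False ne unfolding seq_order_def by auto
  qed
  then have "node_iso True False F" using F(1) unfolding node_iso_def by blast
  then show False using not_node_iso by blast
qed


section \<open>The two trees as sets of points of \<open>l\<close>\<close>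

lemma card_Times_l: "|A| \<le>o l \<Longrightarrow> |B| \<le>o l \<Longrightarrow> |A \<times> B| \<le>o l"
  using card_of_Times_ordLeq_infinite_Field[of l A B] Cl unfolding cinfinite_def by blast

text \<open>Single entries, as pairs of position and letter, are at most \<open>l\<close> many and
  can be coded by points of \<open>l\<close>; a node becomes the set of codes of its entries. So the
  nodes fit into \<open>'l set\<close> however many there are.\<close>

lemma node_code:
  obtains \<psi> :: "('k \<rightharpoonup> 'l letter) \<Rightarrow> 'l set" where "\<And>r. inj_on \<psi> (nodes r)"
proof -
  let ?L = "{w :: 'l letter. set_letter w \<subseteq> Field l}"
  have "|Field k| <o l" using less_l_iff card_Field_k by blast
  then have "|Field k \<times> ?L| \<le>o l" by (rule card_Times_l[OF ordLess_imp_ordLeq card_letters])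
  then have "|Field k \<times> ?L| \<le>o |Field l|"
    using ordLeq_ordIso_trans[OF _ ordIso_symmetric[OF card_of_Field_ordIso[of l]]] Cl by blast
  then obtain \<phi> where \<phi>: "inj_on \<phi> (Field k \<times> ?L)" "\<phi> ` (Field k \<times> ?L) \<subseteq> Field l"
    using card_of_ordLeq[of "Field k \<times> ?L" "Field l"] by blast
  have sub: "Map.graph s \<subseteq> Field k \<times> ?L" if "s \<in> nodes r" for s r
  proof
    fix p assume "p \<in> Map.graph s"
    then obtain a w where p: "p = (a, w)" "s a = Some w" unfolding Map.graph_def by blast
    then have "a \<in> Field k" "w \<in> ran s" using nodes_dom_Field[OF that] by (auto simp: ran_def)
    then show "p \<in> Field k \<times> ?L" using ran_node[OF that] p(1) by blast
  qed
  have "inj_on (\<lambda>s. \<phi> ` Map.graph s) (nodes r)" for r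
  proof (rule inj_onI)
    fix s t assume st: "s \<in> nodes r" "t \<in> nodes r" "\<phi> ` Map.graph s = \<phi> ` Map.graph t"
    then have "Map.graph s = Map.graph t"
      using inj_on_image_eq_iff[OF \<phi>(1) sub[OF st(1)] sub[OF st(2)]] by blast
    then have "s a = Some w \<longleftrightarrow> t a = Some w" for a w unfolding Map.graph_def by blast
    then show "s = t" by (metis ext not_None_eq)
  qed
  then show thesis by (rule that)
qed

lemma card_nodes_lower: "l \<le>o |nodes r|"
proof -
  have e: "Map.empty \<in> nodes r" by (rule sequence_tree.empty_node[OF sequence_tree_nodes])
  then obtain a where a: "a \<in> Field k" "dom (Map.empty :: 'k \<rightharpoonup> 'l letter) = underS k a"
    using Ck unfolding nodes_def cinfinite_def by fastforce
  have ok: "ok r Map.empty a (Plain x star star)" if "x \<in> Field l" for x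
    using that star(1) a(2) by simp
  have "inj_on (\<lambda>x. [a \<mapsto> Plain x star star]) (Field l)"
    by (rule inj_onI) (metis fun_upd_same letter.inject(2) option.inject)
  moreover have "(\<lambda>x. [a \<mapsto> Plain x star star]) ` Field l \<subseteq> nodes r"
    using extend_node(1)[OF e a ok] by blast
  ultimately have "|Field l| \<le>o |nodes r|" using card_of_ordLeq[of "Field l" "nodes r"] by blast
  then show ?thesis using ordIso_ordLeq_trans[OF ordIso_symmetric[OF card_of_Field_ordIso[of l]]] Cl by blast
qed

text \<open>Shorter sequences are padded to length \<open>k\<close>, with \<open>None\<close>
  treated as one more letter.\<close>

lemma card_nodes_upper: "|nodes r| \<le>o l ^c k"
proof -
  let ?L = "insert None (Some ` {w :: 'l letter. set_letter w \<subseteq> Field l})"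
  have inf: "infinite (Field l)" and card: "Card_order l" using Cl unfolding cinfinite_def by auto
  have ne: "Field l \<noteq> {}" using inf by auto
  have "|{None :: 'l letter option}| \<le>o l"
    by (rule ordLeq_ordIso_trans[OF card_of_singl_ordLeq[OF ne] card_of_Field_ordIso[OF card]])
  then have "|{None} \<union> Some ` {w :: 'l letter. set_letter w \<subseteq> Field l}| \<le>o l"
    by (rule card_of_Un_ordLeq_infinite_Field[OF inf _ card_of_image_ordLeq[OF card_letters] card])
  then have "|?L| \<le>o |Field l|"
    using ordLeq_ordIso_trans[OF _ ordIso_symmetric[OF card_of_Field_ordIso[OF card]]] by simp
  then obtain \<phi> where \<phi>: "inj_on \<phi> ?L" "\<phi> ` ?L \<subseteq> Field l" using card_of_ordLeq[of ?L "Field l"] by blast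
  let ?h = "\<lambda>s a. if a \<in> Field k then \<phi> (s a) else undefined"
  have L: "s a \<in> ?L" if s: "s \<in> nodes r" for s a
  proof (cases "s a")
    case (Some w)
    then have "w \<in> ran s" by (rule ranI)
    then show ?thesis using ran_node[OF s] Some by blast
  qed simp
  have "inj_on ?h (nodes r)"
  proof (rule inj_onI)
    fix s t assume s: "s \<in> nodes r" and t: "t \<in> nodes r" and eq: "?h s = ?h t"
    show "s = t"
    proof
      fix a show "s a = t a"
      proof (cases "a \<in> Field k")
        case True
        then have "\<phi> (s a) = \<phi> (t a)" using fun_cong[OF eq, of a] by simp
        then show ?thesis by (rule inj_onD[OF \<phi>(1) _ L[OF s] L[OF t]])
      next
        case False
        then have "a \<notin> dom s" "a \<notin> dom t" using nodes_dom_Field[OF s] nodes_dom_Field[OF t] by blast+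
        then show ?thesis by (simp add: domIff)
      qed
    qed
  qed
  moreover have "?h ` nodes r \<subseteq> Func (Field k) (Field l)"
  proof (rule image_subsetI)
    fix s assume s: "s \<in> nodes r"
    have "\<phi> (s a) \<in> Field l" for a using \<phi>(2) L[OF s, of a] by blast
    then show "?h s \<in> Func (Field k) (Field l)" unfolding Func_def by simp
  qed
  ultimately show ?thesis
    unfolding cexp_def using card_of_ordLeq[of "nodes r" "Func (Field k) (Field l)"] by blast
qed

lemma EF_equiv_nodes:
  fixes \<psi> :: "('k \<rightharpoonup> 'l letter) \<Rightarrow> 'l set"
  assumes inj: "\<And>r. inj_on \<psi> (nodes r)"
  shows "EF_equiv l clock (tree_struct (dir_image (seq_order (nodes True)) \<psi>))
    (tree_struct (dir_image (seq_order (nodes False)) \<psi>))"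
proof (rule EF_equiv_by_commitments)
  let ?T = "\<lambda>r. tree_struct (dir_image (seq_order (nodes r)) \<psi>)"
  let ?rk = "\<lambda>r a. rank (the_inv_into (nodes r) \<psi> a)"
  let ?f = "\<lambda>I. map_prod \<psi> \<psi> ` translate_graph I"
  have inj': "inj_on \<psi> (Field (seq_order (nodes r)))" for r unfolding Field_seq_order by (rule inj)
  have fst: "fst (?T r) = \<psi> ` nodes r" for r
    unfolding tree_struct_def dir_image_Field Field_seq_order by simp
  have inv: "the_inv_into (nodes r) \<psi> (\<psi> s) = s" if "s \<in> nodes r" for r s
    by (rule the_inv_into_f_f[OF inj that])
  have rk: "?rk r a \<in> Field l" if "a \<in> fst (?T r)" for r a
    using that rank(1) inv unfolding fst by auto
  show "?rk True a \<in> Field l" if "a \<in> fst (?T True)" for a by (rule rk[OF that])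
  show "?rk False a \<in> Field l" if "a \<in> fst (?T False)" for a by (rule rk[OF that])
  show "partial_iso (?T True) (?T False) (?f I)" if "I \<subseteq> Field l" "|bad I| <o k" for I
    by (rule partial_iso_dir_image[OF inj' inj' partial_iso_trans_graph[OF that]])
  show "\<exists>b. (a, b) \<in> ?f I"
    if I: "I \<subseteq> Field l" "|bad I| <o k" and a: "a \<in> fst (?T True)" and i: "i \<in> I" "?rk True a \<in> underS l i"
    for I a i
  proof -
    obtain s where s: "a = \<psi> s" "s \<in> nodes True" using a unfolding fst by blast
    have "bounded I s" by (rule rank(2)[OF s(2) i(1)]) (use i(2) s inv in simp)
    then have "(s, translate I s) \<in> translate_graph I" using s(2) unfolding translate_graph_def by blast
    then show ?thesis using s(1) by force
  qed
  show "\<exists>a. (a, b) \<in> ?f I"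
    if I: "I \<subseteq> Field l" "|bad I| <o k" and b: "b \<in> fst (?T False)" and i: "i \<in> I" "?rk False b \<in> underS l i"
    for I b i
  proof -
    obtain c where c: "b = \<psi> c" "c \<in> nodes False" using b unfolding fst by blast
    have "bounded I c" by (rule rank(2)[OF c(2) i(1)]) (use i(2) c inv in simp)
    then obtain s where "s \<in> nodes True" "bounded I s" "translate I s = c" by (rule translate_surj[OF I c(2)])
    then have "(s, c) \<in> translate_graph I" unfolding translate_graph_def by blast
    then show ?thesis using c(1) by force
  qed
  show "?f I \<subseteq> ?f I'"
    if "I \<subseteq> I'" "I' \<subseteq> Field l" "\<And>i i'. i \<in> I \<Longrightarrow> i' \<in> I' - I \<Longrightarrow> i \<in> underS l i'" for I I'
    by (rule image_mono[OF translate_graph_extend[OF that]])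
qed

lemma exists_trees:
  "\<exists>(I0 :: 'l set rel) (I1 :: 'l set rel).
     wide_tree l k I0 \<and> wide_tree l k I1 \<and>
     \<not> isomorphic (tree_struct I0) (tree_struct I1) \<and>
     EF_equiv l clock (tree_struct I0) (tree_struct I1) \<and>
     (l ^c k =o l \<longrightarrow> |Field I0| =o l \<and> |Field I1| =o l)"
proof -
  obtain \<psi> :: "('k \<rightharpoonup> 'l letter) \<Rightarrow> 'l set" where inj: "\<And>r. inj_on \<psi> (nodes r)"
    using node_code by blast
  let ?I = "\<lambda>r. dir_image (seq_order (nodes r)) \<psi>"
  have inj': "inj_on \<psi> (Field (seq_order (nodes r)))" for r unfolding Field_seq_order by (rule inj)
  have "|Field (?I r)| =o l" if lk: "l ^c k =o l" for r
  proof -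
    have F: "Field (?I r) = \<psi> ` nodes r" unfolding dir_image_Field Field_seq_order ..
    have "|Field (?I r)| \<le>o l"
      unfolding F by (rule card_of_image_ordLeq[OF ordLeq_ordIso_trans[OF card_nodes_upper lk]])
    moreover have "|nodes r| =o |\<psi> ` nodes r|"
      using card_of_ordIsoI[of \<psi> "nodes r" "\<psi> ` nodes r"] inj[of r] unfolding bij_betw_def by blast
    then have "l \<le>o |Field (?I r)|" unfolding F by (rule ordLeq_ordIso_trans[OF card_nodes_lower])
    ultimately show ?thesis unfolding ordIso_iff_ordLeq by (rule conjI)
  qed
  moreover have "wide_tree l k (?I r)" for r by (rule wide_tree_dir_image[OF wide_tree_nodes inj'])
  moreover have "\<not> isomorphic (tree_struct (?I True)) (tree_struct (?I False))"
    using isomorphic_dir_imageD[OF inj' inj'] not_isomorphic_nodes by blast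
  moreover have "EF_equiv l clock (tree_struct (?I True)) (tree_struct (?I False))"
    by (rule EF_equiv_nodes[OF inj])
  ultimately show ?thesis by blast
qed

end

lemma (in successor_cardinal) letters_exist: "\<exists>J star. letters l m k J star"
proof -
  have "|Field m| <o l" using less_l_iff card_Field_m by blast
  then have "|Field m| \<le>o |Field l|"
    using ordLeq_ordIso_trans[OF ordLess_imp_ordLeq ordIso_symmetric[OF card_of_Field_ordIso[of l]]] Cl by blast
  then obtain g where g: "inj_on g (Field m)" "g ` Field m \<subseteq> Field l"
    using card_of_ordLeq[of "Field m" "Field l"] by blast
  have "|Field m| =o |g ` Field m|"
    using card_of_ordIsoI[of g "Field m" "g ` Field m"] g(1) unfolding bij_betw_def by blast
  then have J: "|g ` Field m| =o m"
    using ordIso_transitive[OF ordIso_symmetric card_of_Field_ordIso[of m]] Cm by blast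
  \<comment> \<open>A strict upper bound of the chosen copy of \<open>m\<close> lies outside it and
    serves as \<open>star\<close>.\<close>
  obtain b where b: "b \<in> Field l" "g ` Field m \<subseteq> underS l b"
    by (rule bounded_l[OF g(2) ordIso_imp_ordLeq[OF J]])
  then have "b \<notin> g ` Field m" using underS_notIn by fast
  then have "letters l m k (g ` Field m) b" using g(2) J b(1) by unfold_locales
  then show ?thesis by blast
qed

theorem mainTheorem1:
  fixes l :: "'l rel" and m :: "'m rel" and k :: "'k rel"
  assumes "Cinfinite l" and "Cinfinite m" and "Cinfinite k"
    and "l =o cardSuc m"
    and "regularCard m"
    and "regularCard k" and "k \<le>o m"
    and "l ^<c k =o l"
  shows "(\<exists>(I0 :: 'l set rel) (I1 :: 'l set rel).
            wide_tree l k I0 \<and> wide_tree l k I1 \<and>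
            \<not> isomorphic (tree_struct I0) (tree_struct I1) \<and>
            EF_equiv l (ord_prod m k) (tree_struct I0) (tree_struct I1)) \<and>
         (l ^c k =o l \<longrightarrow>
          (\<exists>(I0 :: 'l set rel) (I1 :: 'l set rel).
            wide_tree l k I0 \<and> wide_tree l k I1 \<and>
            \<not> isomorphic (tree_struct I0) (tree_struct I1) \<and>
            EF_equiv l (ord_prod m k) (tree_struct I0) (tree_struct I1) \<and>
            |Field I0| =o l \<and> |Field I1| =o l))"
proof -
  interpret successor_cardinal l m k
    using assms by unfold_locales
  obtain J star where "letters l m k J star" using letters_exist by blast
  then interpret letters l m k J star .
  show ?thesis using exists_trees by blast
qed

end
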